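(* Consider pairs $(u,a)$ with $u:\mathbb R\to\mathbb R$ and $a>0$. Begin with $(u,a)=(\log\cosh,1)$, and perform finitely many operations of either of the following forms: (1) for some $r\ge0$, replace $u$ by $T_{a,r}u$, leaving $a$ unchanged; (2) for some $b\in(0,a)$, replace $a$ by $b$, leaving $u$ unchanged. For every pair $(u,a)$ obtained in this way, the functions $C,K,J$ of the slope variable $B$ associated with $(u,a)$ satisfy \[ K\ge0,\qquad K_B\ge0,\qquad J\ge0,\qquad J_B\ge0,\qquad (C^{3/2}J)_B\le0 \] for $0\le B<1$. In particular, if \[ z=-\tfrac12C_B=(a+K)B, \] then \[ CJ_B\le 3zJ \] for $0\le B<1$.
   Context: For $r\ge0$, $P_rg(x)=\mathbb E\,g(x+\sqrt r\,Z)$ with $Z$ standard Gaussian, and for $a>0$, \[ T_{a,r}\phi(x)=\frac1a\log P_r\bigl(\mathrm e^{a\phi}\bigr)(x). \] Every function $u$ obtained from $\log\cosh$ by finitely many such transforms is even, $C^\infty$, has $u''>0$ everywhere and $-1<u'<1$ with $u'(x)\to\pm1$ as $x\to\pm\infty$; hence $x\mapsto B=u'(x)$ is a smooth increasing bijection $\mathbb R\to(-1,1)$. The curvature $C$ is regarded as a function of $B$: $C(B)=u''(x)$ where $u'(x)=B$. It is even and smooth on $(-1,1)$. Subscripts $B$ denote derivatives in $B$. Define, for $B\neq0$, \[ A=-\frac{C_B}{2B},\qquad K=A-a,\qquad J=-a-\tfrac12C_{BB}; \] since $C$ is even and smooth, $C_B/B$ extends smoothly through $B=0$, and $A,K,J$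 are defined at $B=0$ by this extension. *)

theory Defs
  imports "HOL-Probability.Probability"
begin

definition gauss_avg :: "real \<Rightarrow> (real \<Rightarrow> real) \<Rightarrow> real \<Rightarrow> real" where
  "gauss_avg r g x = (LINT z|std_normal_distribution. g (x + sqrt r * z))"

definition log_transform :: "real \<Rightarrow> real \<Rightarrow> (real \<Rightarrow> real) \<Rightarrow> real \<Rightarrow> real" where
  "log_transform a r \<phi> x = 1 / a * ln (gauss_avg r (\<lambda>y. exp (a * \<phi> y)) x)"

inductive obtainable :: "(real \<Rightarrow> real) \<Rightarrow> real \<Rightarrow> bool" where
  start: "obtainable (\<lambda>x. ln (cosh x)) 1"
| transform: "obtainable u a \<Longrightarrow> r \<ge> 0 \<Longrightarrow> obtainable (log_transform a r u) a"
| lower: "obtainable u a \<Longrightarrow> b \<in> {0<..<a} \<Longrightarrow> obtainable u b"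

text \<open>
  For obtainable \<open>u\<close> the slope \<open>u'\<close> is a bijection from the reals onto the open interval
  \<open>(-1, 1)\<close>. The quantities below are functions of the slope \<open>B\<close> and are meaningful only for
  \<open>-1 < B < 1\<close>; derivatives of them are derivatives in \<open>B\<close>, two-sided also at \<open>B = 0\<close>.
\<close>

definition slope_point :: "(real \<Rightarrow> real) \<Rightarrow> real \<Rightarrow> real" where
  "slope_point u B = (THE x. deriv u x = B)"

definition curv :: "(real \<Rightarrow> real) \<Rightarrow> real \<Rightarrow> real" where
  "curv u B = deriv (deriv u) (slope_point u B)"

text \<open>The value at \<open>B = 0\<close> is the continuous extension of the quotient.\<close>

definition A_of :: "(real \<Rightarrow> real) \<Rightarrow> real \<Rightarrow> real" where
  "A_of u B = (if B = 0 then Lim (at 0) (\<lambda>b. - deriv (curv u) b / (2 * b))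
               else - deriv (curv u) B / (2 * B))"

definition K_of :: "(real \<Rightarrow> real) \<Rightarrow> real \<Rightarrow> real \<Rightarrow> real" where
  "K_of u a B = A_of u B - a"

definition J_of :: "(real \<Rightarrow> real) \<Rightarrow> real \<Rightarrow> real \<Rightarrow> real" where
  "J_of u a B = - a - 1 / 2 * deriv (deriv (curv u)) B"

end

(*
  Let u(t) = T_{a,t} u, B = u' and C = u''. By the Hopf-Cole transform exp (a u(t)) solves the heat
  equation, so the t-derivative of u is (u'' + a u'^2) / 2, and as a function of (t, B) the
  curvature has t-derivative - C^2 J. In the variables (t, x), put z = - u''' / (2 u''), Y = C J,
  R = C^2 J_B and Q = 3 z Y - R. With L f = f_t - f'' / 2 - a u' f',
    L (C Y) = - 2 Y (C Y),
    L (C R) = - (3 a C + 8 Y) (C R) + 12 z C Y (a C + Y),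
    L (C Q) = - 5 Y (C Q) + 3 z C Y^2.
  All three functions are O(exp (- 2 |x|)), so the maximum principle gives first Y >= 0 on the line,
  hence z >= 0 for x >= 0, and then R >= 0 and Q >= 0 on the half-line, where the odd functions
  C R and C Q vanish at 0. Lowering a adds a nonnegative multiple of C to Y and of z C to Q, and
  leaves R unchanged. For log cosh and a = 1 all three vanish. The claims on K follow from
  (B K)_B = J.
*)
theory Submission
  imports Defs "HOL-Real_Asymp.Real_Asymp"
begin

section \<open>Differentiation under the integral and a maximum principle\<close>

text \<open>The factor \<open>C\<close> in the three functions is there for decay. \<open>Y\<close>,
  \<open>R\<close> and \<open>Q\<close> are polynomials in \<open>a\<close>, \<open>u''\<close> and
  the ratios \<open>u^(k) / u''\<close>, of which only boundedness is established; multiplication by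
  \<open>C\<close> supplies the factor \<open>exp (- 2 * |x|)\<close> that makes negative minima
  exist. Bounded ratios need upper bounds on the higher derivatives and a lower bound on
  \<open>u''\<close> at the same exponential rate, uniformly in \<open>t\<close>, so the induction
  has to carry both; they are part of the invariant \<open>tame\<close>. The obstacle is that these
  bounds are nonlinear in \<open>u\<close>, whereas only \<open>w = exp (a * u)\<close> evolves
  linearly. For the upper bounds one averages \<open>w^(k+1) - a w^(k)\<close>, which is linear in
  \<open>w\<close> and relatively small near plus infinity, where \<open>w\<close> grows like
  \<open>exp (a * x)\<close>; the estimate uses \<open>a \<le> 1\<close>, an invariant of the pairs.
  The lower bound comes from writing \<open>a u'' W\<close> for the evolved \<open>u\<close> as the
  average of a positive function. Seven derivatives occur, since \<open>R\<close> and
  \<open>Q\<close> contain five and the heat operator adds two. Time derivatives are taken at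
  positive \<open>t\<close> only; at \<open>t = 0\<close> joint continuity suffices.\<close>

lemma has_real_derivative_integral_dominated:
  fixes f :: "real \<Rightarrow> 'a \<Rightarrow> real"
  assumes e: "e > 0"
    and der: "\<And>x w. \<bar>x - x0\<bar> < e \<Longrightarrow> ((\<lambda>x. f x w) has_real_derivative f' x w) (at x)"
    and int: "\<And>x. \<bar>x - x0\<bar> < e \<Longrightarrow> integrable M (f x)"
    and bound: "\<And>x w. \<bar>x - x0\<bar> < e \<Longrightarrow> \<bar>f' x w\<bar> \<le> g w"
    and g: "integrable M g"
    and meas: "f' x0 \<in> borel_measurable M"
  shows "((\<lambda>x. LINT w|M. f x w) has_real_derivative (LINT w|M. f' x0 w)) (at x0)"
  unfolding has_field_derivative_iff tendsto_at_iff_sequentially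
proof (intro allI impI)
  fix X :: "nat \<Rightarrow> real"
  assume ne: "\<forall>i. X i \<in> UNIV - {x0}" and lim: "X \<longlonglongrightarrow> x0"
  let ?D = "\<lambda>x w. (f x w - f x0 w) / (x - x0)"
  from lim e have ev: "eventually (\<lambda>n. \<bar>X n - x0\<bar> < e) sequentially"
    by (metis (no_types, lifting) dist_real_def eventually_mono tendstoD)
  then obtain N where N: "\<And>n. n \<ge> N \<Longrightarrow> \<bar>X n - x0\<bar> < e"
    by (auto simp: eventually_sequentially)
  \<comment> \<open>Dropping the first \<open>N\<close> terms puts the whole sequence within
    \<open>e\<close> of \<open>x0\<close>; there the mean value theorem bounds every difference
    quotient by \<open>g\<close>, so dominated convergence applies.\<close>
  have "(\<lambda>n. LINT w|M. ?D (X (n + N)) w) \<longlonglongrightarrow> (LINT w|M. f' x0 w)"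
  proof (rule integral_dominated_convergence[where w = g])
    show "(\<lambda>w. ?D (X (n + N)) w) \<in> borel_measurable M" for n
      using int[of "X (n + N)"] int[of x0] N[of "n + N"] e by auto
    show "AE w in M. (\<lambda>n. ?D (X (n + N)) w) \<longlonglongrightarrow> f' x0 w"
    proof (rule AE_I2)
      fix w
      have "((\<lambda>x. ?D x w) \<longlongrightarrow> f' x0 w) (at x0)"
        using der[of x0 w] e by (simp add: has_field_derivative_iff)
      then have "((\<lambda>x. ?D x w) \<circ> X) \<longlonglongrightarrow> f' x0 w"
        using ne lim unfolding tendsto_at_iff_sequentially by blast
      then show "(\<lambda>n. ?D (X (n + N)) w) \<longlonglongrightarrow> f' x0 w"
        unfolding o_def by (rule LIMSEQ_ignore_initial_segment)
    qed
    show "AE w in M. norm (?D (X (n + N)) w) \<le> g w" for n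
    proof (rule AE_I2)
      fix w
      let ?x = "X (n + N)"
      have xe: "\<bar>?x - x0\<bar> < e" using N by simp
      have "convex {x0 - e <..< x0 + e}" by simp
      then have "norm (f ?x w - f x0 w) \<le> g w * norm (?x - x0)"
        by (rule field_differentiable_bound[where f' = "\<lambda>x. f' x w"])
          (use der bound xe e in \<open>auto simp: abs_less_iff has_field_derivative_at_within\<close>)
      then show "norm (?D ?x w) \<le> g w"
        using ne by (simp add: field_simps)
    qed
  qed (use meas g in auto)
  moreover have "(LINT w|M. ?D (X (n + N)) w)
      = ((LINT w|M. f (X (n + N)) w) - (LINT w|M. f x0 w)) / (X (n + N) - x0)" for n
  proof -
    have "integrable M (f (X (n + N)))" "integrable M (f x0)"
      using int[of "X (n + N)"] int[of x0] N[of "n + N"] e by simp_all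
    then show ?thesis by (simp only: integral_divide_zero Bochner_Integration.integral_diff)
  qed
  ultimately have "(\<lambda>n. ((LINT w|M. f (X (n + N)) w) - (LINT w|M. f x0 w)) / (X (n + N) - x0))
      \<longlonglongrightarrow> (LINT w|M. f' x0 w)" by (simp only:)
  from LIMSEQ_offset[OF this]
  show "((\<lambda>x. ((LINT w|M. f x w) - (LINT w|M. f x0 w)) / (x - x0)) \<circ> X) \<longlonglongrightarrow> (LINT w|M. f' x0 w)"
    by (simp add: o_def)
qed

text \<open>If \<open>f2\<close> were negative, \<open>f1\<close> would be negative immediately to
  the right of its zero \<open>x\<close>, and the mean value theorem would give smaller values of
  \<open>f\<close> there.\<close>

lemma second_derivative_nonneg_at_local_min:
  fixes f :: "real \<Rightarrow> real"
  assumes d: "d > 0" and min: "\<And>y. \<bar>y - x\<bar> < d \<Longrightarrow> f x \<le> f y"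
    and f1: "\<And>y. (f has_real_derivative f1 y) (at y)"
    and f2: "(f1 has_real_derivative f2) (at x)"
  shows "f1 x = 0" "f2 \<ge> 0"
proof -
  show z: "f1 x = 0"
    by (rule DERIV_local_min[OF f1 d]) (use min in \<open>auto simp: abs_minus_commute\<close>)
  show "f2 \<ge> 0"
  proof (rule ccontr)
    assume "\<not> f2 \<ge> 0"
    then obtain e where e: "e > 0" "\<And>h. h > 0 \<Longrightarrow> h < e \<Longrightarrow> f1 x > f1 (x + h)"
      using DERIV_neg_dec_right[OF f2] by auto
    define h where "h = min d e / 2"
    have h: "h > 0" "h < d" "h < e" using d e by (auto simp: h_def)
    have "\<exists>y. x < y \<and> y < x + h \<and> f (x + h) - f x = (x + h - x) * f1 y"
      by (rule MVT2) (use h f1 in auto)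
    then obtain y where y: "x < y" "y < x + h" "f (x + h) - f x = h * f1 y" by auto
    have "f1 y < 0" using e(2)[of "y - x"] y h z by auto
    then have "f (x + h) < f x" using y h
      by (metis diff_less_0_iff_less mult_pos_neg)
    then show False using min[of "x + h"] h by auto
  qed
qed

text \<open>At a negative minimum of \<open>exp (- l * t) * F t x\<close> with \<open>l > L\<close> the hypothesis contradicts the
  sign of the time derivative; the decay in \<open>x\<close> makes the minimum exist.\<close>

lemma parabolic_nonneg:
  fixes F :: "real \<Rightarrow> real \<Rightarrow> real" and S :: "real set"
  assumes S: "closed S"
    and cont: "continuous_on ({0..T} \<times> S) (\<lambda>p. F (fst p) (snd p))"
    and decay: "\<And>t x. t \<in> {0..T} \<Longrightarrow> x \<in> S \<Longrightarrow> F t x \<ge> - M * exp (- 2 * \<bar>x\<bar>)"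
    and init: "\<And>x. x \<in> S \<Longrightarrow> F 0 x \<ge> 0"
    and bdry: "\<And>t x. t \<in> {0<..T} \<Longrightarrow> x \<in> S \<Longrightarrow> F t x < 0 \<Longrightarrow> x \<in> interior S"
    and F1: "\<And>t x. t \<in> {0<..T} \<Longrightarrow> (F t has_real_derivative F1 t x) (at x)"
    and F2: "\<And>t x. t \<in> {0<..T} \<Longrightarrow> (F1 t has_real_derivative F2 t x) (at x)"
    and Ft: "\<And>t x. t \<in> {0<..T} \<Longrightarrow> ((\<lambda>s. F s x) has_real_derivative Ft t x) (at t)"
    and ineq: "\<And>t x. t \<in> {0<..T} \<Longrightarrow> x \<in> S \<Longrightarrow> F t x < 0 \<Longrightarrow> F1 t x = 0 \<Longrightarrow> F2 t x \<ge> 0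
        \<Longrightarrow> Ft t x \<ge> L * F t x"
    and t0: "t0 \<in> {0..T}" and x0: "x0 \<in> S"
  shows "F t0 x0 \<ge> 0"
proof (rule ccontr)
  assume neg: "\<not> F t0 x0 \<ge> 0"
  \<comment> \<open>The absolute value makes \<open>l\<close> positive besides exceeding
    \<open>L\<close>: then \<open>exp (- l * t) \<le> 1\<close>, and the decay bound for
    \<open>F\<close> passes to \<open>G\<close>.\<close>
  define l where "l = \<bar>L\<bar> + 1"
  define G where "G t x = exp (- l * t) * F t x" for t x
  have l: "l > 0" "l > L" by (auto simp: l_def)
  have G0: "G t0 x0 < 0" using neg by (simp add: G_def mult_pos_neg)
  define e where "e = - G t0 x0"
  have e: "e > 0" using G0 by (simp add: e_def)
  have "((\<lambda>x::real. \<bar>M\<bar> * exp (- 2 * x)) \<longlongrightarrow> 0) at_top" by real_asymp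
  then have "eventually (\<lambda>x. \<bar>M\<bar> * exp (- 2 * x) < e) at_top"
    using e by (rule order_tendstoD)
  then obtain X where X: "\<And>x. x \<ge> X \<Longrightarrow> \<bar>M\<bar> * exp (- 2 * x) < e"
    by (auto simp: eventually_at_top_linorder)
  \<comment> \<open>Including \<open>x0\<close> makes the box below nonempty, and outside the box
    \<open>G\<close> exceeds \<open>G t0 x0\<close>; hence the minimum over the box is one over all
    of \<open>S\<close>.\<close>
  define X' where "X' = max X \<bar>x0\<bar>"
  have far: "G t x > G t0 x0" if "t \<in> {0..T}" "x \<in> S" "\<bar>x\<bar> \<ge> X" for t x
  proof -
    have "- (\<bar>M\<bar> * exp (- 2 * \<bar>x\<bar>)) \<le> F t x"
    proof -
      have "M * exp (- 2 * \<bar>x\<bar>) \<le> \<bar>M\<bar> * exp (- 2 * \<bar>x\<bar>)"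
        by (intro mult_right_mono abs_ge_self) simp
      then show ?thesis using decay[OF that(1,2)] by linarith
    qed
    then have "- e < F t x" using X[OF that(3)] by linarith
    moreover have "exp (- l * t) \<le> 1" using l that by auto
    ultimately have "- e < exp (- l * t) * F t x"
    proof (cases "F t x \<ge> 0")
      case True then show ?thesis using e by (meson le_less_trans less_le_trans mult_nonneg_nonneg
        exp_ge_zero neg_less_0_iff_less)
    next
      case False
      then have "exp (- l * t) * F t x \<ge> 1 * F t x"
        using \<open>exp (- l * t) \<le> 1\<close> by (intro mult_right_mono_neg) auto
      then show ?thesis using \<open>- e < F t x\<close> by linarith
    qed
    then show ?thesis by (simp add: G_def e_def)
  qed
  let ?K = "{0..T} \<times> (S \<inter> {-X'..X'})"
  have "compact ?K"
    by (intro compact_Times compact_Icc closed_Int_compact S)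
  moreover have "- X' \<le> x0" "x0 \<le> X'" unfolding X'_def by linarith+
  then have K0: "(t0, x0) \<in> ?K" using t0 x0 by auto
  then have "?K \<noteq> {}" by blast
  moreover have "continuous_on ?K (\<lambda>p. G (fst p) (snd p))"
    unfolding G_def
    by (intro continuous_intros continuous_on_subset[OF cont]) auto
  ultimately obtain p where p: "p \<in> ?K" and pmin: "\<And>q. q \<in> ?K \<Longrightarrow> G (fst p) (snd p) \<le> G (fst q) (snd q)"
    using continuous_attains_inf[of ?K "\<lambda>p. G (fst p) (snd p)"] by blast
  obtain t x where tx: "p = (t, x)" by (cases p)
  have t: "t \<in> {0..T}" and x: "x \<in> S" using p tx by auto
  have Gle: "G t x \<le> G t0 x0"
    using pmin[OF K0] by (simp add: tx)
  have min: "G t x \<le> G s y" if "s \<in> {0..T}" "y \<in> S" for s y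
  proof (cases "\<bar>y\<bar> \<le> X'")
    case True then show ?thesis using pmin[of "(s, y)"] that by (auto simp: tx abs_le_iff)
  next
    case False
    then have "\<bar>y\<bar> \<ge> X" by (simp add: X'_def)
    then show ?thesis using far[OF that] Gle by linarith
  qed
  have Gneg: "G t x < 0" using Gle G0 by linarith
  then have Fneg: "F t x < 0" by (simp add: G_def mult_less_0_iff)
  have tpos: "t \<in> {0<..T}" using t init[OF x] Fneg by (cases "t = 0") auto
  have "x \<in> interior S" using bdry[OF tpos x Fneg] .
  then obtain d where d: "d > 0" "ball x d \<subseteq> S" by (auto simp: mem_interior)
  have Fmin: "F t x \<le> F t y" if "\<bar>y - x\<bar> < d" for y
  proof -
    have "y \<in> S" using d that by (auto simp: dist_real_def abs_minus_commute)
    then show ?thesis using min[OF t, of y] by (simp add: G_def)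
  qed
  have F10: "F1 t x = 0" and F20: "F2 t x \<ge> 0"
    using second_derivative_nonneg_at_local_min[OF d(1) Fmin F1[OF tpos] F2[OF tpos]] by auto
  have Ftge: "Ft t x \<ge> L * F t x" using ineq[OF tpos x Fneg F10 F20] .
  have "((\<lambda>s. G s x) has_real_derivative (exp (- l * t) * (Ft t x - l * F t x))) (at t)"
    unfolding G_def by (auto intro!: derivative_eq_intros Ft[OF tpos] simp: algebra_simps)
  \<comment> \<open>A strictly positive time derivative means that \<open>G\<close> was smaller
    slightly earlier, against minimality; \<open>t > 0\<close> leaves room for the earlier
    time.\<close>
  moreover have "exp (- l * t) * (Ft t x - l * F t x) > 0"
  proof -
    have "(L - l) * F t x > 0" using l Fneg by (intro mult_neg_neg) auto
    then show ?thesis using Ftge by (simp add: algebra_simps)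
  qed
  ultimately obtain h where h: "h > 0" "\<And>k. k > 0 \<Longrightarrow> k < h \<Longrightarrow> G (t - k) x < G t x"
    using DERIV_pos_inc_left by blast
  define k where "k = min h t / 2"
  have "k > 0" "k < h" "t - k \<in> {0..T}" using h tpos by (auto simp: k_def)
  then show False using h(2)[of k] min[of "t - k" x] x by auto
qed

section \<open>Gaussian averages of functions of exponential growth\<close>

lemma exp_abs_le_sum: "exp (c * \<bar>z\<bar>) \<le> exp (c * z) + exp (- c * z)" for c z :: real
  by (cases "z \<ge> 0") auto

text \<open>Completing the square turns the product with the standard density into
  \<open>exp (c\<^sup>2 / 2)\<close> times the normal density with mean \<open>c\<close>.\<close>

lemma integrable_std_normal_exp: "integrable std_normal_distribution (\<lambda>z. exp (c * z))"
  and integral_std_normal_exp: "(LINT z|std_normal_distribution. exp (c * z)) = exp (c\<^sup>2 / 2)"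
proof -
  have eq: "std_normal_density z * exp (c * z) = exp (c\<^sup>2 / 2) * normal_density c 1 z" for z
    by (simp add: std_normal_density_def normal_density_def flip: exp_add)
      (simp add: power2_eq_square field_simps)
  show "integrable std_normal_distribution (\<lambda>z. exp (c * z))"
    by (subst integrable_density) (auto simp: eq)
  show "(LINT z|std_normal_distribution. exp (c * z)) = exp (c\<^sup>2 / 2)"
    by (subst integral_density) (auto simp: eq)
qed

lemma integrable_std_normal_exp_abs:
  "integrable std_normal_distribution (\<lambda>z. exp (c * \<bar>z\<bar>))"
proof (rule Bochner_Integration.integrable_bound)
  show "integrable std_normal_distribution (\<lambda>z. exp (c * z) + exp (- c * z))"
    by (intro Bochner_Integration.integrable_add integrable_std_normal_exp)
  show "AE z in std_normal_distribution. norm (exp (c * \<bar>z\<bar>)) \<le> norm (exp (c * z) + exp (- c * z))"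
    using exp_abs_le_sum[of c] by (intro AE_I2) (auto intro: order_trans[OF _ abs_ge_self])
qed auto

text \<open>The bound is uniform for \<open>x\<close> and \<open>s\<close> in bounded sets; it
  provides the integrable majorants for limits under the Gaussian integral.\<close>

lemma exp_growth_affine:
  fixes c :: real
  assumes "c \<ge> 0" "\<And>y. \<bar>f y\<bar> \<le> M * exp (c * \<bar>y\<bar>)" "\<bar>s\<bar> \<le> S" "\<bar>x\<bar> \<le> X"
  shows "\<bar>f (x + s * z)\<bar> \<le> M * exp (c * X) * exp (c * S * \<bar>z\<bar>)"
proof -
  have M: "M \<ge> 0" using assms(2)[of 0] by auto
  have "\<bar>x + s * z\<bar> \<le> X + S * \<bar>z\<bar>"
    using abs_triangle_ineq[of x "s * z"] assms mult_right_mono[of "\<bar>s\<bar>" S "\<bar>z\<bar>"]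
    by (simp add: abs_mult)
  then have "c * \<bar>x + s * z\<bar> \<le> c * X + c * S * \<bar>z\<bar>"
    using mult_left_mono[OF _ assms(1)] by (fastforce simp: algebra_simps)
  then have "M * exp (c * \<bar>x + s * z\<bar>) \<le> M * exp (c * X + c * S * \<bar>z\<bar>)"
    using M by (intro mult_left_mono) auto
  then show ?thesis using assms(2)[of "x + s * z"] by (simp add: exp_add mult.assoc)
qed

lemma integrable_std_normal_growth:
  assumes "c \<ge> 0" "\<And>y. \<bar>f y\<bar> \<le> M * exp (c * \<bar>y\<bar>)" and [measurable]: "f \<in> borel_measurable borel"
  shows "integrable std_normal_distribution (\<lambda>z. f (x + s * z))"
proof (rule Bochner_Integration.integrable_bound)
  show "integrable std_normal_distribution (\<lambda>z. M * exp (c * \<bar>x\<bar>) * exp (c * \<bar>s\<bar> * \<bar>z\<bar>))"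
    by (intro integrable_mult_right integrable_std_normal_exp_abs)
  show "AE z in std_normal_distribution. norm (f (x + s * z))
      \<le> norm (M * exp (c * \<bar>x\<bar>) * exp (c * \<bar>s\<bar> * \<bar>z\<bar>))"
    using exp_growth_affine[OF assms(1,2) order_refl[of "\<bar>s\<bar>"] order_refl[of "\<bar>x\<bar>"]]
    by (intro AE_I2) (auto intro: order_trans[OF _ abs_ge_self])
qed (simp add: measurable_cong_sets[OF sets_density refl])

lemma gauss_avg_has_derivative:
  assumes "c \<ge> 0" "\<And>y. \<bar>f y\<bar> \<le> M * exp (c * \<bar>y\<bar>)" "\<And>y. \<bar>f' y\<bar> \<le> M' * exp (c * \<bar>y\<bar>)"
    and der: "\<And>y. (f has_real_derivative f' y) (at y)" and cont: "continuous_on UNIV f'"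
  shows "(gauss_avg r f has_real_derivative gauss_avg r f' x) (at x)"
  unfolding gauss_avg_def
proof (rule has_real_derivative_integral_dominated[where e = 1
      and g = "\<lambda>z. M' * exp (c * (\<bar>x\<bar> + 1)) * exp (c * \<bar>sqrt r\<bar> * \<bar>z\<bar>)"])
  have [measurable]: "f \<in> borel_measurable borel"
    using der by (intro borel_measurable_continuous_onI) (auto intro: DERIV_isCont continuous_at_imp_continuous_on)
  have [measurable]: "f' \<in> borel_measurable borel"
    using cont by (rule borel_measurable_continuous_onI)
  show "((\<lambda>y. f (y + sqrt r * z)) has_real_derivative f' (y + sqrt r * z)) (at y)" for y z
    by (rule DERIV_chain2[OF der, THEN DERIV_cong]) (auto intro!: derivative_eq_intros)
  show "integrable std_normal_distribution (\<lambda>z. f (y + sqrt r * z))" for y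
    by (rule integrable_std_normal_growth[OF assms(1,2)]) auto
  show "\<bar>f' (y + sqrt r * z)\<bar> \<le> M' * exp (c * (\<bar>x\<bar> + 1)) * exp (c * \<bar>sqrt r\<bar> * \<bar>z\<bar>)"
    if "\<bar>y - x\<bar> < 1" for y z
    using that by (intro exp_growth_affine assms) auto
  show "(\<lambda>z. f' (x + sqrt r * z)) \<in> borel_measurable std_normal_distribution"
    by (simp add: measurable_cong_sets[OF sets_density refl])
  show "integrable std_normal_distribution (\<lambda>z. M' * exp (c * (\<bar>x\<bar> + 1)) * exp (c * \<bar>sqrt r\<bar> * \<bar>z\<bar>))"
    by (intro integrable_mult_right integrable_std_normal_exp_abs)
qed simp

text \<open>Fundamental theorem of calculus on the whole line for
  \<open>std_normal_density z * g z\<close>, whose derivative is the difference of the two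
  integrands; the Gaussian beats the exponential growth of \<open>g\<close>, so both boundary values
  vanish.\<close>

lemma std_normal_integration_by_parts:
  assumes c: "c \<ge> 0" and b: "\<And>y. \<bar>g y\<bar> \<le> M * exp (c * \<bar>y\<bar>)" and b': "\<And>y. \<bar>g' y\<bar> \<le> M' * exp (c * \<bar>y\<bar>)"
    and der: "\<And>y. (g has_real_derivative g' y) (at y)" and cont: "continuous_on UNIV g'"
  shows "(LINT z|std_normal_distribution. z * g z) = (LINT z|std_normal_distribution. g' z)"
proof -
  have contg: "continuous_on UNIV g"
    using der by (auto intro: DERIV_isCont continuous_at_imp_continuous_on)
  have [measurable]: "g \<in> borel_measurable borel" "g' \<in> borel_measurable borel"
    using cont contg by (auto intro: borel_measurable_continuous_onI)
  have M: "M \<ge> 0" using b[of 0] by auto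
  have i1: "integrable std_normal_distribution g'"
    using integrable_std_normal_growth[OF c b', of 0 1] by simp
  have i2: "integrable std_normal_distribution (\<lambda>z. z * g z)"
  proof (rule Bochner_Integration.integrable_bound)
    show "integrable std_normal_distribution (\<lambda>z. M * exp ((c + 1) * \<bar>z\<bar>))"
      by (intro integrable_mult_right integrable_std_normal_exp_abs)
    \<comment> \<open>The factor \<open>\<bar>z\<bar>\<close> is absorbed by raising the exponent
      from \<open>c\<close> to \<open>c + 1\<close>.\<close>
    have "\<bar>z\<bar> * \<bar>g z\<bar> \<le> exp \<bar>z\<bar> * (M * exp (c * \<bar>z\<bar>))" for z
      by (intro mult_mono b) (use exp_ge_add_one_self[of "\<bar>z\<bar>"] in linarith, auto)
    then show "AE z in std_normal_distribution. norm (z * g z) \<le> norm (M * exp ((c + 1) * \<bar>z\<bar>))"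
      using M by (intro AE_I2) (auto simp: abs_mult algebra_simps exp_add)
  qed (simp add: measurable_cong_sets[OF sets_density refl])
  let ?p = std_normal_density
  define F where "F z = ?p z * g z" for z
  define f where "f z = ?p z * g' z - ?p z * (z * g z)" for z
  have j1: "integrable lborel (\<lambda>z. ?p z * g' z)" and j2: "integrable lborel (\<lambda>z. ?p z * (z * g z))"
    using i1 i2 by (auto simp: integrable_density)
  have derp: "(?p has_real_derivative - z * ?p z) (at z)" for z
  proof -
    have "((\<lambda>z. exp (- z\<^sup>2 / 2)) has_real_derivative - z * exp (- z\<^sup>2 / 2)) (at z)"
      by (auto intro!: derivative_eq_intros)
    from DERIV_cmult[OF this, of "1 / sqrt (2 * pi)"] show ?thesis
      unfolding std_normal_density_def by (simp only: mult.left_commute)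
  qed
  have derF: "(F has_real_derivative f z) (at z)" for z
    unfolding F_def f_def by (auto intro!: derivative_eq_intros derp der)
  have contp: "continuous_on UNIV ?p"
    using derp by (auto intro: DERIV_isCont continuous_at_imp_continuous_on)
  have contf: "continuous_on UNIV f"
    unfolding f_def by (intro continuous_intros contp cont contg)
  have bF: "norm (F z) \<le> M * exp (c * \<bar>z\<bar>) * exp (- z\<^sup>2 / 2)" for z
  proof -
    have "1 \<le> sqrt (2 * pi)" using pi_gt3 by (intro real_le_rsqrt) auto
    then have "?p z \<le> exp (- z\<^sup>2 / 2)" by (auto simp: std_normal_density_def field_simps)
    then have "?p z * \<bar>g z\<bar> \<le> exp (- z\<^sup>2 / 2) * (M * exp (c * \<bar>z\<bar>))"
      by (intro mult_mono b) auto
    then show ?thesis by (simp add: F_def abs_mult mult_ac)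
  qed
  have "((\<lambda>z::real. exp (c * \<bar>z\<bar>) * exp (- z\<^sup>2 / 2)) \<longlongrightarrow> 0) at_top"
  proof (rule Lim_null_comparison)
    show "((\<lambda>z::real. exp (- z)) \<longlongrightarrow> 0) at_top" by real_asymp
    \<comment> \<open>From \<open>2 * (c + 1)\<close> on, \<open>z\<^sup>2 / 2\<close> is at least
      \<open>(c + 1) * z\<close>, which leaves \<open>exp (- z)\<close>.\<close>
    show "eventually (\<lambda>z. norm (exp (c * \<bar>z\<bar>) * exp (- z\<^sup>2 / 2)) \<le> exp (- z)) at_top"
      using eventually_ge_at_top[of "2 * (c + 1)"]
    proof eventually_elim
      case (elim z)
      have "2 * (c + 1) * z \<le> z * z" using elim c by (intro mult_right_mono) auto
      then show ?case using elim c by (simp add: power2_eq_square algebra_simps flip: exp_add)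
    qed
  qed
  from tendsto_mult_right_zero[OF this, of M]
  have top: "((\<lambda>z::real. M * exp (c * \<bar>z\<bar>) * exp (- z\<^sup>2 / 2)) \<longlongrightarrow> 0) at_top"
    by (simp only: mult.assoc)
  then have bot: "((\<lambda>z::real. M * exp (c * \<bar>z\<bar>) * exp (- z\<^sup>2 / 2)) \<longlongrightarrow> 0) at_bot"
    by (simp add: filterlim_at_bot_mirror)
  have "(F \<longlongrightarrow> 0) A" if "((\<lambda>z. M * exp (c * \<bar>z\<bar>) * exp (- z\<^sup>2 / 2)) \<longlongrightarrow> 0) A" for A
    using that by (rule Lim_null_comparison[rotated]) (rule eventuallyI, rule bF)
  note lim = this
  have Ftop: "(F \<longlongrightarrow> 0) at_top" by (rule lim[OF top])
  have Fbot: "(F \<longlongrightarrow> 0) at_bot" by (rule lim[OF bot])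
  from Ftop Fbot have "((F \<circ> real_of_ereal) \<longlongrightarrow> 0) (at_left \<infinity>)" "((F \<circ> real_of_ereal) \<longlongrightarrow> 0) (at_right (- \<infinity>))"
    by (auto simp: o_def at_left_PInf at_right_MInf filterlim_filtermap)
  then have "(LBINT z=-\<infinity>..\<infinity>. f z) = 0 - 0"
    using contf derF j1 j2
    by (intro interval_integral_FTC_integrable)
      (auto simp: has_real_derivative_iff_has_vector_derivative[symmetric] einterval_def
        continuous_on_eq_continuous_at f_def set_integrable_def)
  then have "(LINT z|lborel. f z) = 0"
    by (simp add: interval_lebesgue_integral_def einterval_def set_lebesgue_integral_def)
  then have "(LINT z|lborel. ?p z * g' z) = (LINT z|lborel. ?p z * (z * g z))"
    using j1 j2 by (simp add: f_def)
  then show ?thesis by (simp add: integral_density)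
qed

text \<open>Differentiating \<open>sqrt s\<close> brings out \<open>z / (2 * sqrt t)\<close>;
  integration by parts trades the factor \<open>z\<close> for \<open>sqrt t\<close> times one more
  derivative, which gives the heat equation. The square root is the reason for
  \<open>t > 0\<close>.\<close>

lemma gauss_avg_has_time_derivative:
  assumes t: "t > 0" and c: "c \<ge> 0"
    and b: "\<And>y. \<bar>f y\<bar> \<le> M * exp (c * \<bar>y\<bar>)" and b': "\<And>y. \<bar>f' y\<bar> \<le> M' * exp (c * \<bar>y\<bar>)"
    and b'': "\<And>y. \<bar>f'' y\<bar> \<le> M'' * exp (c * \<bar>y\<bar>)"
    and der: "\<And>y. (f has_real_derivative f' y) (at y)" and der': "\<And>y. (f' has_real_derivative f'' y) (at y)"
    and cont: "continuous_on UNIV f''"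
  shows "((\<lambda>s. gauss_avg s f x) has_real_derivative gauss_avg t f'' x / 2) (at t)"
proof -
  have contf: "continuous_on UNIV f" "continuous_on UNIV f'"
    using der der' by (auto intro: DERIV_isCont continuous_at_imp_continuous_on)
  have [measurable]: "f \<in> borel_measurable borel" "f' \<in> borel_measurable borel"
    using contf by (auto intro: borel_measurable_continuous_onI)
  have M': "M' \<ge> 0" using b'[of 0] by auto
  let ?S = "sqrt (2 * t)"
  \<comment> \<open>On this window \<open>s\<close> stays between \<open>t / 2\<close> and
    \<open>3 * t / 2\<close>, so \<open>1 / sqrt s\<close> and \<open>sqrt s\<close> are both
    bounded; \<open>sqrt (2 * t)\<close> is a convenient upper bound.\<close>
  have near: "s > t / 2" "\<bar>sqrt s\<bar> \<le> ?S" if "\<bar>s - t\<bar> < t / 2" for s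
  proof -
    have "- (t / 2) < s - t" "s - t < t / 2" using that by linarith+
    then show "s > t / 2" "\<bar>sqrt s\<bar> \<le> ?S" using t by auto
  qed
  have "((\<lambda>s. gauss_avg s f x) has_real_derivative
      (LINT z|std_normal_distribution. z / (2 * sqrt t) * f' (x + sqrt t * z))) (at t)"
    unfolding gauss_avg_def
  proof (rule has_real_derivative_integral_dominated[where e = "t / 2"
      and f' = "\<lambda>s z. z / (2 * sqrt s) * f' (x + sqrt s * z)"
      and g = "\<lambda>z. M' * exp (c * \<bar>x\<bar>) / (2 * sqrt (t / 2)) * exp ((c * ?S + 1) * \<bar>z\<bar>)"])
    show "((\<lambda>s. f (x + sqrt s * z)) has_real_derivative z / (2 * sqrt s) * f' (x + sqrt s * z)) (at s)"
      if "\<bar>s - t\<bar> < t / 2" for s z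
      using near[OF that] t
      by (intro DERIV_chain2[OF der, THEN DERIV_cong])
        (auto intro!: derivative_eq_intros simp: field_simps)
    show "integrable std_normal_distribution (\<lambda>z. f (x + sqrt s * z))" for s
      by (rule integrable_std_normal_growth[OF c b]) auto
    show "\<bar>z / (2 * sqrt s) * f' (x + sqrt s * z)\<bar>
        \<le> M' * exp (c * \<bar>x\<bar>) / (2 * sqrt (t / 2)) * exp ((c * ?S + 1) * \<bar>z\<bar>)"
      if s: "\<bar>s - t\<bar> < t / 2" for s z
    proof -
      have 1: "\<bar>f' (x + sqrt s * z)\<bar> \<le> M' * exp (c * \<bar>x\<bar>) * exp (c * ?S * \<bar>z\<bar>)"
        by (rule exp_growth_affine[OF c b' near(2)[OF s] order_refl])
      have "\<bar>z\<bar> \<le> exp \<bar>z\<bar>" using exp_ge_add_one_self[of "\<bar>z\<bar>"] by linarith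
      moreover have "sqrt (t / 2) \<le> sqrt s" "sqrt (t / 2) > 0" using near[OF s] t by auto
      ultimately have 2: "\<bar>z\<bar> / (2 * sqrt s) \<le> exp \<bar>z\<bar> / (2 * sqrt (t / 2))"
        by (intro frac_le) auto
      have "sqrt s \<ge> 0" using near[OF s] t by simp
      then have "\<bar>z / (2 * sqrt s) * f' (x + sqrt s * z)\<bar> = \<bar>z\<bar> / (2 * sqrt s) * \<bar>f' (x + sqrt s * z)\<bar>"
        by (simp add: abs_mult)
      also have "\<dots> \<le> exp \<bar>z\<bar> / (2 * sqrt (t / 2)) * (M' * exp (c * \<bar>x\<bar>) * exp (c * ?S * \<bar>z\<bar>))"
        using t by (intro mult_mono 1 2) auto
      finally show ?thesis by (simp add: algebra_simps exp_add)
    qed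
    show "(\<lambda>z. z / (2 * sqrt t) * f' (x + sqrt t * z)) \<in> borel_measurable std_normal_distribution"
      by (simp add: measurable_cong_sets[OF sets_density refl])
    show "integrable std_normal_distribution
        (\<lambda>z. M' * exp (c * \<bar>x\<bar>) / (2 * sqrt (t / 2)) * exp ((c * ?S + 1) * \<bar>z\<bar>))"
      by (intro integrable_mult_right integrable_std_normal_exp_abs)
  qed (use t in auto)
  moreover have "(LINT z|std_normal_distribution. z * f' (x + sqrt t * z))
      = (LINT z|std_normal_distribution. sqrt t * f'' (x + sqrt t * z))"
  proof (rule std_normal_integration_by_parts[where c = "c * sqrt t"])
    show "0 \<le> c * sqrt t" using c t by auto
    show "\<bar>f' (x + sqrt t * z)\<bar> \<le> M' * exp (c * \<bar>x\<bar>) * exp (c * sqrt t * \<bar>z\<bar>)" for z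
      using t by (intro exp_growth_affine[OF c b']) auto
    have "\<bar>f'' (x + sqrt t * z)\<bar> \<le> M'' * exp (c * \<bar>x\<bar>) * exp (c * sqrt t * \<bar>z\<bar>)" for z
      using t by (intro exp_growth_affine[OF c b'']) auto
    then show "\<bar>sqrt t * f'' (x + sqrt t * z)\<bar> \<le> (sqrt t * (M'' * exp (c * \<bar>x\<bar>))) * exp (c * sqrt t * \<bar>z\<bar>)" for z
      using t by (simp add: abs_mult mult.assoc)
    show "((\<lambda>z. f' (x + sqrt t * z)) has_real_derivative sqrt t * f'' (x + sqrt t * z)) (at z)" for z
      by (intro DERIV_chain2[OF der', THEN DERIV_cong]) (auto intro!: derivative_eq_intros)
    show "continuous_on UNIV (\<lambda>z. sqrt t * f'' (x + sqrt t * z))"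
      by (intro continuous_intros continuous_on_compose2[OF cont]) auto
  qed
  moreover have "z / (2 * sqrt t) * y = (z * y) / (2 * sqrt t)" for z y by simp
  ultimately show ?thesis using t by (simp add: gauss_avg_def)
qed

lemma continuous_on_gauss_avg:
  assumes c: "c \<ge> 0" and b: "\<And>y. \<bar>f y\<bar> \<le> M * exp (c * \<bar>y\<bar>)" and cont: "continuous_on UNIV f"
  shows "continuous_on UNIV (\<lambda>p. gauss_avg (fst p) f (snd p))"
proof (rule continuous_on_sequentiallyI)
  fix q :: "nat \<Rightarrow> real \<times> real" and p
  assume q: "q \<longlonglongrightarrow> p"
  have [measurable]: "f \<in> borel_measurable borel"
    using cont by (rule borel_measurable_continuous_onI)
  have q1: "(\<lambda>n. sqrt (fst (q n))) \<longlonglongrightarrow> sqrt (fst p)" and q2: "(\<lambda>n. snd (q n)) \<longlonglongrightarrow> snd p"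
    using q by (auto intro!: tendsto_intros)
  obtain S where S: "\<And>n. \<bar>sqrt (fst (q n))\<bar> \<le> S"
    using Bseq_eq_bounded convergent_imp_Bseq[OF convergentI[OF q1]] by (auto simp: Bseq_def)
  obtain X where X: "\<And>n. \<bar>snd (q n)\<bar> \<le> X"
    using convergent_imp_Bseq[OF convergentI[OF q2]] by (auto simp: Bseq_def)
  show "(\<lambda>n. gauss_avg (fst (q n)) f (snd (q n))) \<longlonglongrightarrow> gauss_avg (fst p) f (snd p)"
    unfolding gauss_avg_def
  proof (rule integral_dominated_convergence[where w = "\<lambda>z. M * exp (c * X) * exp (c * S * \<bar>z\<bar>)"])
    show "integrable std_normal_distribution (\<lambda>z. M * exp (c * X) * exp (c * S * \<bar>z\<bar>))"
      by (intro integrable_mult_right integrable_std_normal_exp_abs)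
    show "AE z in std_normal_distribution. norm (f (snd (q n) + sqrt (fst (q n)) * z))
        \<le> M * exp (c * X) * exp (c * S * \<bar>z\<bar>)" for n
      using exp_growth_affine[OF c b S X] by (intro AE_I2) auto
    have "isCont f y" for y using cont by (simp add: continuous_on_eq_continuous_at)
    then show "AE z in std_normal_distribution. (\<lambda>n. f (snd (q n) + sqrt (fst (q n)) * z))
        \<longlonglongrightarrow> f (snd p + sqrt (fst p) * z)"
      by (intro AE_I2 isCont_tendsto_compose[of _ f]) (auto intro!: tendsto_intros q1 q2)
  qed (simp_all add: measurable_cong_sets[OF sets_density refl])
qed

section \<open>Weighted bounds on all derivatives\<close>

text \<open>Bounds on all derivatives up to order \<open>n\<close> by one weight, uniform over a
  parameter set, typically a time interval, or the unit type for a single function. Unfolding one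
  derivative at a time lets sums and products be treated by induction on \<open>n\<close>, without a
  Leibniz formula.\<close>

fun deriv_bounded :: "'p set \<Rightarrow> nat \<Rightarrow> (real \<Rightarrow> real) \<Rightarrow> ('p \<Rightarrow> real \<Rightarrow> real) \<Rightarrow> bool" where
  "deriv_bounded P 0 e F = (\<exists>M. \<forall>p\<in>P. \<forall>x. \<bar>F p x\<bar> \<le> M * e x)"
| "deriv_bounded P (Suc n) e F = ((\<exists>M. \<forall>p\<in>P. \<forall>x. \<bar>F p x\<bar> \<le> M * e x) \<and>
     (\<exists>F'. (\<forall>p\<in>P. \<forall>x. (F p has_real_derivative F' p x) (at x)) \<and> deriv_bounded P n e F'))"

lemma deriv_bounded_bound:
  assumes "deriv_bounded P n e F" "\<And>x. e x \<ge> 0"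
  obtains M where "M \<ge> 0" "\<And>p x. p \<in> P \<Longrightarrow> \<bar>F p x\<bar> \<le> M * e x"
proof -
  obtain M where M: "\<forall>p\<in>P. \<forall>x. \<bar>F p x\<bar> \<le> M * e x" using assms(1) by (cases n) auto
  have "\<bar>F p x\<bar> \<le> \<bar>M\<bar> * e x" if "p \<in> P" for p x
    using M that mult_right_mono[OF abs_ge_self assms(2)] by (meson order_trans)
  then show ?thesis using that[of "\<bar>M\<bar>"] by auto
qed

lemma deriv_bounded_SucD: "deriv_bounded P (Suc n) e F \<Longrightarrow> deriv_bounded P n e F"
proof (induction n arbitrary: F)
  case (Suc n)
  then obtain F' where F': "\<forall>p\<in>P. \<forall>x. (F p has_real_derivative F' p x) (at x)" "deriv_bounded P (Suc n) e F'"
    by auto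
  from Suc.IH[OF F'(2)] F'(1) Suc.prems show ?case by auto
qed auto

lemma deriv_bounded_cong:
  assumes "\<And>p. p \<in> P \<Longrightarrow> F p = G p"
  shows "deriv_bounded P n e F \<longleftrightarrow> deriv_bounded P n e G"
  using assms by (cases n) auto

lemma deriv_bounded_weight:
  assumes "deriv_bounded P n e F" "\<And>x. e x \<ge> 0" "\<And>x. e x \<le> K * e' x"
  shows "deriv_bounded P n e' F"
  using assms(1)
proof (induction n arbitrary: F)
  have bnd: "\<exists>M. \<forall>p\<in>P. \<forall>x. \<bar>F p x\<bar> \<le> M * e' x" if d: "deriv_bounded P n e F" for F n
  proof -
    obtain M where "M \<ge> 0" "\<And>p x. p \<in> P \<Longrightarrow> \<bar>F p x\<bar> \<le> M * e x"
      using deriv_bounded_bound[OF d assms(2)] by blast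
    then have "\<bar>F p x\<bar> \<le> M * K * e' x" if "p \<in> P" for p x
      using that mult_left_mono[OF assms(3)[of x], of M] by (metis mult.assoc order_trans)
    then show ?thesis by blast
  qed
  {
    case 0 show ?case using bnd[OF 0] by simp
  next
    case (Suc n) then show ?case using bnd[OF Suc.prems] by auto
  }
qed

lemma deriv_bounded_reindex:
  assumes "deriv_bounded P n e F" "\<And>q. q \<in> Q \<Longrightarrow> h q \<in> P"
  shows "deriv_bounded Q n e (\<lambda>q. F (h q))"
  using assms(1)
proof (induction n arbitrary: F)
  case 0 then show ?case using assms(2) by fastforce
next
  case (Suc n)
  then obtain F' where F': "\<forall>p\<in>P. \<forall>x. (F p has_real_derivative F' p x) (at x)" "deriv_bounded P n e F'"
    by auto
  have "\<exists>M. \<forall>q\<in>Q. \<forall>x. \<bar>F (h q) x\<bar> \<le> M * e x" using Suc.prems assms(2) by fastforce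
  then show ?case using Suc.IH[OF F'(2)] F'(1) assms(2)
    by (auto intro!: exI[of _ "\<lambda>q. F' (h q)"])
qed

lemma deriv_bounded_const: "deriv_bounded P n (\<lambda>_. 1) (\<lambda>_ _. c)"
proof (induction n arbitrary: c)
  case (Suc n)
  then show ?case by (auto intro!: exI[of _ "\<lambda>_ _. 0"] derivative_eq_intros)
qed auto

lemma deriv_bounded_add:
  assumes "deriv_bounded P n e F" "deriv_bounded P n e G"
  shows "deriv_bounded P n e (\<lambda>p x. F p x + G p x)"
  using assms
proof (induction n arbitrary: F G)
  have bnd: "\<exists>M. \<forall>p\<in>P. \<forall>x. \<bar>F p x + G p x\<bar> \<le> M * e x"
    if "\<forall>p\<in>P. \<forall>x. \<bar>F p x\<bar> \<le> M * e x" "\<forall>p\<in>P. \<forall>x. \<bar>G p x\<bar> \<le> M' * e x" for F G M M'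
    using that by (intro exI[of _ "M + M'"]) (auto simp: distrib_right intro!: order_trans[OF abs_triangle_ineq] add_mono)
  {
    case 0 then show ?case using bnd by auto
  next
    case (Suc n)
    then obtain F' G' where D: "\<forall>p\<in>P. \<forall>x. (F p has_real_derivative F' p x) (at x)" "deriv_bounded P n e F'"
      "\<forall>p\<in>P. \<forall>x. (G p has_real_derivative G' p x) (at x)" "deriv_bounded P n e G'" by auto
    have "\<exists>M. \<forall>p\<in>P. \<forall>x. \<bar>F p x + G p x\<bar> \<le> M * e x" using Suc.prems bnd by auto
    then show ?case using Suc.IH[OF D(2,4)] D(1,3)
      by (auto intro!: exI[of _ "\<lambda>p x. F' p x + G' p x"] derivative_eq_intros)
  }
qed

lemma deriv_bounded_mult:
  assumes "deriv_bounded P n e F" "deriv_bounded P n e' G" "\<And>x. e x \<ge> 0" "\<And>x. e' x \<ge> 0"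
  shows "deriv_bounded P n (\<lambda>x. e x * e' x) (\<lambda>p x. F p x * G p x)"
  using assms(1,2)
proof (induction n arbitrary: F G)
  have bnd: "\<exists>M. \<forall>p\<in>P. \<forall>x. \<bar>F p x * G p x\<bar> \<le> M * (e x * e' x)"
    if FG: "deriv_bounded P n e F" "deriv_bounded P n e' G" for n F G
  proof -
    obtain M where M: "M \<ge> 0" "\<And>p x. p \<in> P \<Longrightarrow> \<bar>F p x\<bar> \<le> M * e x"
      using deriv_bounded_bound[OF FG(1) assms(3)] by blast
    obtain N where N: "N \<ge> 0" "\<And>p x. p \<in> P \<Longrightarrow> \<bar>G p x\<bar> \<le> N * e' x"
      using deriv_bounded_bound[OF FG(2) assms(4)] by blast
    have "\<bar>F p x * G p x\<bar> \<le> (M * N) * (e x * e' x)" if "p \<in> P" for p x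
      using mult_mono[OF M(2)[OF that, of x] N(2)[OF that, of x]] M(1) assms(3)[of x]
      by (simp add: abs_mult mult_ac)
    then show ?thesis by blast
  qed
  {
    case 0 then show ?case using bnd[OF 0] by simp
  next
    case (Suc n)
    then obtain F' G' where D: "\<forall>p\<in>P. \<forall>x. (F p has_real_derivative F' p x) (at x)" "deriv_bounded P n e F'"
      "\<forall>p\<in>P. \<forall>x. (G p has_real_derivative G' p x) (at x)" "deriv_bounded P n e' G'" by auto
    \<comment> \<open>Each summand of the product rule differentiates one factor only; the other is
      lowered by one order to match.\<close>
    note S = Suc.prems[THEN deriv_bounded_SucD]
    have "deriv_bounded P n (\<lambda>x. e x * e' x) (\<lambda>p x. F' p x * G p x + F p x * G' p x)"
      by (intro deriv_bounded_add Suc.IH D S)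
    then show ?case using bnd[OF Suc.prems] D(1,3)
      by (auto intro!: exI[of _ "\<lambda>p x. F' p x * G p x + F p x * G' p x"] derivative_eq_intros)
  }
qed

lemma deriv_bounded_cmult:
  assumes "deriv_bounded P n e F" "\<And>x. e x \<ge> 0"
  shows "deriv_bounded P n e (\<lambda>p x. c * F p x)"
  using deriv_bounded_mult[OF deriv_bounded_const assms(1) _ assms(2), of c] by simp

lemma deriv_bounded_diff:
  assumes "deriv_bounded P n e F" "deriv_bounded P n e G" "\<And>x. e x \<ge> 0"
  shows "deriv_bounded P n e (\<lambda>p x. F p x - G p x)"
  using deriv_bounded_add[OF assms(1) deriv_bounded_cmult[OF assms(2,3), of "-1"]] by simp

lemma deriv_bounded_deriv:
  assumes "deriv_bounded P (Suc n) e F"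
  shows "deriv_bounded P n e (\<lambda>p. deriv (F p))"
    and "p \<in> P \<Longrightarrow> (F p has_real_derivative deriv (F p) x) (at x)"
proof -
  obtain F' where F': "\<forall>p\<in>P. \<forall>x. (F p has_real_derivative F' p x) (at x)" "deriv_bounded P n e F'"
    using assms by auto
  then have eq: "deriv (F p) = F' p" if "p \<in> P" for p
    using that by (auto intro!: DERIV_imp_deriv)
  show "deriv_bounded P n e (\<lambda>p. deriv (F p))"
    using F'(2) deriv_bounded_cong[of P "\<lambda>p. deriv (F p)" F'] eq by blast
  show "p \<in> P \<Longrightarrow> (F p has_real_derivative deriv (F p) x) (at x)"
    using F'(1) eq by auto
qed

text \<open>Boundedness at every order allows the existentially quantified derivatives to be
  replaced by the concrete iterates of \<open>deriv\<close>.\<close>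

lemma deriv_bounded_iterated:
  assumes "\<And>n. deriv_bounded P n e F"
  shows "deriv_bounded P n e (\<lambda>p. (deriv ^^ k) (F p))"
    and "p \<in> P \<Longrightarrow> ((deriv ^^ k) (F p) has_real_derivative (deriv ^^ Suc k) (F p) x) (at x)"
proof -
  have *: "\<forall>n. deriv_bounded P n e (\<lambda>p. (deriv ^^ k) (F p))" for k
    by (induction k) (use assms in \<open>auto simp del: deriv_bounded.simps intro: deriv_bounded_deriv(1)\<close>)
  then show "deriv_bounded P n e (\<lambda>p. (deriv ^^ k) (F p))" by blast
  show "p \<in> P \<Longrightarrow> ((deriv ^^ k) (F p) has_real_derivative (deriv ^^ Suc k) (F p) x) (at x)"
    using deriv_bounded_deriv(2)[OF *[of k, rule_format]] by simp
qed

definition tail_weight :: "real \<Rightarrow> real" where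
  "tail_weight x = min 1 (exp (- 2 * x))"

lemma tail_weight_bounds: "tail_weight x \<ge> 0" "tail_weight x > 0" "tail_weight x \<le> 1"
  by (auto simp: tail_weight_def)

text \<open>The one-sided weight controls \<open>u' - 1\<close> on the whole line; with evenness it makes all
  derivatives of order at least two decay like \<open>exp (- 2 * \<bar>x\<bar>)\<close>.\<close>

definition tame :: "(real \<Rightarrow> real) \<Rightarrow> bool" where
  "tame u \<longleftrightarrow> (\<forall>x. u (- x) = u x) \<and> (\<exists>c. \<forall>x. \<bar>u x - \<bar>x\<bar>\<bar> \<le> c) \<and>
    (\<forall>x. (u has_real_derivative deriv u x) (at x)) \<and>
    (\<forall>n. deriv_bounded (UNIV :: unit set) n tail_weight (\<lambda>_ x. deriv u x - 1)) \<and>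
    (\<exists>m>0. \<forall>x. deriv (deriv u) x \<ge> m * exp (- 2 * \<bar>x\<bar>))"

section \<open>Gaussian averages of exponentials and comparison of averages\<close>

lemma gauss_avg_exp: "t \<ge> 0 \<Longrightarrow> gauss_avg t (\<lambda>y. exp (c * y)) x = exp (c * x + c\<^sup>2 * t / 2)"
proof -
  assume t: "t \<ge> 0"
  have "exp (c * (x + sqrt t * z)) = exp (c * x) * exp ((c * sqrt t) * z)" for z
    by (simp add: algebra_simps flip: exp_add)
  then have "gauss_avg t (\<lambda>y. exp (c * y)) x = exp (c * x) * exp ((c * sqrt t)\<^sup>2 / 2)"
    by (simp add: gauss_avg_def integral_std_normal_exp)
  then show ?thesis using t by (simp add: power_mult_distrib exp_add)
qed

lemma gauss_avg_const: "gauss_avg t (\<lambda>y. k) x = k"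
proof -
  interpret prob_space std_normal_distribution
    using prob_space_normal_density[of 1 0] by simp
  show ?thesis using prob_space by (simp add: gauss_avg_def)
qed

lemma gauss_avg_0: "gauss_avg 0 f x = f x"
  using gauss_avg_const[of 0 "f x" x] by (simp add: gauss_avg_def)

text \<open>Replacing \<open>z\<close> by \<open>- z\<close> preserves the standard density.\<close>

lemma gauss_avg_even:
  assumes "\<And>y. f (- y) = f y" and "continuous_on UNIV f"
  shows "gauss_avg t f (- x) = gauss_avg t f x"
proof -
  have [measurable]: "f \<in> borel_measurable borel"
    using assms(2) by (rule borel_measurable_continuous_onI)
  let ?g = "\<lambda>x z. std_normal_density z * f (x + sqrt t * z)"
  have *: "gauss_avg t f x = (LINT z|lborel. ?g x z)" for x
    unfolding gauss_avg_def by (subst integral_density) auto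
  have "gauss_avg t f (- x) = (LINT z|lborel. ?g (- x) (0 + (- 1) * z))"
    unfolding * by (subst lborel_integral_real_affine[of "- 1" _ 0]) auto
  also have "\<dots> = (LINT z|lborel. ?g x z)"
  proof (rule Bochner_Integration.integral_cong)
    fix z show "?g (- x) (0 + (- 1) * z) = ?g x z"
      using assms(1)[of "x + sqrt t * z"] by (simp add: std_normal_density_def)
  qed simp
  finally show ?thesis by (simp add: *)
qed

text \<open>Continuity is bundled in for measurability, so that this one predicate yields
  integrability for every Gaussian average.\<close>

definition exp_growth :: "real \<Rightarrow> (real \<Rightarrow> real) \<Rightarrow> bool" where
  "exp_growth c f \<longleftrightarrow> continuous_on UNIV f \<and> (\<exists>M. \<forall>y. \<bar>f y\<bar> \<le> M * exp (c * \<bar>y\<bar>))"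

lemma exp_growth_integrable:
  assumes "c \<ge> 0" "exp_growth c f"
  shows "integrable std_normal_distribution (\<lambda>z. f (x + s * z))"
  using assms integrable_std_normal_growth[OF assms(1)] borel_measurable_continuous_onI
  unfolding exp_growth_def by blast

lemma gauss_avg_mono:
  assumes "c \<ge> 0" "exp_growth c f" "exp_growth c g" "\<And>y. f y \<le> g y"
  shows "gauss_avg t f x \<le> gauss_avg t g x"
  unfolding gauss_avg_def by (intro integral_mono exp_growth_integrable[OF assms(1)] assms)

lemma exp_growth_cmult: "exp_growth c f \<Longrightarrow> exp_growth c (\<lambda>y. k * f y)"
proof -
  assume f: "exp_growth c f"
  then obtain M where M: "\<forall>y. \<bar>f y\<bar> \<le> M * exp (c * \<bar>y\<bar>)" by (auto simp: exp_growth_def)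
  have "\<bar>k * f y\<bar> \<le> (\<bar>k\<bar> * M) * exp (c * \<bar>y\<bar>)" for y
    using mult_left_mono[OF M[rule_format, of y], of "\<bar>k\<bar>"] by (simp add: abs_mult mult.assoc)
  then show ?thesis using f by (auto simp: exp_growth_def intro!: continuous_intros)
qed

lemma exp_growth_add: "exp_growth c f \<Longrightarrow> exp_growth c g \<Longrightarrow> exp_growth c (\<lambda>y. f y + g y)"
proof -
  assume f: "exp_growth c f" and g: "exp_growth c g"
  obtain M where M: "\<forall>y. \<bar>f y\<bar> \<le> M * exp (c * \<bar>y\<bar>)" using f by (auto simp: exp_growth_def)
  obtain N where N: "\<forall>y. \<bar>g y\<bar> \<le> N * exp (c * \<bar>y\<bar>)" using g by (auto simp: exp_growth_def)
  have "\<bar>f y + g y\<bar> \<le> (M + N) * exp (c * \<bar>y\<bar>)" for y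
    using M N by (auto simp: distrib_right intro!: order_trans[OF abs_triangle_ineq] add_mono)
  then show ?thesis using f g by (auto simp: exp_growth_def intro!: continuous_intros)
qed

lemma exp_growth_exp: "\<bar>k\<bar> \<le> c \<Longrightarrow> exp_growth c (\<lambda>y. exp (k * y))"
  and exp_growth_exp_abs: "k \<le> c \<Longrightarrow> exp_growth c (\<lambda>y. exp (k * \<bar>y\<bar>))"
proof -
  assume k: "\<bar>k\<bar> \<le> c"
  have "k * y \<le> c * \<bar>y\<bar>" for y
    by (rule order_trans[OF abs_ge_self]) (auto simp: abs_mult intro!: mult_right_mono k)
  then show "exp_growth c (\<lambda>y. exp (k * y))"
    by (auto simp: exp_growth_def intro!: continuous_intros exI[of _ 1])
next
  assume "k \<le> c"
  then show "exp_growth c (\<lambda>y. exp (k * \<bar>y\<bar>))"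
    by (auto simp: exp_growth_def intro!: continuous_intros exI[of _ 1] mult_right_mono)
qed

lemma exp_growth_mono: "exp_growth c f \<Longrightarrow> c \<le> c' \<Longrightarrow> exp_growth c' f"
proof -
  assume f: "exp_growth c f" and c: "c \<le> c'"
  then obtain M where M: "\<forall>y. \<bar>f y\<bar> \<le> M * exp (c * \<bar>y\<bar>)" by (auto simp: exp_growth_def)
  have "M \<ge> 0" using M[rule_format, of 0] by simp
  then have "M * exp (c * \<bar>y\<bar>) \<le> M * exp (c' * \<bar>y\<bar>)" for y
    using c by (intro mult_left_mono) (simp_all add: mult_right_mono)
  then have "\<bar>f y\<bar> \<le> M * exp (c' * \<bar>y\<bar>)" for y by (rule order_trans[OF M[rule_format]])
  then show ?thesis using f unfolding exp_growth_def by blast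
qed

lemma exp_growth_const: "c \<ge> 0 \<Longrightarrow> exp_growth c (\<lambda>y. k)"
  using exp_growth_cmult[OF exp_growth_exp[of 0 c], of k] by simp

lemma gauss_avg_add:
  assumes "c \<ge> 0" "exp_growth c f" "exp_growth c g"
  shows "gauss_avg t (\<lambda>y. f y + g y) x = gauss_avg t f x + gauss_avg t g x"
  unfolding gauss_avg_def by (intro Bochner_Integration.integral_add exp_growth_integrable[OF assms(1)] assms)

lemma gauss_avg_cmult: "gauss_avg t (\<lambda>y. k * f y) x = k * gauss_avg t f x"
  unfolding gauss_avg_def by simp

lemma gauss_avg_abs_le:
  assumes "c \<ge> 0" "exp_growth c f" "exp_growth c g" "\<And>y. \<bar>f y\<bar> \<le> g y"
  shows "\<bar>gauss_avg t f x\<bar> \<le> gauss_avg t g x"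
  unfolding gauss_avg_def
  by (rule order_trans[OF integral_abs_bound]) 
     (intro integral_mono integrable_abs exp_growth_integrable[OF assms(1)] assms)

lemma gauss_avg_exp_abs_le:
  assumes "t \<ge> 0" "c \<ge> 0"
  shows "gauss_avg t (\<lambda>y. exp (c * \<bar>y\<bar>)) x \<le> 2 * exp (c\<^sup>2 * t / 2) * exp (c * \<bar>x\<bar>)"
proof -
  have "gauss_avg t (\<lambda>y. exp (c * \<bar>y\<bar>)) x \<le> gauss_avg t (\<lambda>y. exp (c * y) + exp (- c * y)) x"
    using assms by (intro gauss_avg_mono[where c = c] exp_growth_add exp_growth_exp exp_growth_exp_abs exp_abs_le_sum) auto
  also have "\<dots> = exp (c * x + c\<^sup>2 * t / 2) + exp (- c * x + (- c)\<^sup>2 * t / 2)"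
  proof -
    have "exp_growth c (\<lambda>y. exp (c * y))" "exp_growth c (\<lambda>y. exp (- c * y))"
      using assms(2) exp_growth_exp[of c c] exp_growth_exp[of "- c" c] by simp_all
    then show ?thesis by (simp only: gauss_avg_add[OF assms(2)] gauss_avg_exp[OF assms(1)])
  qed
  also have "\<dots> = (exp (c * x) + exp (- c * x)) * exp (c\<^sup>2 * t / 2)"
    by (simp add: distrib_right flip: exp_add)
  also have "\<dots> \<le> (exp (c * \<bar>x\<bar>) + exp (c * \<bar>x\<bar>)) * exp (c\<^sup>2 * t / 2)"
  proof -
    have "c * x \<le> c * \<bar>x\<bar>" "- c * x \<le> c * \<bar>x\<bar>"
      using mult_left_mono[OF abs_ge_self[of x] assms(2)] mult_left_mono[OF abs_ge_minus_self[of x] assms(2)] by simp_all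
    then show ?thesis by (intro mult_right_mono add_mono) simp_all
  qed
  finally show ?thesis by (simp add: mult_ac)
qed

text \<open>\<open>exp (c * \<bar>y\<bar>)\<close> dominates \<open>exp (c * y)\<close>, whose
  average gains the factor \<open>exp (c\<^sup>2 * t / 2) \<ge> 1\<close>; evenness supplies
  negative \<open>x\<close>.\<close>

lemma gauss_avg_exp_abs_ge:
  assumes "t \<ge> 0" "c \<ge> 0"
  shows "gauss_avg t (\<lambda>y. exp (c * \<bar>y\<bar>)) x \<ge> exp (c * \<bar>x\<bar>)"
proof -
  have "exp (c * x) \<le> gauss_avg t (\<lambda>y. exp (c * \<bar>y\<bar>)) x" for x
  proof -
    have "exp (c * x) \<le> gauss_avg t (\<lambda>y. exp (c * y)) x"
      using assms by (simp add: gauss_avg_exp)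
    also have "\<dots> \<le> gauss_avg t (\<lambda>y. exp (c * \<bar>y\<bar>)) x"
      using assms by (intro gauss_avg_mono[where c = c] exp_growth_exp exp_growth_exp_abs) (auto intro: mult_left_mono)
    finally show ?thesis .
  qed
  from this[of x] this[of "- x"] gauss_avg_even[of "\<lambda>y. exp (c * \<bar>y\<bar>)" t x] show ?thesis
    by (cases "x \<ge> 0") (simp_all add: continuous_intros)
qed

text \<open>The inequality \<open>1 / e \<ge> 2 * d - d\<^sup>2 * e\<close> is averaged for \<open>e = exp (k * \<bar>y\<bar>)\<close>, with \<open>d\<close> chosen
  optimally.\<close>

lemma gauss_avg_exp_neg_abs_ge:
  assumes t: "t \<in> {0..T}" and k: "k \<ge> 0"
  shows "gauss_avg t (\<lambda>y. exp (- k * \<bar>y\<bar>)) x \<ge> exp (- k\<^sup>2 * T / 2) / 2 * exp (- k * \<bar>x\<bar>)"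
proof -
  \<comment> \<open>\<open>d\<close> is the reciprocal of
    \<open>2 * exp (k\<^sup>2 * T / 2) * exp (k * \<bar>x\<bar>)\<close>, an upper bound for the
    average of \<open>exp (k * \<bar>y\<bar>)\<close>; the subtracted term is then at most
    \<open>d\<close>.\<close>
  define d where "d = exp (- k\<^sup>2 * T / 2) / 2 * exp (- k * \<bar>x\<bar>)"
  have d: "d > 0" by (simp add: d_def)
  have "2 * d + (- (d\<^sup>2)) * exp (k * \<bar>y\<bar>) \<le> exp (- k * \<bar>y\<bar>)" for y
  proof -
    have "0 \<le> (1 - d * exp (k * \<bar>y\<bar>))\<^sup>2 * exp (- k * \<bar>y\<bar>)" by simp
    also have "\<dots> = exp (- k * \<bar>y\<bar>) - 2 * d * (exp (k * \<bar>y\<bar>) * exp (- k * \<bar>y\<bar>))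
        + d\<^sup>2 * exp (k * \<bar>y\<bar>) * (exp (k * \<bar>y\<bar>) * exp (- k * \<bar>y\<bar>))"
      by (simp add: power2_eq_square algebra_simps)
    also have "exp (k * \<bar>y\<bar>) * exp (- k * \<bar>y\<bar>) = 1" by (simp flip: exp_add)
    finally show ?thesis by simp
  qed
  moreover have g: "exp_growth k (\<lambda>y. (- (d\<^sup>2)) * exp (k * \<bar>y\<bar>))"
    by (intro exp_growth_cmult exp_growth_exp_abs order_refl)
  ultimately have "gauss_avg t (\<lambda>y. 2 * d + (- (d\<^sup>2)) * exp (k * \<bar>y\<bar>)) x \<le> gauss_avg t (\<lambda>y. exp (- k * \<bar>y\<bar>)) x"
    using k by (intro gauss_avg_mono[where c = k] exp_growth_add[OF exp_growth_const g] exp_growth_exp_abs) auto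
  also have "gauss_avg t (\<lambda>y. 2 * d + (- (d\<^sup>2)) * exp (k * \<bar>y\<bar>)) x
      = 2 * d + (- (d\<^sup>2)) * gauss_avg t (\<lambda>y. exp (k * \<bar>y\<bar>)) x"
    using k by (simp only: gauss_avg_add[OF k exp_growth_const g] gauss_avg_const gauss_avg_cmult)
  finally have 1: "2 * d - d\<^sup>2 * gauss_avg t (\<lambda>y. exp (k * \<bar>y\<bar>)) x \<le> gauss_avg t (\<lambda>y. exp (- k * \<bar>y\<bar>)) x"
    by simp
  have "gauss_avg t (\<lambda>y. exp (k * \<bar>y\<bar>)) x \<le> 2 * exp (k\<^sup>2 * t / 2) * exp (k * \<bar>x\<bar>)"
    using t k by (intro gauss_avg_exp_abs_le) auto
  also have "\<dots> \<le> 2 * exp (k\<^sup>2 * T / 2) * exp (k * \<bar>x\<bar>)"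
    using t by (intro mult_right_mono mult_left_mono) (auto intro: mult_left_mono)
  also have "\<dots> = 1 / d"
    by (simp add: d_def exp_minus field_simps)
  finally have "d\<^sup>2 * gauss_avg t (\<lambda>y. exp (k * \<bar>y\<bar>)) x \<le> d\<^sup>2 * (1 / d)"
    by (intro mult_left_mono) auto
  also have "\<dots> = d" using d by (simp add: power2_eq_square)
  finally show ?thesis using 1 by (simp add: d_def)
qed

section \<open>The heat flow of \<open>exp (a * u)\<close>\<close>

text \<open>Meant for families closed under differentiation: the bounds at order \<open>n\<close>
  are available for all members at once, so \<open>F' k\<close> may be an expression in any of the
  \<open>F j\<close>.\<close>

lemma deriv_boundedI:
  assumes "\<And>n k. (\<And>k. deriv_bounded P n e (F k)) \<Longrightarrow> deriv_bounded P n e (F' k)"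
    and "\<And>k. \<exists>M. \<forall>p\<in>P. \<forall>x. \<bar>F k p x\<bar> \<le> M * e x"
    and "\<And>k p x. p \<in> P \<Longrightarrow> (F k p has_real_derivative F' k p x) (at x)"
  shows "deriv_bounded P n e (F k)"
proof (induction n arbitrary: k)
  case 0 show ?case using assms(2) by simp
next
  case (Suc n)
  show ?case using assms(2)[of k] assms(3)[of _ k] assms(1)[OF Suc.IH, of k]
    by auto
qed

lemma tame_deriv_bounded:
  assumes "tame u"
  shows "deriv_bounded (UNIV :: unit set) n (\<lambda>_. 1) (\<lambda>_. deriv u)"
proof -
  have "deriv_bounded (UNIV :: unit set) n (\<lambda>_. 1) (\<lambda>_ x. deriv u x - 1)"
    using assms by (intro deriv_bounded_weight[of UNIV n tail_weight _ 1 "\<lambda>_. 1"])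
      (auto simp: tame_def tail_weight_bounds simp del: deriv_bounded.simps)
  from deriv_bounded_add[OF this deriv_bounded_const[of _ _ 1]] show ?thesis by simp
qed

locale heat_flow =
  fixes u :: "real \<Rightarrow> real" and a T :: real
  assumes tame: "tame u" and a: "0 < a" "a \<le> 1" and T: "0 \<le> T"
begin

definition w :: "real \<Rightarrow> real" where "w y = exp (a * u y)"
definition W :: "nat \<Rightarrow> real \<Rightarrow> real \<Rightarrow> real" where "W k t = gauss_avg t ((deriv ^^ k) w)"
text \<open>These quotients play the role of moments: the \<open>x\<close>-derivatives of
  \<open>ln (W 0 t x)\<close> are the cumulants built from them.\<close>

definition \<omega> :: "nat \<Rightarrow> real \<Rightarrow> real \<Rightarrow> real" where "\<omega> k t x = W k t x / W 0 t x"
text \<open>The numerator is linear in \<open>w\<close> and vanishes when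
  \<open>w y = exp (a * y)\<close>, the growth at plus infinity; what remains carries the decay of
  \<open>u' - 1\<close>.\<close>

definition \<eta> :: "nat \<Rightarrow> real \<Rightarrow> real \<Rightarrow> real" where "\<eta> k t x = \<omega> (Suc k) t x - a * \<omega> k t x"

lemma u_deriv: "(u has_real_derivative deriv u x) (at x)"
  using tame by (simp add: tame_def)

lemma w_deriv: "(w has_real_derivative a * (w x * deriv u x)) (at x)"
  unfolding w_def by (auto intro!: derivative_eq_intros u_deriv)

lemma w_bounds: "\<exists>M m. m > 0 \<and> (\<forall>x. w x \<le> M * exp (a * \<bar>x\<bar>) \<and> m * exp (a * \<bar>x\<bar>) \<le> w x)"
proof -
  obtain c where c: "\<And>x. \<bar>u x - \<bar>x\<bar>\<bar> \<le> c" using tame by (auto simp: tame_def)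
  have "w x \<le> exp (a * c) * exp (a * \<bar>x\<bar>) \<and> exp (- a * c) * exp (a * \<bar>x\<bar>) \<le> w x" for x
  proof -
    have "u x \<le> c + \<bar>x\<bar>" "- c + \<bar>x\<bar> \<le> u x" using c[of x] by linarith+
    then have "a * u x \<le> a * (c + \<bar>x\<bar>)" "a * (- c + \<bar>x\<bar>) \<le> a * u x"
      using a by (simp_all only: mult_le_cancel_left_pos)
    then show ?thesis by (simp add: w_def algebra_simps flip: exp_add)
  qed
  then show ?thesis by (intro exI[of _ "exp (a * c)"] exI[of _ "exp (- a * c)"]) auto
qed

text \<open>The single function forms a family closed under differentiation, because
  \<open>w' = a * w * u'\<close> and all derivatives of \<open>u'\<close> are bounded.\<close>

lemma w_deriv_bounded: "deriv_bounded (UNIV :: unit set) n (\<lambda>x. exp (a * \<bar>x\<bar>)) (\<lambda>_. w)"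
proof -
  obtain M where M: "\<And>x. w x \<le> M * exp (a * \<bar>x\<bar>)" using w_bounds by auto
  show ?thesis
  proof (rule deriv_boundedI[where F = "\<lambda>_::unit. \<lambda>_. w" and F' = "\<lambda>_ _ x. a * (w x * deriv u x)" for k])
    show "\<exists>M. \<forall>p\<in>UNIV. \<forall>x. \<bar>w x\<bar> \<le> M * exp (a * \<bar>x\<bar>)"
      using M by (auto simp: w_def)
    show "deriv_bounded (UNIV :: unit set) n (\<lambda>x. exp (a * \<bar>x\<bar>)) (\<lambda>_ x. a * (w x * deriv u x))"
      if "\<And>k. deriv_bounded (UNIV :: unit set) n (\<lambda>x. exp (a * \<bar>x\<bar>)) (\<lambda>_. w)" for n
      using deriv_bounded_mult[OF that tame_deriv_bounded[OF tame]]
      by (intro deriv_bounded_cmult) auto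
  qed (rule w_deriv)
qed

text \<open>\<open>w' - a * w = a * w * (u' - 1)\<close>, and the tail weight is contributed by the
  last factor.\<close>

lemma w_error_deriv_bounded:
  "deriv_bounded (UNIV :: unit set) n (\<lambda>x. exp (a * \<bar>x\<bar>) * tail_weight x) (\<lambda>_ x. deriv w x - a * w x)"
proof -
  have "deriv_bounded (UNIV :: unit set) n tail_weight (\<lambda>_ x. a * (deriv u x - 1))"
    using tame by (intro deriv_bounded_cmult tail_weight_bounds) (simp add: tame_def)
  from deriv_bounded_mult[OF w_deriv_bounded this]
  have "deriv_bounded (UNIV :: unit set) n (\<lambda>x. exp (a * \<bar>x\<bar>) * tail_weight x) (\<lambda>_ x. w x * (a * (deriv u x - 1)))"
    by (simp add: tail_weight_bounds del: deriv_bounded.simps)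
  moreover have "deriv w x - a * w x = w x * (a * (deriv u x - 1))" for x
    using DERIV_imp_deriv[OF w_deriv, of x] by (simp add: algebra_simps)
  ultimately show ?thesis by (simp only:)
qed

lemma Dw: "((deriv ^^ k) w has_real_derivative (deriv ^^ Suc k) w x) (at x)"
  using deriv_bounded_iterated(2)[OF w_deriv_bounded] by blast

lemma Dw_growth: "exp_growth a ((deriv ^^ k) w)"
proof -
  obtain M where "\<And>x. \<bar>(deriv ^^ k) w x\<bar> \<le> M * exp (a * \<bar>x\<bar>)"
    using deriv_bounded_bound[OF deriv_bounded_iterated(1)[OF w_deriv_bounded, of 0 k]] by auto
  moreover have "continuous_on UNIV ((deriv ^^ k) w)"
    using Dw by (auto intro: DERIV_isCont continuous_at_imp_continuous_on)
  ultimately show ?thesis unfolding exp_growth_def by blast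
qed

lemma Dw_error_bound: "\<exists>M\<ge>0. \<forall>x. \<bar>(deriv ^^ Suc k) w x - a * (deriv ^^ k) w x\<bar> \<le> M * (exp (a * \<bar>x\<bar>) * tail_weight x)"
proof -
  have eq: "(deriv ^^ k) (\<lambda>x. deriv w x - a * w x) = (\<lambda>x. (deriv ^^ Suc k) w x - a * (deriv ^^ k) w x)" for k
  proof (induction k)
    case (Suc k)
    have "((\<lambda>x. (deriv ^^ Suc k) w x - a * (deriv ^^ k) w x) has_real_derivative
        (deriv ^^ Suc (Suc k)) w x - a * (deriv ^^ Suc k) w x) (at x)" for x
      by (intro DERIV_diff DERIV_cmult Dw)
    from DERIV_imp_deriv[OF this] show ?case using Suc by auto
  qed simp
  obtain M where "M \<ge> 0" "\<And>x. \<bar>(deriv ^^ k) (\<lambda>x. deriv w x - a * w x) x\<bar> \<le> M * (exp (a * \<bar>x\<bar>) * tail_weight x)"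
    using deriv_bounded_bound[OF deriv_bounded_iterated(1)[OF w_error_deriv_bounded, of 0 k]]
    by (auto simp: tail_weight_bounds)
  then show ?thesis unfolding eq by auto
qed

lemma W_deriv: "(W k t has_real_derivative W (Suc k) t x) (at x)"
proof -
  obtain M M' where "\<And>y. \<bar>(deriv ^^ k) w y\<bar> \<le> M * exp (a * \<bar>y\<bar>)" "\<And>y. \<bar>(deriv ^^ Suc k) w y\<bar> \<le> M' * exp (a * \<bar>y\<bar>)"
    using Dw_growth[of k] Dw_growth[of "Suc k"] unfolding exp_growth_def by blast
  then show ?thesis unfolding W_def
    using a Dw Dw_growth[of "Suc k"] by (intro gauss_avg_has_derivative[where c = a]) (auto simp: exp_growth_def)
qed

lemma W_time_deriv: "t > 0 \<Longrightarrow> ((\<lambda>s. W k s x) has_real_derivative W (Suc (Suc k)) t x / 2) (at t)"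
proof -
  assume t: "t > 0"
  obtain M M' M'' where "\<And>y. \<bar>(deriv ^^ k) w y\<bar> \<le> M * exp (a * \<bar>y\<bar>)" "\<And>y. \<bar>(deriv ^^ Suc k) w y\<bar> \<le> M' * exp (a * \<bar>y\<bar>)"
      "\<And>y. \<bar>(deriv ^^ Suc (Suc k)) w y\<bar> \<le> M'' * exp (a * \<bar>y\<bar>)"
    using Dw_growth[of k] Dw_growth[of "Suc k"] Dw_growth[of "Suc (Suc k)"] unfolding exp_growth_def by blast
  then show ?thesis unfolding W_def using t a Dw[of k] Dw[of "Suc k"] Dw_growth[of "Suc (Suc k)"]
    by (intro gauss_avg_has_time_derivative[where c = a and f' = "(deriv ^^ Suc k) w"]) (auto simp: exp_growth_def)
qed

lemma W_cont: "continuous_on UNIV (\<lambda>p. W k (fst p) (snd p))"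
  using Dw_growth[of k] a continuous_on_gauss_avg[of a] unfolding W_def exp_growth_def by auto

lemma W_even: "W 0 t (- x) = W 0 t x"
  unfolding W_def using tame Dw_growth[of 0]
  by (intro gauss_avg_even) (auto simp: w_def tame_def exp_growth_def)

text \<open>Averaging does not lower \<open>exp (a * \<bar>x\<bar>)\<close>, so the constant valid
  for \<open>w\<close> serves at all times; the bounds on the quotients by \<open>W 0\<close> rest
  on it.\<close>

lemma W0_ge: "\<exists>m>0. \<forall>t\<ge>0. \<forall>x. m * exp (a * \<bar>x\<bar>) \<le> W 0 t x"
proof -
  obtain m where m: "m > 0" "\<And>x. m * exp (a * \<bar>x\<bar>) \<le> w x" using w_bounds by auto
  have "m * exp (a * \<bar>x\<bar>) \<le> W 0 t x" if t: "t \<ge> 0" for t x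
  proof -
    have "m * exp (a * \<bar>x\<bar>) \<le> m * gauss_avg t (\<lambda>y. exp (a * \<bar>y\<bar>)) x"
      using t a m by (intro mult_left_mono gauss_avg_exp_abs_ge) auto
    also have "\<dots> = gauss_avg t (\<lambda>y. m * exp (a * \<bar>y\<bar>)) x" by (simp add: gauss_avg_cmult)
    also have "\<dots> \<le> W 0 t x" unfolding W_def
      using a m Dw_growth[of 0] by (intro gauss_avg_mono[where c = a] exp_growth_cmult exp_growth_exp_abs) auto
    finally show ?thesis .
  qed
  then show ?thesis using m by blast
qed

lemma W0_pos: "t \<ge> 0 \<Longrightarrow> W 0 t x > 0"
  using W0_ge by (meson exp_gt_zero less_le_trans mult_pos_pos)

lemma gauss_avg_le_weight:
  assumes f: "exp_growth a f" and M: "M \<ge> 0" "\<And>x. \<bar>f x\<bar> \<le> M * exp (a * \<bar>x\<bar>)" and t: "t \<in> {0..T}"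
  shows "\<bar>gauss_avg t f x\<bar> \<le> M * (2 * exp (a\<^sup>2 * T / 2)) * exp (a * \<bar>x\<bar>)"
proof -
  have "\<bar>gauss_avg t f x\<bar> \<le> gauss_avg t (\<lambda>y. M * exp (a * \<bar>y\<bar>)) x"
    using a M by (intro gauss_avg_abs_le[where c = a] f exp_growth_cmult exp_growth_exp_abs) auto
  also have "\<dots> = M * gauss_avg t (\<lambda>y. exp (a * \<bar>y\<bar>)) x" by (simp add: gauss_avg_cmult)
  also have "\<dots> \<le> M * (2 * exp (a\<^sup>2 * t / 2) * exp (a * \<bar>x\<bar>))"
    using t a M by (intro mult_left_mono gauss_avg_exp_abs_le) auto
  also have "\<dots> \<le> M * (2 * exp (a\<^sup>2 * T / 2) * exp (a * \<bar>x\<bar>))"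
    using t M by (intro mult_left_mono mult_right_mono) (auto intro: mult_left_mono)
  finally show ?thesis by (simp add: mult.assoc)
qed

lemma W_le: "\<exists>M. \<forall>t\<in>{0..T}. \<forall>x. \<bar>W k t x\<bar> \<le> M * exp (a * \<bar>x\<bar>)"
proof -
  obtain M where M: "\<forall>x. \<bar>(deriv ^^ k) w x\<bar> \<le> M * exp (a * \<bar>x\<bar>)"
    using Dw_growth[of k] by (auto simp: exp_growth_def)
  moreover from this have "M \<ge> 0" by (auto dest: spec[of _ 0])
  ultimately show ?thesis unfolding W_def using gauss_avg_le_weight[OF Dw_growth] by blast
qed

text \<open>Both for positive and for negative \<open>x\<close> the weight is dominated by \<open>exp ((a - 2) * x)\<close>, on
  which the Gaussian average acts by a scalar; here \<open>a \<le> 1\<close> is used.\<close>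

lemma W_error_le:
  "\<exists>M. \<forall>t\<in>{0..T}. \<forall>x. \<bar>W (Suc k) t x - a * W k t x\<bar> \<le> M * (exp (a * \<bar>x\<bar>) * tail_weight x)"
proof -
  let ?f = "\<lambda>x. (deriv ^^ Suc k) w x + (- a) * (deriv ^^ k) w x"
  obtain M where M: "M \<ge> 0" "\<And>x. \<bar>?f x\<bar> \<le> M * (exp (a * \<bar>x\<bar>) * tail_weight x)"
    using Dw_error_bound[of k] by auto
  have f: "exp_growth a ?f" by (intro exp_growth_add exp_growth_cmult Dw_growth)
  have Wf: "W (Suc k) t x - a * W k t x = gauss_avg t ?f x" for t x
    unfolding W_def gauss_avg_add[OF less_imp_le[OF a(1)] Dw_growth exp_growth_cmult[OF Dw_growth]] gauss_avg_cmult
    by simp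
  define M1 where "M1 = M * (2 * exp (a\<^sup>2 * T / 2))"
  define M2 where "M2 = M * exp ((a - 2)\<^sup>2 * T / 2)"
  have "\<bar>gauss_avg t ?f x\<bar> \<le> (M1 + M2) * (exp (a * \<bar>x\<bar>) * tail_weight x)" if t: "t \<in> {0..T}" for t x
  proof (cases "x \<ge> 0")
    case True
    have "\<bar>?f y\<bar> \<le> M * exp ((a - 2) * y)" for y
    proof -
      have "exp (a * \<bar>y\<bar>) * tail_weight y \<le> exp ((a - 2) * y)"
      proof (cases "y \<ge> 0")
        case True
        then have "tail_weight y = exp (- 2 * y)" by (simp add: tail_weight_def)
        then show ?thesis using True by (simp add: left_diff_distrib flip: exp_add)
      next
        case False
        then have "a * \<bar>y\<bar> \<le> (a - 2) * y" using a mult_right_mono_neg[of "2 * a" 2 y] by (simp add: algebra_simps)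
        moreover have "tail_weight y = 1" using False by (simp add: tail_weight_def)
        ultimately show ?thesis by simp
      qed
      from order_trans[OF M(2) mult_left_mono[OF this M(1)]] show ?thesis .
    qed
    then have "\<bar>gauss_avg t ?f x\<bar> \<le> gauss_avg t (\<lambda>y. M * exp ((a - 2) * y)) x"
      using a exp_growth_mono[OF f, of 2] by (intro gauss_avg_abs_le[where c = 2] exp_growth_cmult exp_growth_exp) auto
    also have "\<dots> = M * exp ((a - 2) * x + (a - 2)\<^sup>2 * t / 2)"
      using t by (simp add: gauss_avg_cmult gauss_avg_exp)
    also have "\<dots> \<le> M * exp ((a - 2) * x + (a - 2)\<^sup>2 * T / 2)"
      using t M(1) by (intro mult_left_mono) (auto intro: mult_left_mono)
    also have "\<dots> = M2 * (exp (a * \<bar>x\<bar>) * tail_weight x)"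
    proof -
      have "tail_weight x = exp (- 2 * x)" using True by (simp add: tail_weight_def)
      then have "exp (a * \<bar>x\<bar>) * tail_weight x = exp ((a - 2) * x)"
        using True by (simp add: left_diff_distrib flip: exp_add)
      then show ?thesis by (simp add: M2_def exp_add)
    qed
    also have "\<dots> \<le> (M1 + M2) * (exp (a * \<bar>x\<bar>) * tail_weight x)"
      using M(1) by (intro mult_right_mono) (auto simp: M1_def tail_weight_bounds)
    finally show ?thesis .
  next
    case False
    \<comment> \<open>For negative \<open>x\<close> the tail weight at \<open>x\<close> is 1, and
      the plain growth bound suffices.\<close>
    have "\<bar>?f y\<bar> \<le> M * exp (a * \<bar>y\<bar>)" for y
      by (rule order_trans[OF M(2) mult_left_mono[OF _ M(1)]]) (simp add: mult_left_le tail_weight_bounds)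
    then have "\<bar>gauss_avg t ?f x\<bar> \<le> M1 * exp (a * \<bar>x\<bar>)"
      unfolding M1_def by (rule gauss_avg_le_weight[OF f M(1) _ t])
    also have "\<dots> = M1 * (exp (a * \<bar>x\<bar>) * tail_weight x)" using False by (simp add: tail_weight_def)
    also have "\<dots> \<le> (M1 + M2) * (exp (a * \<bar>x\<bar>) * tail_weight x)"
      using M(1) by (intro mult_right_mono) (auto simp: M2_def tail_weight_bounds)
    finally show ?thesis .
  qed
  then show ?thesis unfolding Wf by blast
qed

text \<open>The growth \<open>exp (a * \<bar>x\<bar>)\<close> of the numerators cancels against the
  lower bound on \<open>W 0\<close>, leaving the weights 1 and \<open>tail_weight\<close>.\<close>

lemma omega_bound: "\<exists>M. \<forall>t\<in>{0..T}. \<forall>x. \<bar>\<omega> k t x\<bar> \<le> M * 1"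
  and eta_bound: "\<exists>M. \<forall>t\<in>{0..T}. \<forall>x. \<bar>\<eta> k t x\<bar> \<le> M * tail_weight x"
proof -
  obtain m where m: "m > 0" "\<And>t x. t \<ge> 0 \<Longrightarrow> m * exp (a * \<bar>x\<bar>) \<le> W 0 t x" using W0_ge by blast
  have key: "\<bar>F\<bar> / W 0 t x \<le> M / m * e"
    if "t \<in> {0..T}" "\<bar>F\<bar> \<le> M * (exp (a * \<bar>x\<bar>) * e)" for F t x M e
  proof -
    have "\<bar>F\<bar> / W 0 t x \<le> (M * (exp (a * \<bar>x\<bar>) * e)) / (m * exp (a * \<bar>x\<bar>))"
      using that m by (intro frac_le) (auto intro: order_trans[OF abs_ge_zero])
    then show ?thesis using m by simp
  qed
  obtain M where "\<forall>t\<in>{0..T}. \<forall>x. \<bar>W k t x\<bar> \<le> M * exp (a * \<bar>x\<bar>)" using W_le by blast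
  then show "\<exists>M. \<forall>t\<in>{0..T}. \<forall>x. \<bar>\<omega> k t x\<bar> \<le> M * 1"
    using key[of _ _ M _ 1] W0_pos by (intro exI[of _ "M / m"]) (simp add: \<omega>_def less_imp_le)
  obtain M where "\<forall>t\<in>{0..T}. \<forall>x. \<bar>W (Suc k) t x - a * W k t x\<bar> \<le> M * (exp (a * \<bar>x\<bar>) * tail_weight x)"
    using W_error_le by blast
  then show "\<exists>M. \<forall>t\<in>{0..T}. \<forall>x. \<bar>\<eta> k t x\<bar> \<le> M * tail_weight x"
    using key W0_pos by (intro exI[of _ "M / m"]) (simp add: \<eta>_def \<omega>_def less_imp_le flip: diff_divide_distrib)
qed

lemma omega_deriv: "t \<ge> 0 \<Longrightarrow> (\<omega> k t has_real_derivative \<omega> (Suc k) t x - \<omega> k t x * \<omega> 1 t x) (at x)"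
proof -
  assume "t \<ge> 0"
  then have W0: "W 0 t x \<noteq> 0" using W0_pos[of t x] by simp
  have "((\<lambda>x. W k t x / W 0 t x) has_real_derivative
      (W (Suc k) t x * W 0 t x - W k t x * W 1 t x) / (W 0 t x * W 0 t x)) (at x)"
    unfolding One_nat_def by (rule DERIV_divide[OF W_deriv W_deriv W0])
  moreover have "(W (Suc k) t x * W 0 t x - W k t x * W 1 t x) / (W 0 t x * W 0 t x)
      = \<omega> (Suc k) t x - \<omega> k t x * \<omega> 1 t x"
    unfolding \<omega>_def using W0 by (simp add: diff_divide_distrib)
  ultimately show ?thesis unfolding \<omega>_def by simp
qed

lemma eta_deriv: "t \<ge> 0 \<Longrightarrow> (\<eta> k t has_real_derivative \<eta> (Suc k) t x - \<eta> k t x * \<omega> 1 t x) (at x)"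
  unfolding \<eta>_def by (auto intro!: derivative_eq_intros omega_deriv simp: algebra_simps)

lemma omega_time_deriv: "t > 0 \<Longrightarrow>
    ((\<lambda>s. \<omega> k s x) has_real_derivative (\<omega> (Suc (Suc k)) t x - \<omega> k t x * \<omega> 2 t x) / 2) (at t)"
proof -
  assume t: "t > 0"
  then have W0: "W 0 t x \<noteq> 0" using W0_pos[of t x] by simp
  have "((\<lambda>s. W k s x / W 0 s x) has_real_derivative
      (W (Suc (Suc k)) t x / 2 * W 0 t x - W k t x * (W 2 t x / 2)) / (W 0 t x * W 0 t x)) (at t)"
    unfolding numeral_2_eq_2 by (rule DERIV_divide[OF W_time_deriv[OF t] W_time_deriv[OF t] W0])
  moreover have "(W (Suc (Suc k)) t x / 2 * W 0 t x - W k t x * (W 2 t x / 2)) / (W 0 t x * W 0 t x)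
      = (\<omega> (Suc (Suc k)) t x - \<omega> k t x * \<omega> 2 t x) / 2"
    unfolding \<omega>_def using W0 by (simp add: diff_divide_distrib)
  ultimately show ?thesis unfolding \<omega>_def by (simp only:)
qed

lemma omega_cont: "continuous_on ({0..T} \<times> UNIV) (\<lambda>p. \<omega> k (fst p) (snd p))"
  unfolding \<omega>_def by (intro continuous_intros continuous_on_subset[OF W_cont]) (simp_all, metis W0_pos atLeastAtMost_iff less_irrefl mem_Times_iff)

lemma omega_deriv_bounded: "deriv_bounded {0..T} n (\<lambda>_. 1) (\<omega> k)"
proof (rule deriv_boundedI[where F = \<omega> and F' = "\<lambda>k t x. \<omega> (Suc k) t x - \<omega> k t x * \<omega> 1 t x"])
  show "deriv_bounded {0..T} n (\<lambda>_. 1) (\<lambda>t x. \<omega> (Suc k) t x - \<omega> k t x * \<omega> 1 t x)"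
    if "\<And>k. deriv_bounded {0..T} n (\<lambda>_. 1) (\<omega> k)" for n k
    using deriv_bounded_mult[OF that[of k] that[of 1]] by (intro deriv_bounded_diff that) auto
qed (use omega_bound omega_deriv in auto)

text \<open>The derivative of \<open>\<eta> k\<close> is linear in the \<open>\<eta>\<close>, with
  bounded coefficients, so the tail weight persists at every order.\<close>

lemma eta_deriv_bounded: "deriv_bounded {0..T} n tail_weight (\<eta> k)"
proof (rule deriv_boundedI[where F = \<eta> and F' = "\<lambda>k t x. \<eta> (Suc k) t x - \<eta> k t x * \<omega> 1 t x"])
  show "deriv_bounded {0..T} n tail_weight (\<lambda>t x. \<eta> (Suc k) t x - \<eta> k t x * \<omega> 1 t x)"
    if "\<And>k. deriv_bounded {0..T} n tail_weight (\<eta> k)" for n k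
    using deriv_bounded_mult[OF that[of k] omega_deriv_bounded[of n 1]]
    by (intro deriv_bounded_diff that) (auto simp: tail_weight_bounds)
qed (use eta_bound eta_deriv in auto)

end

section \<open>Cumulants and the evolution of the derivatives of \<open>u\<close>\<close>

text \<open>Only the indices \<open>1\<close> to \<open>7\<close> are meaningful.\<close>

definition cumulant :: "nat \<Rightarrow> (nat \<Rightarrow> real) \<Rightarrow> real" where
  "cumulant k m =
    (if k = 1 then m 1
     else if k = 2 then m 2 - m 1 ^ 2
     else if k = 3 then m 3 - 3 * m 2 * m 1 + 2 * m 1 ^ 3
     else if k = 4 then m 4 - 4 * m 3 * m 1 - 3 * m 2 ^ 2 + 12 * m 2 * m 1 ^ 2 - 6 * m 1 ^ 4
     else if k = 5 then m 5 - 5 * m 4 * m 1 - 10 * m 3 * m 2 + 20 * m 3 * m 1 ^ 2 + 30 * m 2 ^ 2 * m 1 - 60 * m 2 * m 1 ^ 3 + 24 * m 1 ^ 5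
     else if k = 6 then
       m 6 - 6 * m 5 * m 1 - 15 * m 4 * m 2 + 30 * m 4 * m 1 ^ 2 - 10 * m 3 ^ 2 + 120 * m 3 * m 2 * m 1 - 120 * m 3 * m 1 ^ 3 + 30 * m 2 ^ 3 - 270 * m 2 ^ 2 * m 1 ^ 2 + 360 * m 2 * m 1 ^ 4 - 120 * m 1 ^ 6
     else
       m 7 - 7 * m 6 * m 1 - 21 * m 5 * m 2 + 42 * m 5 * m 1 ^ 2 - 35 * m 4 * m 3 + 210 * m 4 * m 2 * m 1 - 210 * m 4 * m 1 ^ 3 + 140 * m 3 ^ 2 * m 1 + 210 * m 3 * m 2 ^ 2 - 1260 * m 3 * m 2 * m 1 ^ 2 + 840 * m 3 * m 1 ^ 4 - 630 * m 2 ^ 3 * m 1 + 2520 * m 2 ^ 2 * m 1 ^ 3 - 2520 * m 2 * m 1 ^ 5 + 720 * m 1 ^ 7)"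

lemma cumulant_simps:
  "cumulant 1 m = m 1"
  "cumulant 2 m = m 2 - m 1 ^ 2"
  "cumulant 3 m = m 3 - 3 * m 2 * m 1 + 2 * m 1 ^ 3"
  "cumulant 4 m = m 4 - 4 * m 3 * m 1 - 3 * m 2 ^ 2 + 12 * m 2 * m 1 ^ 2 - 6 * m 1 ^ 4"
  "cumulant 5 m = m 5 - 5 * m 4 * m 1 - 10 * m 3 * m 2 + 20 * m 3 * m 1 ^ 2 + 30 * m 2 ^ 2 * m 1 - 60 * m 2 * m 1 ^ 3 + 24 * m 1 ^ 5"
  "cumulant 6 m = m 6 - 6 * m 5 * m 1 - 15 * m 4 * m 2 + 30 * m 4 * m 1 ^ 2 - 10 * m 3 ^ 2 + 120 * m 3 * m 2 * m 1 - 120 * m 3 * m 1 ^ 3 + 30 * m 2 ^ 3 - 270 * m 2 ^ 2 * m 1 ^ 2 + 360 * m 2 * m 1 ^ 4 - 120 * m 1 ^ 6"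
  "cumulant 7 m = m 7 - 7 * m 6 * m 1 - 21 * m 5 * m 2 + 42 * m 5 * m 1 ^ 2 - 35 * m 4 * m 3 + 210 * m 4 * m 2 * m 1 - 210 * m 4 * m 1 ^ 3 + 140 * m 3 ^ 2 * m 1 + 210 * m 3 * m 2 ^ 2 - 1260 * m 3 * m 2 * m 1 ^ 2 + 840 * m 3 * m 1 ^ 4 - 630 * m 2 ^ 3 * m 1 + 2520 * m 2 ^ 2 * m 1 ^ 3 - 2520 * m 2 * m 1 ^ 5 + 720 * m 1 ^ 7"
  by (simp_all add: cumulant_def)

text \<open>The assumption is the derivative rule for quotients of the successive derivatives of a
  function by that function. Cumulants are the derivatives of its logarithm, so differentiation
  raises the order by one; each case is a polynomial identity in the moments.\<close>

lemma cumulant_deriv: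
  assumes m: "\<And>k. ((\<lambda>x. m x k) has_real_derivative m x (Suc k) - m x k * m x 1) (at x)"
  shows "((\<lambda>x. cumulant 1 (m x)) has_real_derivative cumulant 2 (m x)) (at x)"
    and "((\<lambda>x. cumulant 2 (m x)) has_real_derivative cumulant 3 (m x)) (at x)"
    and "((\<lambda>x. cumulant 3 (m x)) has_real_derivative cumulant 4 (m x)) (at x)"
    and "((\<lambda>x. cumulant 4 (m x)) has_real_derivative cumulant 5 (m x)) (at x)"
    and "((\<lambda>x. cumulant 5 (m x)) has_real_derivative cumulant 6 (m x)) (at x)"
    and "((\<lambda>x. cumulant 6 (m x)) has_real_derivative cumulant 7 (m x)) (at x)"
proof -
  have d: "((\<lambda>x. m x 1) has_real_derivative m x 2 - m x 1 * m x 1) (at x)"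
    "((\<lambda>x. m x 2) has_real_derivative m x 3 - m x 2 * m x 1) (at x)"
    "((\<lambda>x. m x 3) has_real_derivative m x 4 - m x 3 * m x 1) (at x)"
    "((\<lambda>x. m x 4) has_real_derivative m x 5 - m x 4 * m x 1) (at x)"
    "((\<lambda>x. m x 5) has_real_derivative m x 6 - m x 5 * m x 1) (at x)"
    "((\<lambda>x. m x 6) has_real_derivative m x 7 - m x 6 * m x 1) (at x)"
    using m[of 1] m[of 2] m[of 3] m[of 4] m[of 5] m[of 6] by (simp_all add: numeral_eq_Suc)
  show "((\<lambda>x. cumulant 1 (m x)) has_real_derivative cumulant 2 (m x)) (at x)"
    using d(1) by (simp only: cumulant_simps power2_eq_square)
  show "((\<lambda>x. cumulant 2 (m x)) has_real_derivative cumulant 3 (m x)) (at x)"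
    unfolding cumulant_simps
    by (rule DERIV_cong, (rule derivative_intros d)+, simp, algebra)
  show "((\<lambda>x. cumulant 3 (m x)) has_real_derivative cumulant 4 (m x)) (at x)"
    unfolding cumulant_simps
    by (rule DERIV_cong, (rule derivative_intros d)+, simp, algebra)
  show "((\<lambda>x. cumulant 4 (m x)) has_real_derivative cumulant 5 (m x)) (at x)"
    unfolding cumulant_simps
    by (rule DERIV_cong, (rule derivative_intros d)+, simp, algebra)
  show "((\<lambda>x. cumulant 5 (m x)) has_real_derivative cumulant 6 (m x)) (at x)"
    unfolding cumulant_simps
    by (rule DERIV_cong, (rule derivative_intros d)+, simp, algebra)
  show "((\<lambda>x. cumulant 6 (m x)) has_real_derivative cumulant 7 (m x)) (at x)"
    unfolding cumulant_simps
    by (rule DERIV_cong, (rule derivative_intros d)+, simp, algebra)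
qed

text \<open>With \<open>k1\<close>, \<open>k2\<close> the first two cumulants, the logarithm of a
  heat solution has time derivative \<open>(k2 + k1^2) / 2\<close>, and the formulas are its
  successive \<open>x\<close>-derivatives. They are verified on the moments, which avoids
  interchanging derivatives in \<open>t\<close> and \<open>x\<close>.\<close>

lemma cumulant_time_deriv:
  assumes m: "\<And>k. ((\<lambda>t. m t k) has_real_derivative (m t (Suc (Suc k)) - m t k * m t 2) / 2) (at t)"
  shows "((\<lambda>t. cumulant 1 (m t)) has_real_derivative
      cumulant 3 (m t) / 2 + cumulant 1 (m t) * cumulant 2 (m t)) (at t)"
    and "((\<lambda>t. cumulant 2 (m t)) has_real_derivative
      cumulant 4 (m t) / 2 + cumulant 1 (m t) * cumulant 3 (m t) + cumulant 2 (m t) ^ 2) (at t)"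
    and "((\<lambda>t. cumulant 3 (m t)) has_real_derivative
      cumulant 5 (m t) / 2 + cumulant 1 (m t) * cumulant 4 (m t) + 3 * cumulant 2 (m t) * cumulant 3 (m t)) (at t)"
    and "((\<lambda>t. cumulant 4 (m t)) has_real_derivative
      cumulant 6 (m t) / 2 + cumulant 1 (m t) * cumulant 5 (m t) + 4 * cumulant 2 (m t) * cumulant 4 (m t) + 3 * cumulant 3 (m t) ^ 2) (at t)"
    and "((\<lambda>t. cumulant 5 (m t)) has_real_derivative
      cumulant 7 (m t) / 2 + cumulant 1 (m t) * cumulant 6 (m t) + 5 * cumulant 2 (m t) * cumulant 5 (m t) + 10 * cumulant 3 (m t) * cumulant 4 (m t)) (at t)"
proof -
  have d: "((\<lambda>t. m t 1) has_real_derivative (m t 3 - m t 1 * m t 2) / 2) (at t)"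
    "((\<lambda>t. m t 2) has_real_derivative (m t 4 - m t 2 * m t 2) / 2) (at t)"
    "((\<lambda>t. m t 3) has_real_derivative (m t 5 - m t 3 * m t 2) / 2) (at t)"
    "((\<lambda>t. m t 4) has_real_derivative (m t 6 - m t 4 * m t 2) / 2) (at t)"
    "((\<lambda>t. m t 5) has_real_derivative (m t 7 - m t 5 * m t 2) / 2) (at t)"
    using m[of 1] m[of 2] m[of 3] m[of 4] m[of 5] by (simp_all add: numeral_eq_Suc)
  show "((\<lambda>t. cumulant 1 (m t)) has_real_derivative
      cumulant 3 (m t) / 2 + cumulant 1 (m t) * cumulant 2 (m t)) (at t)"
    unfolding cumulant_simps
    by (rule DERIV_cong, rule d, simp add: field_simps, algebra)
  show "((\<lambda>t. cumulant 2 (m t)) has_real_derivative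
      cumulant 4 (m t) / 2 + cumulant 1 (m t) * cumulant 3 (m t) + cumulant 2 (m t) ^ 2) (at t)"
    unfolding cumulant_simps
    by (rule DERIV_cong, (rule derivative_intros d)+, simp add: field_simps, algebra)
  show "((\<lambda>t. cumulant 3 (m t)) has_real_derivative
      cumulant 5 (m t) / 2 + cumulant 1 (m t) * cumulant 4 (m t) + 3 * cumulant 2 (m t) * cumulant 3 (m t)) (at t)"
    unfolding cumulant_simps
    by (rule DERIV_cong, (rule derivative_intros d)+, simp add: field_simps, algebra)
  show "((\<lambda>t. cumulant 4 (m t)) has_real_derivative
      cumulant 6 (m t) / 2 + cumulant 1 (m t) * cumulant 5 (m t) + 4 * cumulant 2 (m t) * cumulant 4 (m t) + 3 * cumulant 3 (m t) ^ 2) (at t)"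
    unfolding cumulant_simps
    by (rule DERIV_cong, (rule derivative_intros d)+, simp add: field_simps, algebra)
  show "((\<lambda>t. cumulant 5 (m t)) has_real_derivative
      cumulant 7 (m t) / 2 + cumulant 1 (m t) * cumulant 6 (m t) + 5 * cumulant 2 (m t) * cumulant 5 (m t) + 10 * cumulant 3 (m t) * cumulant 4 (m t)) (at t)"
    unfolding cumulant_simps
    by (rule DERIV_cong, (rule derivative_intros d)+, simp add: field_simps, algebra)
qed

lemma cumulant_continuous_on:
  assumes "\<And>k. continuous_on S (\<lambda>x. m x k)"
  shows "continuous_on S (\<lambda>x. cumulant k (m x))"
proof -
  consider "k = 1" | "k = 2" | "k = 3" | "k = 4" | "k = 5" | "k = 6" | "k \<notin> {1,2,3,4,5,6}" by auto
  then show ?thesis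
    by cases (simp_all add: cumulant_def continuous_intros assms)
qed

section \<open>Parity and higher derivatives of tame functions\<close>

lemma higher_deriv_parity:
  fixes f :: "real \<Rightarrow> real"
  assumes even: "\<And>x. f (- x) = f x"
    and der: "\<And>k x. ((deriv ^^ k) f has_real_derivative (deriv ^^ Suc k) f x) (at x)"
  shows "(deriv ^^ k) f (- x) = (- 1) ^ k * (deriv ^^ k) f x"
proof (induction k arbitrary: x)
  case (Suc k)
  have eq: "(\<lambda>x. (deriv ^^ k) f (- x)) = (\<lambda>x. (- 1) ^ k * (deriv ^^ k) f x)"
    using Suc by auto
  have "((\<lambda>x. (deriv ^^ k) f (- x)) has_real_derivative (deriv ^^ Suc k) f (- x) * (- 1)) (at x)"
    by (rule DERIV_chain2[OF der]) (auto intro!: derivative_eq_intros)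
  moreover have "((\<lambda>x. (deriv ^^ k) f (- x)) has_real_derivative (- 1) ^ k * (deriv ^^ Suc k) f x) (at x)"
    unfolding eq by (rule DERIV_cmult[OF der])
  ultimately have "(deriv ^^ Suc k) f (- x) * (- 1) = (- 1) ^ k * (deriv ^^ Suc k) f x"
    by (rule DERIV_unique)
  then show ?case by simp
qed (use even in simp)

lemma tame_higher_deriv:
  assumes "tame u"
  shows "((deriv ^^ k) u has_real_derivative (deriv ^^ Suc k) u x) (at x)"
proof (cases k)
  case 0 then show ?thesis using assms by (simp add: tame_def)
next
  case (Suc j)
  show ?thesis
    using deriv_bounded_iterated(2)[OF tame_deriv_bounded[OF assms], where k = j] Suc
    by (simp add: funpow_swap1)
qed

lemma tame_higher_deriv_parity:
  "tame u \<Longrightarrow> (deriv ^^ k) u (- x) = (- 1) ^ k * (deriv ^^ k) u x"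
  by (rule higher_deriv_parity, simp add: tame_def, rule tame_higher_deriv)

section \<open>The evolving function and its derivatives\<close>

context heat_flow
begin

definition v :: "real \<Rightarrow> real \<Rightarrow> real" where "v t = log_transform a t u"

text \<open>An explicit formula for what \<open>higher_deriv_v\<close> identifies as the
  \<open>k\<close>-th derivative of \<open>v t\<close>, for \<open>k\<close> from 1 to 7; time
  derivatives and joint continuity are then inherited from the \<open>\<omega>\<close>.\<close>

definition V :: "nat \<Rightarrow> real \<Rightarrow> real \<Rightarrow> real" where "V k t x = cumulant k (\<lambda>j. \<omega> j t x) / a"

lemma v_eq: "v t x = 1 / a * ln (W 0 t x)"
  by (simp add: v_def log_transform_def W_def w_def[abs_def])

lemma omega_0: "t \<ge> 0 \<Longrightarrow> \<omega> 0 t x = 1"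
  using W0_pos[of t x] by (simp add: \<omega>_def)

lemma v_deriv: "t \<ge> 0 \<Longrightarrow> (v t has_real_derivative V 1 t x) (at x)"
proof -
  assume t: "t \<ge> 0"
  have "((\<lambda>x. 1 / a * ln (W 0 t x)) has_real_derivative 1 / a * (1 / W 0 t x * W 1 t x)) (at x)"
    using W0_pos[OF t, of x] W_deriv[of 0 t x] by (intro DERIV_cmult DERIV_chain2[OF DERIV_ln_divide]) auto
  moreover have "v t = (\<lambda>x. 1 / a * ln (W 0 t x))" using v_eq by blast
  moreover have "1 / a * (1 / W 0 t x * W 1 t x) = V 1 t x"
    by (simp add: V_def cumulant_simps \<omega>_def del: One_nat_def)
  ultimately show ?thesis by (simp only:)
qed

lemma V_deriv:
  assumes "t \<ge> 0"
  shows "(V 1 t has_real_derivative V 2 t x) (at x)" "(V 2 t has_real_derivative V 3 t x) (at x)"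
    "(V 3 t has_real_derivative V 4 t x) (at x)" "(V 4 t has_real_derivative V 5 t x) (at x)"
    "(V 5 t has_real_derivative V 6 t x) (at x)" "(V 6 t has_real_derivative V 7 t x) (at x)"
proof -
  note d = cumulant_deriv[of "\<lambda>x j. \<omega> j t x", OF omega_deriv[OF assms]]
  show "(V 1 t has_real_derivative V 2 t x) (at x)" unfolding V_def[abs_def] by (rule DERIV_cdivide[OF d(1)])
  show "(V 2 t has_real_derivative V 3 t x) (at x)" unfolding V_def[abs_def] by (rule DERIV_cdivide[OF d(2)])
  show "(V 3 t has_real_derivative V 4 t x) (at x)" unfolding V_def[abs_def] by (rule DERIV_cdivide[OF d(3)])
  show "(V 4 t has_real_derivative V 5 t x) (at x)" unfolding V_def[abs_def] by (rule DERIV_cdivide[OF d(4)])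
  show "(V 5 t has_real_derivative V 6 t x) (at x)" unfolding V_def[abs_def] by (rule DERIV_cdivide[OF d(5)])
  show "(V 6 t has_real_derivative V 7 t x) (at x)" unfolding V_def[abs_def] by (rule DERIV_cdivide[OF d(6)])
qed

text \<open>Passing from cumulants to \<open>V\<close> divides by \<open>a\<close>, so linear terms
  keep their coefficients and quadratic ones acquire a factor \<open>a\<close>.\<close>

lemma V_time_deriv:
  assumes "t > 0"
  shows "((\<lambda>s. V 1 s x) has_real_derivative V 3 t x / 2 + a * (V 1 t x * V 2 t x)) (at t)"
    "((\<lambda>s. V 2 s x) has_real_derivative V 4 t x / 2 + a * (V 1 t x * V 3 t x) + a * (V 2 t x)\<^sup>2) (at t)"
    "((\<lambda>s. V 3 s x) has_real_derivative V 5 t x / 2 + a * (V 1 t x * V 4 t x) + a * (3 * V 2 t x * V 3 t x)) (at t)"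
    "((\<lambda>s. V 4 s x) has_real_derivative V 6 t x / 2 + a * (V 1 t x * V 5 t x)
        + a * (4 * V 2 t x * V 4 t x + 3 * (V 3 t x)\<^sup>2)) (at t)"
    "((\<lambda>s. V 5 s x) has_real_derivative V 7 t x / 2 + a * (V 1 t x * V 6 t x)
        + a * (5 * V 2 t x * V 5 t x + 10 * V 3 t x * V 4 t x)) (at t)"
proof -
  note d = cumulant_time_deriv[of "\<lambda>s j. \<omega> j s x", OF omega_time_deriv[OF assms]]
  show "((\<lambda>s. V 1 s x) has_real_derivative V 3 t x / 2 + a * (V 1 t x * V 2 t x)) (at t)"
    unfolding V_def by (rule DERIV_cong[OF DERIV_cdivide[OF d(1)]]) (use a in \<open>simp add: field_simps power2_eq_square\<close>)
  show "((\<lambda>s. V 2 s x) has_real_derivative V 4 t x / 2 + a * (V 1 t x * V 3 t x) + a * (V 2 t x)\<^sup>2) (at t)"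
    unfolding V_def by (rule DERIV_cong[OF DERIV_cdivide[OF d(2)]]) (use a in \<open>simp add: field_simps power2_eq_square\<close>)
  show "((\<lambda>s. V 3 s x) has_real_derivative V 5 t x / 2 + a * (V 1 t x * V 4 t x) + a * (3 * V 2 t x * V 3 t x)) (at t)"
    unfolding V_def by (rule DERIV_cong[OF DERIV_cdivide[OF d(3)]]) (use a in \<open>simp add: field_simps power2_eq_square\<close>)
  show "((\<lambda>s. V 4 s x) has_real_derivative V 6 t x / 2 + a * (V 1 t x * V 5 t x)
        + a * (4 * V 2 t x * V 4 t x + 3 * (V 3 t x)\<^sup>2)) (at t)"
    unfolding V_def by (rule DERIV_cong[OF DERIV_cdivide[OF d(4)]]) (use a in \<open>simp add: field_simps power2_eq_square\<close>)
  show "((\<lambda>s. V 5 s x) has_real_derivative V 7 t x / 2 + a * (V 1 t x * V 6 t x)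
        + a * (5 * V 2 t x * V 5 t x + 10 * V 3 t x * V 4 t x)) (at t)"
    unfolding V_def by (rule DERIV_cong[OF DERIV_cdivide[OF d(5)]]) (use a in \<open>simp add: field_simps power2_eq_square\<close>)
qed

lemma V_cont: "continuous_on ({0..T} \<times> UNIV) (\<lambda>p. V k (fst p) (snd p))"
  unfolding V_def using a by (intro continuous_on_divide cumulant_continuous_on omega_cont continuous_on_const) auto

lemma deriv_v: "t \<ge> 0 \<Longrightarrow> deriv (v t) = V 1 t"
  using DERIV_imp_deriv[OF v_deriv] by auto

lemma deriv_v_2: "t \<ge> 0 \<Longrightarrow> deriv (V 1 t) = V 2 t"
  using DERIV_imp_deriv[OF V_deriv(1)] by auto

lemma higher_deriv_v:
  assumes "t \<ge> 0" "k \<in> {1..7}"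
  shows "(deriv ^^ k) (v t) = V k t"
proof -
  have "deriv (V 1 t) = V 2 t" "deriv (V 2 t) = V 3 t" "deriv (V 3 t) = V 4 t"
    "deriv (V 4 t) = V 5 t" "deriv (V 5 t) = V 6 t" "deriv (V 6 t) = V 7 t"
    using V_deriv[OF assms(1), THEN DERIV_imp_deriv] by auto
  moreover have "k = 1 \<or> k = 2 \<or> k = 3 \<or> k = 4 \<or> k = 5 \<or> k = 6 \<or> k = 7" using assms(2) by auto
  ultimately show ?thesis using deriv_v[OF assms(1)] by (elim disjE) (simp_all add: numeral_eq_Suc)
qed

text \<open>Since \<open>\<omega> 0 = 1\<close>, the slope defect is a multiple of
  \<open>\<eta> 0\<close>; this is how the decay of \<open>\<eta>\<close> reaches the derivatives of
  \<open>v\<close>.\<close>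

lemma V1_minus_1: "t \<ge> 0 \<Longrightarrow> V 1 t x - 1 = 1 / a * \<eta> 0 t x"
  using a by (simp add: V_def cumulant_simps(1) \<eta>_def omega_0 diff_divide_distrib flip: One_nat_def)

lemma V_deriv_bounded: "deriv_bounded {0..T} n tail_weight (\<lambda>t x. V 1 t x - 1)"
proof -
  have "deriv_bounded {0..T} n tail_weight (\<lambda>t x. 1 / a * \<eta> 0 t x)"
    by (intro deriv_bounded_cmult eta_deriv_bounded tail_weight_bounds)
  moreover have "(\<lambda>x. V 1 t x - 1) = (\<lambda>x. 1 / a * \<eta> 0 t x)" if "t \<in> {0..T}" for t
    using that by (intro ext V1_minus_1) simp
  ultimately show ?thesis
    using deriv_bounded_cong[of "{0..T}" "\<lambda>t x. V 1 t x - 1" "\<lambda>t x. 1 / a * \<eta> 0 t x"] by blast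
qed

lemma v_bound: "\<exists>c. \<forall>t\<in>{0..T}. \<forall>x. \<bar>v t x - \<bar>x\<bar>\<bar> \<le> c"
proof -
  obtain m where m: "m > 0" "\<And>t x. t \<ge> 0 \<Longrightarrow> m * exp (a * \<bar>x\<bar>) \<le> W 0 t x" using W0_ge by blast
  obtain M where M: "\<And>t x. t \<in> {0..T} \<Longrightarrow> \<bar>W 0 t x\<bar> \<le> M * exp (a * \<bar>x\<bar>)" using W_le by blast
  have "M * exp (a * \<bar>0\<bar>) > 0" using M[of 0 0] m(2)[of 0 0] m(1) T by simp
  then have Mpos: "M > 0" by simp
  have "\<bar>v t x - \<bar>x\<bar>\<bar> \<le> (\<bar>ln m\<bar> + \<bar>ln M\<bar>) / a" if t: "t \<in> {0..T}" for t x
  proof -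
    have "ln (m * exp (a * \<bar>x\<bar>)) \<le> ln (W 0 t x)" "ln (W 0 t x) \<le> ln (M * exp (a * \<bar>x\<bar>))"
      using m M[OF t, of x] t W0_pos[of t x] by (auto intro!: ln_mono)
    then have "ln m + a * \<bar>x\<bar> \<le> ln (W 0 t x)" "ln (W 0 t x) \<le> ln M + a * \<bar>x\<bar>"
      using m Mpos by (simp_all add: ln_mult)
    then have "\<bar>ln (W 0 t x) - a * \<bar>x\<bar>\<bar> \<le> \<bar>ln m\<bar> + \<bar>ln M\<bar>" by linarith
    then have "\<bar>ln (W 0 t x) - a * \<bar>x\<bar>\<bar> / a \<le> (\<bar>ln m\<bar> + \<bar>ln M\<bar>) / a" using a by (simp add: divide_right_mono)
    moreover have "v t x - \<bar>x\<bar> = (ln (W 0 t x) - a * \<bar>x\<bar>) / a"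
      using a by (simp add: v_eq diff_divide_distrib)
    ultimately show ?thesis using a by simp
  qed
  then show ?thesis by blast
qed

text \<open>Completing the square in the tilted average: \<open>w'' - 2 * l * w' + l\<^sup>2 * w \<ge> a * u'' * w\<close> with
  \<open>l = \<omega> 1 t x\<close>.\<close>

lemma V2_ge: "\<exists>m>0. \<forall>t\<in>{0..T}. \<forall>x. m * exp (- 2 * \<bar>x\<bar>) \<le> V 2 t x"
proof -
  obtain m0 where m0: "m0 > 0" "\<And>x. m0 * exp (- 2 * \<bar>x\<bar>) \<le> deriv (deriv u) x" using tame by (auto simp: tame_def)
  obtain m1 where m1: "m1 > 0" "\<And>x. m1 * exp (a * \<bar>x\<bar>) \<le> w x" using w_bounds by auto
  obtain M where M: "\<And>t x. t \<in> {0..T} \<Longrightarrow> \<bar>W 0 t x\<bar> \<le> M * exp (a * \<bar>x\<bar>)" using W_le by blast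
  have wpos: "w y > 0" for y by (simp add: w_def)
  have M0: "M > 0"
  proof -
    have "M * exp (a * \<bar>0\<bar>) > 0" using M[of 0 0] W0_pos[of 0 0] T by simp
    then show ?thesis by simp
  qed
  \<comment> \<open>\<open>w * u''\<close> is bounded below by a multiple of
    \<open>exp (- k * \<bar>x\<bar>)\<close>; division by \<open>W 0\<close>, which is at most a
    multiple of \<open>exp (a * \<bar>x\<bar>)\<close>, restores the rate 2.\<close>
  define k where "k = 2 - a"
  have k: "k \<ge> 0" using a by (simp add: k_def)
  define q where "q = exp (- k\<^sup>2 * T / 2) / 2"
  have q: "q > 0" by (simp add: q_def)
  have dw: "deriv w = (\<lambda>x. a * (w x * deriv u x))" using DERIV_imp_deriv[OF w_deriv] by blast
  have ddw: "deriv (deriv w) y = a * (w y * deriv (deriv u) y) + w y * (a * deriv u y)\<^sup>2" for y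
  proof -
    have "(deriv u has_real_derivative deriv (deriv u) y) (at y)"
      using tame_higher_deriv[OF tame, of 1] by simp
    then have "(deriv w has_real_derivative a * (w y * deriv (deriv u) y) + w y * (a * deriv u y)\<^sup>2) (at y)"
      unfolding dw by (auto intro!: derivative_eq_intros w_deriv simp: power2_eq_square algebra_simps)
    then show ?thesis by (rule DERIV_imp_deriv)
  qed
  have "m0 * m1 * q / M * exp (- 2 * \<bar>x\<bar>) \<le> V 2 t x" if t: "t \<in> {0..T}" for t x
  proof -
    define l where "l = \<omega> 1 t x"
    have W0: "W 0 t x > 0" using W0_pos t by simp
    let ?f = "\<lambda>y. (deriv ^^ 2) w y + ((- 2 * l) * (deriv ^^ 1) w y + l\<^sup>2 * (deriv ^^ 0) w y)"
    let ?g = "\<lambda>y. (a * (m0 * m1)) * exp (- k * \<bar>y\<bar>)"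
    have "?g y \<le> ?f y" for y
    proof -
      have "?f y = a * (w y * deriv (deriv u) y) + w y * (a * deriv u y - l)\<^sup>2"
        using ddw[of y] by (simp add: numeral_2_eq_2 dw power2_eq_square algebra_simps)
      then have "a * (w y * deriv (deriv u) y) \<le> ?f y" using wpos[of y] by simp
      moreover have "a * ((m1 * exp (a * \<bar>y\<bar>)) * (m0 * exp (- 2 * \<bar>y\<bar>))) \<le> a * (w y * deriv (deriv u) y)"
        using a m0 m1 wpos[of y] by (intro mult_left_mono mult_mono) (auto simp: less_imp_le)
      moreover have "a * ((m1 * exp (a * \<bar>y\<bar>)) * (m0 * exp (- 2 * \<bar>y\<bar>))) = ?g y"
      proof -
        have "exp (a * \<bar>y\<bar>) * exp (- 2 * \<bar>y\<bar>) = exp (- k * \<bar>y\<bar>)"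
          by (simp add: k_def left_diff_distrib flip: exp_add)
        then show ?thesis by (metis (no_types, opaque_lifting) mult.assoc mult.commute)
      qed
      ultimately show ?thesis by linarith
    qed
    then have "gauss_avg t ?g x \<le> gauss_avg t ?f x"
      using a k by (intro gauss_avg_mono[where c = a] exp_growth_add exp_growth_cmult Dw_growth exp_growth_exp_abs) auto
    also have "gauss_avg t ?f x = W 2 t x + ((- 2 * l) * W 1 t x + l\<^sup>2 * W 0 t x)"
      unfolding W_def gauss_avg_add[OF less_imp_le[OF a(1)] Dw_growth exp_growth_add[OF exp_growth_cmult[OF Dw_growth] exp_growth_cmult[OF Dw_growth]]]
        gauss_avg_add[OF less_imp_le[OF a(1)] exp_growth_cmult[OF Dw_growth] exp_growth_cmult[OF Dw_growth]] gauss_avg_cmult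
      by (rule refl)
    \<comment> \<open>With \<open>l\<close> the first moment, the average is \<open>W 0\<close>
      times the second central moment, which is \<open>a * V 2\<close>.\<close>
    also have "\<dots> = W 0 t x * (a * V 2 t x)"
      using W0 a by (simp add: l_def V_def cumulant_simps \<omega>_def field_simps power2_eq_square)
    finally have 1: "a * (m0 * m1) * gauss_avg t (\<lambda>y. exp (- k * \<bar>y\<bar>)) x \<le> W 0 t x * (a * V 2 t x)"
      by (simp add: gauss_avg_cmult)
    have "q * exp (- k * \<bar>x\<bar>) \<le> gauss_avg t (\<lambda>y. exp (- k * \<bar>y\<bar>)) x"
      unfolding q_def using gauss_avg_exp_neg_abs_ge[OF t k] .
    then have "a * (m0 * m1) * (q * exp (- k * \<bar>x\<bar>)) \<le> a * (m0 * m1) * gauss_avg t (\<lambda>y. exp (- k * \<bar>y\<bar>)) x"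
      using a m0 m1 by (intro mult_left_mono) auto
    with 1 have "a * ((m0 * m1) * (q * exp (- k * \<bar>x\<bar>))) \<le> a * (W 0 t x * V 2 t x)"
      by (simp add: mult_ac)
    then have 2: "(m0 * m1) * (q * exp (- k * \<bar>x\<bar>)) \<le> W 0 t x * V 2 t x"
      using a by (simp only: mult_le_cancel_left_pos)
    moreover have "0 < (m0 * m1) * (q * exp (- k * \<bar>x\<bar>))" using m0 m1 q by simp
    ultimately have "0 < W 0 t x * V 2 t x" by linarith
    then have "V 2 t x > 0" using W0 by (simp add: zero_less_mult_iff)
    then have "W 0 t x * V 2 t x \<le> M * exp (a * \<bar>x\<bar>) * V 2 t x"
      using M[OF t, of x] by (intro mult_right_mono) auto
    with 2 have "(m0 * m1) * (q * exp (- k * \<bar>x\<bar>)) \<le> M * exp (a * \<bar>x\<bar>) * V 2 t x" by linarith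
    then have "(m0 * m1) * (q * exp (- k * \<bar>x\<bar>)) / (M * exp (a * \<bar>x\<bar>)) \<le> V 2 t x"
      using M0 by (simp add: divide_le_eq mult_ac)
    moreover have "exp (- k * \<bar>x\<bar>) / exp (a * \<bar>x\<bar>) = exp (- 2 * \<bar>x\<bar>)"
      by (simp add: k_def algebra_simps flip: exp_diff)
    then have "(m0 * m1) * (q * exp (- k * \<bar>x\<bar>)) / (M * exp (a * \<bar>x\<bar>)) = m0 * m1 * q / M * exp (- 2 * \<bar>x\<bar>)"
      by (metis (no_types, opaque_lifting) mult.assoc times_divide_times_eq)
    ultimately show ?thesis by simp
  qed
  moreover have "m0 * m1 * q / M > 0" using m0 m1 q M0 by simp
  ultimately show ?thesis by blast
qed

lemma tame_v: "t \<in> {0..T} \<Longrightarrow> tame (v t)"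
proof -
  assume t: "t \<in> {0..T}"
  then have t0: "t \<ge> 0" by simp
  have "deriv_bounded (UNIV :: unit set) n tail_weight (\<lambda>_ x. V 1 t x - 1)" for n
    using deriv_bounded_reindex[OF V_deriv_bounded, of UNIV "\<lambda>_. t"] t by simp
  moreover have "\<exists>c. \<forall>x. \<bar>v t x - \<bar>x\<bar>\<bar> \<le> c" using v_bound t by blast
  moreover have "\<exists>m>0. \<forall>x. m * exp (- 2 * \<bar>x\<bar>) \<le> V 2 t x" using V2_ge t by blast
  moreover have "v t (- x) = v t x" for x by (simp add: v_eq W_even)
  ultimately show ?thesis
    unfolding tame_def deriv_v[OF t0] deriv_v_2[OF t0] using v_deriv[OF t0] by blast
qed

lemma V_parity: "t \<in> {0..T} \<Longrightarrow> k \<in> {1..7} \<Longrightarrow> V k t (- x) = (- 1) ^ k * V k t x"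
  using tame_higher_deriv_parity[OF tame_v, of t k x] higher_deriv_v[of t k] by simp

text \<open>For \<open>x \<ge> 0\<close> the tail weight is \<open>exp (- 2 * x)\<close>, and parity
  reflects the bound; from order 2 on the constant subtracted from \<open>V 1\<close> is
  gone.\<close>

lemma V_bound:
  assumes "k \<in> {2..7}"
  shows "\<exists>M\<ge>0. \<forall>t\<in>{0..T}. \<forall>x. \<bar>V k t x\<bar> \<le> M * exp (- 2 * \<bar>x\<bar>)"
proof -
  define j where "j = k - 1"
  have j: "k = Suc j" "j \<ge> 1" using assms by (auto simp: j_def)
  obtain M where M: "M \<ge> 0" "\<And>t x. t \<in> {0..T} \<Longrightarrow> \<bar>(deriv ^^ j) (\<lambda>x. V 1 t x - 1) x\<bar> \<le> M * tail_weight x"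
    using deriv_bounded_bound[OF deriv_bounded_iterated(1)[OF V_deriv_bounded, of 0 j] tail_weight_bounds(1)] by blast
  have eq: "(deriv ^^ j) (\<lambda>x. V 1 t x - 1) = V k t" if t: "t \<in> {0..T}" for t
  proof -
    have "deriv (\<lambda>x. V 1 t x - 1) = deriv (V 1 t)"
    proof
      fix x
      have "((\<lambda>x. V 1 t x - 1) has_real_derivative V 2 t x - 0) (at x)"
        using t by (intro DERIV_diff V_deriv DERIV_const) auto
      from DERIV_imp_deriv[OF this] show "deriv (\<lambda>x. V 1 t x - 1) x = deriv (V 1 t) x"
        using deriv_v_2 t by simp
    qed
    then have "(deriv ^^ j) (\<lambda>x. V 1 t x - 1) = (deriv ^^ j) (V 1 t)"
      using j(2) by (cases j) (auto simp: funpow_swap1)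
    also have "\<dots> = (deriv ^^ Suc j) (v t)" using deriv_v[of t] t by (simp add: funpow_swap1)
    finally show ?thesis using higher_deriv_v[of t k] t assms j by simp
  qed
  have "\<bar>V k t x\<bar> \<le> M * exp (- 2 * \<bar>x\<bar>)" if t: "t \<in> {0..T}" for t x
  proof -
    have "\<bar>V k t x\<bar> = \<bar>V k t \<bar>x\<bar>\<bar>"
      using V_parity[OF t, of k x] assms by (auto simp: abs_if[of x] abs_mult power_abs)
    also have "\<dots> \<le> M * tail_weight \<bar>x\<bar>" using M(2)[OF t, of "\<bar>x\<bar>"] eq[OF t] by simp
    finally show ?thesis by (simp add: tail_weight_def)
  qed
  then show ?thesis using M(1) by blast
qed

end

section \<open>Propagation of the curvature inequalities\<close>

text \<open>A derivative in the slope is an \<open>x\<close>-derivative divided by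
  \<open>u''\<close>. The terms below are polynomials in these ratios, \<open>a\<close> and
  \<open>u''\<close>, and differentiation in \<open>x\<close> keeps them polynomial.\<close>

definition deriv_ratio :: "nat \<Rightarrow> (real \<Rightarrow> real) \<Rightarrow> real \<Rightarrow> real" where
  "deriv_ratio k f x = (deriv ^^ k) f x / (deriv ^^ 2) f x"

text \<open>In the variable \<open>B = u'\<close> these are \<open>2 * C * J\<close>, \<open>2 * C\<^sup>2 * J\<^sub>B\<close> and \<open>4 * C * (3 * z * J - C * J\<^sub>B)\<close>.\<close>

definition J_term :: "(real \<Rightarrow> real) \<Rightarrow> real \<Rightarrow> real \<Rightarrow> real" where
  "J_term u a x = (deriv_ratio 3 u x)\<^sup>2 - deriv_ratio 4 u x - 2 * a * (deriv ^^ 2) u x"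

definition J_slope_term :: "(real \<Rightarrow> real) \<Rightarrow> real \<Rightarrow> real" where
  "J_slope_term u x = - deriv_ratio 5 u x + 4 * deriv_ratio 3 u x * deriv_ratio 4 u x - 3 * (deriv_ratio 3 u x) ^ 3"

definition J_decay_term :: "(real \<Rightarrow> real) \<Rightarrow> real \<Rightarrow> real \<Rightarrow> real" where
  "J_decay_term u a x = 2 * deriv_ratio 5 u x - 5 * deriv_ratio 3 u x * deriv_ratio 4 u x
     + 3 * (deriv_ratio 3 u x) ^ 3 + 6 * a * deriv_ratio 3 u x * (deriv ^^ 2) u x"

definition J_conditions :: "(real \<Rightarrow> real) \<Rightarrow> real \<Rightarrow> bool" where
  "J_conditions u a \<longleftrightarrow> (\<forall>x. J_term u a x \<ge> 0) \<and> (\<forall>x\<ge>0. J_slope_term u x \<ge> 0 \<and> J_decay_term u a x \<ge> 0)"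

lemma tame_second_deriv_pos: "tame u \<Longrightarrow> (deriv ^^ 2) u x > 0"
  unfolding tame_def by (simp add: numeral_2_eq_2) (meson exp_gt_zero less_le_trans mult_pos_pos)

lemma deriv_ratio_deriv:
  assumes "tame u"
  shows "(deriv_ratio k u has_real_derivative deriv_ratio (Suc k) u x - deriv_ratio k u x * deriv_ratio 3 u x) (at x)"
proof -
  have nz: "(deriv ^^ 2) u x \<noteq> 0" using tame_second_deriv_pos[OF assms, of x] by simp
  have d2: "((deriv ^^ 2) u has_real_derivative (deriv ^^ 3) u x) (at x)"
    using tame_higher_deriv[OF assms, of 2] by (simp only: eval_nat_numeral)
  have "((\<lambda>x. (deriv ^^ k) u x / (deriv ^^ 2) u x) has_real_derivative
    ((deriv ^^ Suc k) u x * (deriv ^^ 2) u x - (deriv ^^ k) u x * (deriv ^^ 3) u x)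
      / ((deriv ^^ 2) u x * (deriv ^^ 2) u x)) (at x)"
    by (rule DERIV_divide[OF tame_higher_deriv[OF assms] d2 nz])
  moreover have "((deriv ^^ Suc k) u x * (deriv ^^ 2) u x - (deriv ^^ k) u x * (deriv ^^ 3) u x)
      / ((deriv ^^ 2) u x * (deriv ^^ 2) u x) = deriv_ratio (Suc k) u x - deriv_ratio k u x * deriv_ratio 3 u x"
    unfolding deriv_ratio_def using nz by (simp add: diff_divide_distrib)
  ultimately show ?thesis unfolding deriv_ratio_def[abs_def] by (simp only:)
qed

text \<open>The derivative of \<open>u''' / u''\<close> is
  \<open>- J_term u a x - 2 * a * u''\<close>, hence nonpositive, and the ratio vanishes at 0
  because \<open>u'''\<close> is odd.\<close>

lemma deriv_ratio_3_nonpos: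
  assumes u: "tame u" and J: "\<And>x. J_term u a x \<ge> 0" and a: "a \<ge> 0" and x: "x \<ge> 0"
  shows "deriv_ratio 3 u x \<le> 0"
proof -
  have "deriv_ratio 3 u x \<le> deriv_ratio 3 u 0"
  proof (rule DERIV_nonpos_imp_nonincreasing[OF x])
    fix y
    have "(deriv_ratio 3 u has_real_derivative deriv_ratio 4 u y - deriv_ratio 3 u y * deriv_ratio 3 u y) (at y)"
      using deriv_ratio_deriv[OF u, of 3 y] by simp
    moreover have "0 \<le> a * (deriv ^^ 2) u y" using a tame_second_deriv_pos[OF u, of y] by simp
    then have "deriv_ratio 4 u y - deriv_ratio 3 u y * deriv_ratio 3 u y \<le> 0"
      using J[of y] by (simp add: J_term_def power2_eq_square)
    ultimately show "\<exists>D. (deriv_ratio 3 u has_real_derivative D) (at y) \<and> D \<le> 0" by blast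
  qed
  moreover have "deriv_ratio 3 u 0 = 0"
    using tame_higher_deriv_parity[OF u, of 3 0] by (simp add: deriv_ratio_def)
  ultimately show ?thesis by simp
qed

section \<open>Evolution of the derivative ratios and of the three curvature terms\<close>

context heat_flow
begin

definition r :: "nat \<Rightarrow> real \<Rightarrow> real \<Rightarrow> real" where "r k t x = V k t x / V 2 t x"
definition flow_J :: "real \<Rightarrow> real \<Rightarrow> real" where "flow_J t x = (r 3 t x)\<^sup>2 - r 4 t x - 2 * a * V 2 t x"
definition flow_J_slope :: "real \<Rightarrow> real \<Rightarrow> real" where "flow_J_slope t x = - r 5 t x + 4 * r 3 t x * r 4 t x - 3 * (r 3 t x) ^ 3"
definition flow_J_decay :: "real \<Rightarrow> real \<Rightarrow> real" where
  "flow_J_decay t x = 2 * r 5 t x - 5 * r 3 t x * r 4 t x + 3 * (r 3 t x) ^ 3 + 6 * a * r 3 t x * V 2 t x"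

text \<open>The locale does not tie \<open>V\<close> to \<open>T\<close>, so the bound can be applied with horizon \<open>t\<close>.\<close>

lemma V2_pos: "t \<ge> 0 \<Longrightarrow> V 2 t x > 0"
proof -
  assume t: "t \<ge> 0"
  interpret later: heat_flow u a t using tame a t by unfold_locales auto
  have "\<exists>m>0. \<forall>x. m * exp (- 2 * \<bar>x\<bar>) \<le> V 2 t x" using later.V2_ge t by auto
  then show ?thesis by (meson exp_gt_zero less_le_trans mult_pos_pos)
qed

lemma r_rational: "t \<ge> 0 \<Longrightarrow> V k t x = r k t x * V 2 t x"
  using V2_pos[of t x] by (simp add: r_def)

lemma V2_deriv: "t \<ge> 0 \<Longrightarrow> (V 2 t has_real_derivative V 2 t x * r 3 t x) (at x)"
  using V_deriv(2)[of t x] r_rational[of t 3 x] by (simp add: mult.commute)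

lemma r_deriv_aux:
  assumes "t \<ge> 0" "(V k t has_real_derivative V k' t x) (at x)"
  shows "(r k t has_real_derivative r k' t x - r k t x * r 3 t x) (at x)"
proof -
  have nz: "V 2 t x \<noteq> 0" using V2_pos[OF assms(1), of x] by simp
  have "((\<lambda>x. V k t x / V 2 t x) has_real_derivative
    (V k' t x * V 2 t x - V k t x * (V 2 t x * r 3 t x)) / (V 2 t x * V 2 t x)) (at x)"
    by (rule DERIV_divide[OF assms(2) V2_deriv[OF assms(1)] nz])
  moreover have "(V k' t x * V 2 t x - V k t x * (V 2 t x * r 3 t x)) / (V 2 t x * V 2 t x) = r k' t x - r k t x * r 3 t x"
    using nz by (simp add: r_def diff_divide_distrib)
  ultimately show ?thesis unfolding r_def[of k, abs_def] by (simp only:)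
qed

lemma r_deriv:
  assumes "t \<ge> 0"
  shows "(r 3 t has_real_derivative r 4 t x - r 3 t x * r 3 t x) (at x)"
    "(r 4 t has_real_derivative r 5 t x - r 4 t x * r 3 t x) (at x)"
    "(r 5 t has_real_derivative r 6 t x - r 5 t x * r 3 t x) (at x)"
    "(r 6 t has_real_derivative r 7 t x - r 6 t x * r 3 t x) (at x)"
  by (intro r_deriv_aux assms V_deriv)+

lemma V2_time_deriv:
  assumes t: "t > 0"
  shows "((\<lambda>s. V 2 s x) has_real_derivative V 2 t x * (r 4 t x / 2 + a * V 1 t x * r 3 t x + a * V 2 t x)) (at t)"
  by (rule DERIV_cong[OF V_time_deriv(2)[OF t]])
    (use t in \<open>simp add: r_rational[of t 3 x] r_rational[of t 4 x] power2_eq_square algebra_simps\<close>)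

text \<open>Quotient rule with \<open>V 2\<close> factored out of both time derivatives: the bracket
  multiplying \<open>r k t x\<close> is the logarithmic time derivative of
  \<open>V 2\<close>.\<close>

lemma r_time_deriv_aux:
  assumes t: "t > 0" and d: "((\<lambda>s. V k s x) has_real_derivative D) (at t)" and D: "D = E * V 2 t x"
  shows "((\<lambda>s. r k s x) has_real_derivative
    E - r k t x * (r 4 t x / 2 + a * V 1 t x * r 3 t x + a * V 2 t x)) (at t)"
proof -
  have nz: "V 2 t x \<noteq> 0" using V2_pos[of t x] t by simp
  let ?l = "r 4 t x / 2 + a * V 1 t x * r 3 t x + a * V 2 t x"
  have "((\<lambda>s. V k s x / V 2 s x) has_real_derivative
    (D * V 2 t x - V k t x * (V 2 t x * ?l)) / (V 2 t x * V 2 t x)) (at t)"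
    by (rule DERIV_divide[OF d V2_time_deriv[OF t] nz])
  moreover have "(D * V 2 t x - V k t x * (V 2 t x * ?l)) / (V 2 t x * V 2 t x) = E - r k t x * ?l"
    using nz by (simp only: r_def[of k] D) (simp add: diff_divide_distrib)
  ultimately show ?thesis unfolding r_def[of k] by (simp only:)
qed

lemma r_time_deriv:
  fixes x :: real
  assumes t: "t > 0"
  defines "l \<equiv> r 4 t x / 2 + a * V 1 t x * r 3 t x + a * V 2 t x"
  shows "((\<lambda>s. r 3 s x) has_real_derivative r 5 t x / 2 + a * V 1 t x * r 4 t x + a * V 2 t x * (3 * r 3 t x) - r 3 t x * l) (at t)"
    "((\<lambda>s. r 4 s x) has_real_derivative r 6 t x / 2 + a * V 1 t x * r 5 t x
        + a * V 2 t x * (4 * r 4 t x + 3 * (r 3 t x)\<^sup>2) - r 4 t x * l) (at t)"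
    "((\<lambda>s. r 5 s x) has_real_derivative r 7 t x / 2 + a * V 1 t x * r 6 t x
        + a * V 2 t x * (5 * r 5 t x + 10 * r 3 t x * r 4 t x) - r 5 t x * l) (at t)"
proof -
  have V: "V 3 t x = r 3 t x * V 2 t x" "V 4 t x = r 4 t x * V 2 t x" "V 5 t x = r 5 t x * V 2 t x"
    "V 6 t x = r 6 t x * V 2 t x" "V 7 t x = r 7 t x * V 2 t x" using t by (auto intro: r_rational)
  note eq = power2_eq_square algebra_simps
  show "((\<lambda>s. r 3 s x) has_real_derivative r 5 t x / 2 + a * V 1 t x * r 4 t x + a * V 2 t x * (3 * r 3 t x) - r 3 t x * l) (at t)"
    unfolding l_def by (rule r_time_deriv_aux[OF t V_time_deriv(3)[OF t]]) (simp only: V, simp add: eq)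
  show "((\<lambda>s. r 4 s x) has_real_derivative r 6 t x / 2 + a * V 1 t x * r 5 t x
        + a * V 2 t x * (4 * r 4 t x + 3 * (r 3 t x)\<^sup>2) - r 4 t x * l) (at t)"
    unfolding l_def by (rule r_time_deriv_aux[OF t V_time_deriv(4)[OF t]]) (simp only: V, simp add: eq)
  show "((\<lambda>s. r 5 s x) has_real_derivative r 7 t x / 2 + a * V 1 t x * r 6 t x
        + a * V 2 t x * (5 * r 5 t x + 10 * r 3 t x * r 4 t x) - r 5 t x * l) (at t)"
    unfolding l_def by (rule r_time_deriv_aux[OF t V_time_deriv(5)[OF t]]) (simp only: V, simp add: eq)
qed

text \<open>\<open>F1\<close> and \<open>F2\<close> are the \<open>x\<close>-derivatives expanded in
  \<open>a\<close>, \<open>V 2\<close> and the ratios; all three claims thereby become polynomial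
  identities in these and \<open>V 1\<close>. Since \<open>flow_J\<close> is \<open>2 * Y\<close>,
  the reaction coefficient \<open>- 2 * Y\<close> appears as \<open>- flow_J\<close>.\<close>

lemma flow_J_evolution:
  assumes t: "t > 0"
  defines "F \<equiv> \<lambda>t x. V 2 t x * flow_J t x"
    and "F1 \<equiv> \<lambda>t x. V 2 t x * (- 4 * a * V 2 t x * r 3 t x - (r 3 t x) ^ 3 + 2 * r 3 t x * r 4 t x - r 5 t x)"
    and "F2 \<equiv> \<lambda>t x. V 2 t x * (- 4 * a * V 2 t x * (r 3 t x) ^ 2 - 4 * a * V 2 t x * r 4 t x + 2 * (r 3 t x) ^ 4 - 5 * (r 3 t x) ^ 2 * r 4 t x + 2 * r 3 t x * r 5 t x + 2 * (r 4 t x) ^ 2 - r 6 t x)"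
  shows "(F t has_real_derivative F1 t x) (at x)" "(F1 t has_real_derivative F2 t x) (at x)"
    and "((\<lambda>s. F s x) has_real_derivative
      F2 t x / 2 + a * V 1 t x * F1 t x + (- flow_J t x) * F t x) (at t)"
proof -
  note d = V2_deriv r_deriv
  note dt = V2_time_deriv[OF t] r_time_deriv[OF t]
  have t0: "t \<ge> 0" using t by simp
  show "(F t has_real_derivative F1 t x) (at x)"
    unfolding F_def F1_def flow_J_def
    by (rule DERIV_cong, (rule derivative_intros d t0)+, simp, algebra)
  show "(F1 t has_real_derivative F2 t x) (at x)"
    unfolding F1_def F2_def
    by (rule DERIV_cong, (rule derivative_intros d t0)+, simp, algebra)
  show "((\<lambda>s. F s x) has_real_derivative
      F2 t x / 2 + a * V 1 t x * F1 t x + (- flow_J t x) * F t x) (at t)"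
    unfolding F_def F1_def F2_def flow_J_def 
    by (rule DERIV_cong, (rule derivative_intros dt)+, simp add: field_simps, algebra)
qed

text \<open>\<open>flow_J_slope\<close> is \<open>2 * R\<close> and \<open>r 3\<close> is
  \<open>- 2 * z\<close>, so the last term is twice the source
  \<open>12 z C Y (a C + Y)\<close>.\<close>

lemma flow_J_slope_evolution:
  assumes t: "t > 0"
  defines "F \<equiv> \<lambda>t x. V 2 t x * flow_J_slope t x"
    and "F1 \<equiv> \<lambda>t x. V 2 t x * (6 * (r 3 t x) ^ 4 - 13 * (r 3 t x) ^ 2 * r 4 t x + 4 * r 3 t x * r 5 t x + 4 * (r 4 t x) ^ 2 - r 6 t x)"
    and "F2 \<equiv> \<lambda>t x. V 2 t x * (- 18 * (r 3 t x) ^ 5 + 50 * (r 3 t x) ^ 3 * r 4 t x - 17 * (r 3 t x) ^ 2 * r 5 t x - 30 * r 3 t x * (r 4 t x) ^ 2 + 4 * r 3 t x * r 6 t x + 12 * r 4 t x * r 5 t x - r 7 t x)"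
  shows "(F t has_real_derivative F1 t x) (at x)" "(F1 t has_real_derivative F2 t x) (at x)"
    and "((\<lambda>s. F s x) has_real_derivative
      F2 t x / 2 + a * V 1 t x * F1 t x + ((- 3 * a * V 2 t x - 4 * flow_J t x) * F t x
        - 3 * r 3 t x * V 2 t x * flow_J t x * (2 * a * V 2 t x + flow_J t x))) (at t)"
proof -
  note d = V2_deriv r_deriv
  note dt = V2_time_deriv[OF t] r_time_deriv[OF t]
  have t0: "t \<ge> 0" using t by simp
  show "(F t has_real_derivative F1 t x) (at x)"
    unfolding F_def F1_def flow_J_slope_def
    by (rule DERIV_cong, (rule derivative_intros d t0)+, simp, algebra)
  show "(F1 t has_real_derivative F2 t x) (at x)"
    unfolding F1_def F2_def
    by (rule DERIV_cong, (rule derivative_intros d t0)+, simp, algebra)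
  show "((\<lambda>s. F s x) has_real_derivative
      F2 t x / 2 + a * V 1 t x * F1 t x + ((- 3 * a * V 2 t x - 4 * flow_J t x) * F t x
        - 3 * r 3 t x * V 2 t x * flow_J t x * (2 * a * V 2 t x + flow_J t x))) (at t)"
    unfolding F_def F1_def F2_def flow_J_slope_def flow_J_def
    by (rule DERIV_cong, (rule derivative_intros dt)+, simp add: field_simps, algebra)
qed

text \<open>\<open>flow_J_decay\<close> is \<open>4 * Q\<close>, and the last term is four times the
  source \<open>3 z C Y^2\<close>. No \<open>R\<close> occurs on the right: once the signs of
  \<open>Y\<close> and \<open>z\<close> are known, \<open>Q\<close> is treated independently of
  \<open>R\<close>.\<close>

lemma flow_J_decay_evolution:
  assumes t: "t > 0"
  defines "F \<equiv> \<lambda>t x. V 2 t x * flow_J_decay t x"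
    and "F1 \<equiv> \<lambda>t x. V 2 t x * (6 * a * V 2 t x * (r 3 t x) ^ 2 + 6 * a * V 2 t x * r 4 t x - 6 * (r 3 t x) ^ 4 + 14 * (r 3 t x) ^ 2 * r 4 t x - 5 * r 3 t x * r 5 t x - 5 * (r 4 t x) ^ 2 + 2 * r 6 t x)"
    and "F2 \<equiv> \<lambda>t x. V 2 t x * (18 * a * V 2 t x * r 3 t x * r 4 t x + 6 * a * V 2 t x * r 5 t x + 18 * (r 3 t x) ^ 5 - 52 * (r 3 t x) ^ 3 * r 4 t x + 19 * (r 3 t x) ^ 2 * r 5 t x + 33 * r 3 t x * (r 4 t x) ^ 2 - 5 * r 3 t x * r 6 t x - 15 * r 4 t x * r 5 t x + 2 * r 7 t x)"
  shows "(F t has_real_derivative F1 t x) (at x)" "(F1 t has_real_derivative F2 t x) (at x)"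
    and "((\<lambda>s. F s x) has_real_derivative
      F2 t x / 2 + a * V 1 t x * F1 t x + ((- 5 / 2 * flow_J t x) * F t x - 3 / 2 * r 3 t x * V 2 t x * (flow_J t x)\<^sup>2)) (at t)"
proof -
  note d = V2_deriv r_deriv
  note dt = V2_time_deriv[OF t] r_time_deriv[OF t]
  have t0: "t \<ge> 0" using t by simp
  show "(F t has_real_derivative F1 t x) (at x)"
    unfolding F_def F1_def flow_J_decay_def
    by (rule DERIV_cong, (rule derivative_intros d t0)+, simp, algebra)
  show "(F1 t has_real_derivative F2 t x) (at x)"
    unfolding F1_def F2_def
    by (rule DERIV_cong, (rule derivative_intros d t0)+, simp, algebra)
  show "((\<lambda>s. F s x) has_real_derivative
      F2 t x / 2 + a * V 1 t x * F1 t x + ((- 5 / 2 * flow_J t x) * F t x - 3 / 2 * r 3 t x * V 2 t x * (flow_J t x)\<^sup>2)) (at t)"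
    unfolding F_def F1_def F2_def flow_J_decay_def flow_J_def
    by (rule DERIV_cong, (rule derivative_intros dt)+, simp add: field_simps, algebra)
qed

section \<open>Uniform bounds, decay and the maximum principle for the three terms\<close>

definition bnd :: "(real \<Rightarrow> real \<Rightarrow> real) \<Rightarrow> bool" where
  "bnd f \<longleftrightarrow> (\<exists>M. \<forall>t\<in>{0..T}. \<forall>x. \<bar>f t x\<bar> \<le> M)"

lemma bnd_const: "bnd (\<lambda>_ _. c)"
  unfolding bnd_def by auto

lemma bnd_add: "bnd f \<Longrightarrow> bnd g \<Longrightarrow> bnd (\<lambda>t x. f t x + g t x)"
  unfolding bnd_def by (meson abs_triangle_ineq add_mono order_trans)

lemma bnd_mult: "bnd f \<Longrightarrow> bnd g \<Longrightarrow> bnd (\<lambda>t x. f t x * g t x)"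
proof -
  assume "bnd f" "bnd g"
  then obtain M N where M: "\<forall>t\<in>{0..T}. \<forall>x. \<bar>f t x\<bar> \<le> M" and N: "\<forall>t\<in>{0..T}. \<forall>x. \<bar>g t x\<bar> \<le> N"
    by (auto simp: bnd_def)
  have "\<bar>f t x * g t x\<bar> \<le> M * N" if t: "t \<in> {0..T}" for t x
  proof -
    have "\<bar>f t x\<bar> \<le> M" "\<bar>g t x\<bar> \<le> N" using M N t by auto
    then show ?thesis unfolding abs_mult by (intro mult_mono) linarith+
  qed
  then show ?thesis unfolding bnd_def by blast
qed

lemma bnd_minus: "bnd f \<Longrightarrow> bnd (\<lambda>t x. - f t x)"
  unfolding bnd_def by simp

lemma bnd_diff: "bnd f \<Longrightarrow> bnd g \<Longrightarrow> bnd (\<lambda>t x. f t x - g t x)"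
  using bnd_add[of f "\<lambda>t x. - g t x"] bnd_minus[of g] by simp

lemma bnd_power: "bnd f \<Longrightarrow> bnd (\<lambda>t x. f t x ^ n)"
  by (induction n) (auto intro: bnd_const bnd_mult)

lemma bnd_V2: "bnd (V 2)"
proof -
  obtain M where M: "M \<ge> 0" "\<forall>t\<in>{0..T}. \<forall>x. \<bar>V 2 t x\<bar> \<le> M * exp (- 2 * \<bar>x\<bar>)" using V_bound[of 2] by auto
  have "M * exp (- 2 * \<bar>x\<bar>) \<le> M" for x using M(1) by (simp add: mult_left_le)
  then show ?thesis using M(2) unfolding bnd_def by (meson order_trans)
qed

text \<open>The upper bound on \<open>V k\<close> and the lower bound on \<open>V 2\<close> have the
  same exponential rate, which cancels in the quotient.\<close>

lemma bnd_r: "k \<in> {3..5} \<Longrightarrow> bnd (r k)"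
proof -
  assume k: "k \<in> {3..5}"
  obtain M where M: "M \<ge> 0" "\<And>t x. t \<in> {0..T} \<Longrightarrow> \<bar>V k t x\<bar> \<le> M * exp (- 2 * \<bar>x\<bar>)" using V_bound[of k] k by auto
  obtain m where m: "m > 0" "\<And>t x. t \<in> {0..T} \<Longrightarrow> m * exp (- 2 * \<bar>x\<bar>) \<le> V 2 t x" using V2_ge by blast
  have "\<bar>r k t x\<bar> \<le> M / m" if t: "t \<in> {0..T}" for t x
  proof -
    have "\<bar>r k t x\<bar> = \<bar>V k t x\<bar> / V 2 t x" using V2_pos[of t x] t by (simp add: r_def)
    also have "\<dots> \<le> (M * exp (- 2 * \<bar>x\<bar>)) / (m * exp (- 2 * \<bar>x\<bar>))"
      using M(1) by (intro frac_le M(2) m(2) t) (use m(1) in auto)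
    also have "\<dots> = M / m" by simp
    finally show ?thesis .
  qed
  then show ?thesis unfolding bnd_def by blast
qed

lemma bnd_terms: "bnd flow_J" "bnd flow_J_slope" "bnd flow_J_decay"
  unfolding flow_J_def[abs_def] flow_J_slope_def[abs_def] flow_J_decay_def[abs_def]
  by (intro bnd_add bnd_diff bnd_minus bnd_mult bnd_power bnd_const bnd_r bnd_V2; simp)+

lemma r_cont: "continuous_on ({0..T} \<times> UNIV) (\<lambda>p. r k (fst p) (snd p))"
  unfolding r_def
proof (intro continuous_on_divide V_cont ballI)
  fix p assume "p \<in> {0..T} \<times> (UNIV :: real set)"
  then show "V 2 (fst p) (snd p) \<noteq> 0" using V2_pos[of "fst p" "snd p"] by auto
qed

lemma terms_cont:
  "continuous_on ({0..T} \<times> UNIV) (\<lambda>p. V 2 (fst p) (snd p) * flow_J (fst p) (snd p))"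
  "continuous_on ({0..T} \<times> UNIV) (\<lambda>p. V 2 (fst p) (snd p) * flow_J_slope (fst p) (snd p))"
  "continuous_on ({0..T} \<times> UNIV) (\<lambda>p. V 2 (fst p) (snd p) * flow_J_decay (fst p) (snd p))"
  unfolding flow_J_def flow_J_slope_def flow_J_decay_def
  by (intro continuous_intros V_cont r_cont)+

lemma decay_ge:
  assumes "bnd f"
  shows "\<exists>M. \<forall>t\<in>{0..T}. \<forall>x. - M * exp (- 2 * \<bar>x\<bar>) \<le> V 2 t x * f t x"
proof -
  obtain M where M: "M \<ge> 0" "\<And>t x. t \<in> {0..T} \<Longrightarrow> \<bar>V 2 t x\<bar> \<le> M * exp (- 2 * \<bar>x\<bar>)" using V_bound[of 2] by auto
  obtain N where N: "\<And>t x. t \<in> {0..T} \<Longrightarrow> \<bar>f t x\<bar> \<le> N" using assms unfolding bnd_def by blast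
  have "- (M * N) * exp (- 2 * \<bar>x\<bar>) \<le> V 2 t x * f t x" if t: "t \<in> {0..T}" for t x
  proof -
    have "\<bar>V 2 t x * f t x\<bar> \<le> (M * exp (- 2 * \<bar>x\<bar>)) * N"
      unfolding abs_mult using M(1) by (intro mult_mono M(2) N t) auto
    then show ?thesis by (simp add: abs_le_iff mult_ac)
  qed
  then show ?thesis by blast
qed

text \<open>At a spatial minimum the diffusion part is nonnegative and the transport part vanishes,
  so only the reaction \<open>g\<close> has to be compared with \<open>L\<close> times the function.
  As \<open>V 2 > 0\<close>, the signs of \<open>f\<close> and \<open>V 2 * f\<close> agree.\<close>

lemma weighted_max_principle:
  assumes S: "closed S" and b: "bnd f"
    and cont: "continuous_on ({0..T} \<times> UNIV) (\<lambda>p. V 2 (fst p) (snd p) * f (fst p) (snd p))"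
    and init: "\<And>x. x \<in> S \<Longrightarrow> f 0 x \<ge> 0"
    and F1: "\<And>t x. t > 0 \<Longrightarrow> ((\<lambda>x. V 2 t x * f t x) has_real_derivative F1 t x) (at x)"
    and F2: "\<And>t x. t > 0 \<Longrightarrow> (F1 t has_real_derivative F2 t x) (at x)"
    and Ft: "\<And>t x. t > 0 \<Longrightarrow> ((\<lambda>s. V 2 s x * f s x) has_real_derivative
      F2 t x / 2 + a * V 1 t x * F1 t x + g t x) (at t)"
    and t: "t \<in> {0..T}"
    and neg: "\<And>t x. t \<in> {0<..T} \<Longrightarrow> x \<in> S \<Longrightarrow> f t x < 0 \<Longrightarrow>
      x \<in> interior S \<and> L * (V 2 t x * f t x) \<le> g t x"
    and x: "x \<in> S"
  shows "f t x \<ge> 0"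
proof -
  obtain M where M: "\<And>t x. t \<in> {0..T} \<Longrightarrow> - M * exp (- 2 * \<bar>x\<bar>) \<le> V 2 t x * f t x"
    using decay_ge[OF b] by blast
  have sgn: "V 2 t x * f t x < 0 \<Longrightarrow> f t x < 0" "f t x \<ge> 0 \<longleftrightarrow> V 2 t x * f t x \<ge> 0" if "t \<ge> 0" for t x
    using V2_pos[OF that, of x] by (simp_all add: zero_le_mult_iff mult_less_0_iff)
  have "V 2 t x * f t x \<ge> 0"
  proof (rule parabolic_nonneg[where S = S and F = "\<lambda>t x. V 2 t x * f t x" and M = M and L = L, OF S _ M])
    show "continuous_on ({0..T} \<times> S) (\<lambda>p. V 2 (fst p) (snd p) * f (fst p) (snd p))"
      by (rule continuous_on_subset[OF cont]) auto
    show "0 \<le> V 2 0 x * f 0 x" if "x \<in> S" for x using init[OF that] sgn[of 0 x] by simp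
    fix t x assume t: "t \<in> {0<..T}"
    then show "((\<lambda>x. V 2 t x * f t x) has_real_derivative F1 t x) (at x)"
      "(F1 t has_real_derivative F2 t x) (at x)"
      "((\<lambda>s. V 2 s x * f s x) has_real_derivative F2 t x / 2 + a * V 1 t x * F1 t x + g t x) (at t)"
      using F1 F2 Ft by auto
    assume x: "x \<in> S" and "V 2 t x * f t x < 0"
    then have n: "x \<in> interior S \<and> L * (V 2 t x * f t x) \<le> g t x"
      using neg[OF t x] sgn[of t x] t by simp
    then show "x \<in> interior S" by simp
    assume "F1 t x = 0" "F2 t x \<ge> 0"
    then show "L * (V 2 t x * f t x) \<le> F2 t x / 2 + a * V 1 t x * F1 t x + g t x"
      using n by simp
  qed (use t x in auto)
  then show ?thesis using sgn t by simp
qed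

lemma v_0: "v 0 = u"
  using a by (auto simp: v_def log_transform_def gauss_avg_0)

lemma r_eq: "t \<ge> 0 \<Longrightarrow> k \<in> {1..7} \<Longrightarrow> deriv_ratio k (v t) x = r k t x"
  by (simp add: deriv_ratio_def r_def higher_deriv_v)

lemma J_terms_eq:
  assumes "t \<ge> 0"
  shows "J_term (v t) a x = flow_J t x" "J_slope_term (v t) x = flow_J_slope t x" "J_decay_term (v t) a x = flow_J_decay t x"
  using assms by (simp_all add: J_term_def J_slope_term_def J_decay_term_def r_eq higher_deriv_v flow_J_def flow_J_slope_def flow_J_decay_def)

lemma odd_terms_0: "t \<in> {0..T} \<Longrightarrow> flow_J_slope t 0 = 0" "t \<in> {0..T} \<Longrightarrow> flow_J_decay t 0 = 0"
  using V_parity[of t 3 0] V_parity[of t 5 0] by (simp_all add: flow_J_slope_def flow_J_decay_def r_def)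

lemma J_conditions_preserved:
  assumes init: "J_conditions u a"
  shows "t \<in> {0..T} \<Longrightarrow> J_conditions (v t) a"
proof -
  have init': "\<And>x. flow_J 0 x \<ge> 0" "\<And>x. x \<ge> 0 \<Longrightarrow> flow_J_slope 0 x \<ge> 0" "\<And>x. x \<ge> 0 \<Longrightarrow> flow_J_decay 0 x \<ge> 0"
    using init J_terms_eq[of 0] by (auto simp: J_conditions_def v_0)
  obtain L where L: "\<And>t x. t \<in> {0..T} \<Longrightarrow> \<bar>flow_J t x\<bar> \<le> L" using bnd_terms(1) unfolding bnd_def by blast
  have Y: "flow_J t x \<ge> 0" if t: "t \<in> {0..T}" for t x
  proof (rule weighted_max_principle[OF _ bnd_terms(1) terms_cont(1) _ flow_J_evolution t])
    fix t x assume t: "t \<in> {0<..T}" and x: "x \<in> UNIV" and neg: "flow_J t x < 0"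

    \<comment> \<open>The reaction is quadratic: its coefficient \<open>- flow_J\<close> is positive
      where \<open>flow_J\<close> is negative, but it is at most the uniform bound \<open>L\<close>,
      which gives a linear comparison.\<close>
    have "V 2 t x * flow_J t x \<le> 0" using neg V2_pos[of t x] t by (simp add: mult_le_0_iff)
    moreover have "- flow_J t x \<le> L" using L[of t x] t by auto
    ultimately show "x \<in> interior UNIV \<and> L * (V 2 t x * flow_J t x) \<le> (- flow_J t x) * (V 2 t x * flow_J t x)"
      by (simp only: interior_UNIV UNIV_I mult_right_mono_neg simp_thms)
  qed (use init' in auto)
  have r3: "r 3 t x \<le> 0" if "t \<in> {0..T}" "x \<ge> 0" for t x
    using deriv_ratio_3_nonpos[OF tame_v[OF that(1)], of a x] a J_terms_eq[of t] Y[OF that(1)] r_eq[of t 3 x] that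
    by simp
  have R: "flow_J_slope t x \<ge> 0" if t: "t \<in> {0..T}" and x: "x \<ge> 0" for t x
  proof (rule weighted_max_principle[OF _ bnd_terms(2) terms_cont(2) _ flow_J_slope_evolution t])
    fix t x assume t: "t \<in> {0<..T}" and x: "x \<in> {0..}" and neg: "flow_J_slope t x < 0"
    have t': "t \<in> {0..T}" using t by auto
    \<comment> \<open>The term is odd in \<open>x\<close> and vanishes at 0, so a negative value
      lies in the interior of the half-line.\<close>
    have "x \<noteq> 0" using odd_terms_0[OF t'] neg by auto
    then have "x \<in> interior {0..}" using x by simp
    have pos: "V 2 t x > 0" "flow_J t x \<ge> 0" "r 3 t x \<le> 0" using V2_pos[of t x] Y[OF t'] r3[OF t'] t x by auto
    have neg': "V 2 t x * flow_J_slope t x \<le> 0" using neg pos by (simp add: mult_le_0_iff)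
    \<comment> \<open>A nonpositive coefficient times a negative quantity, together with a source of
      the right sign: the rate 0 suffices.\<close>
    have A: "(- 3 * a * V 2 t x - 4 * flow_J t x) * (V 2 t x * flow_J_slope t x) \<ge> 0"
    proof (intro mult_nonpos_nonpos neg')
      have "0 \<le> 3 * a * V 2 t x" using pos a by simp
      then show "- 3 * a * V 2 t x - 4 * flow_J t x \<le> 0" using pos(2) by simp
    qed
    have "r 3 t x * (V 2 t x * flow_J t x * (2 * a * V 2 t x + flow_J t x)) \<le> 0"
      using pos a by (intro mult_nonpos_nonneg mult_nonneg_nonneg add_nonneg_nonneg) auto
    then have B: "3 * r 3 t x * V 2 t x * flow_J t x * (2 * a * V 2 t x + flow_J t x) \<le> 0"
      by (simp add: mult_ac)
    from order_trans[OF B A] show "x \<in> interior {0..} \<and> 0 * (V 2 t x * flow_J_slope t x) \<le> (- 3 * a * V 2 t x - 4 * flow_J t x) * (V 2 t x * flow_J_slope t x)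
        - 3 * r 3 t x * V 2 t x * flow_J t x * (2 * a * V 2 t x + flow_J t x)"
      using \<open>x \<in> interior {0..}\<close> by (simp only: mult_zero_left diff_ge_0_iff_ge simp_thms)
  qed (use init' x in auto)
  have Q: "flow_J_decay t x \<ge> 0" if t: "t \<in> {0..T}" and x: "x \<ge> 0" for t x
  proof (rule weighted_max_principle[OF _ bnd_terms(3) terms_cont(3) _ flow_J_decay_evolution t])
    fix t x assume t: "t \<in> {0<..T}" and x: "x \<in> {0..}" and neg: "flow_J_decay t x < 0"
    have t': "t \<in> {0..T}" using t by auto
    have "x \<noteq> 0" using odd_terms_0[OF t'] neg by auto
    then have "x \<in> interior {0..}" using x by simp
    have pos: "V 2 t x > 0" "flow_J t x \<ge> 0" "r 3 t x \<le> 0" using V2_pos[of t x] Y[OF t'] r3[OF t'] t x by auto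
    have neg': "V 2 t x * flow_J_decay t x \<le> 0" using neg pos by (simp add: mult_le_0_iff)
    have A: "(- 5 / 2 * flow_J t x) * (V 2 t x * flow_J_decay t x) \<ge> 0"
      using pos by (intro mult_nonpos_nonpos neg') auto
    have "r 3 t x * (V 2 t x * (flow_J t x)\<^sup>2) \<le> 0"
      using pos by (intro mult_nonpos_nonneg mult_nonneg_nonneg) auto
    then have B: "3 / 2 * r 3 t x * V 2 t x * (flow_J t x)\<^sup>2 \<le> 0"
      by (simp add: mult_ac)
    from order_trans[OF B A] show "x \<in> interior {0..} \<and> 0 * (V 2 t x * flow_J_decay t x) \<le> (- 5 / 2 * flow_J t x) * (V 2 t x * flow_J_decay t x)
        - 3 / 2 * r 3 t x * V 2 t x * (flow_J t x)\<^sup>2"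
      using \<open>x \<in> interior {0..}\<close> by (simp only: mult_zero_left diff_ge_0_iff_ge simp_thms)
  qed (use init' x in auto)
  show "t \<in> {0..T} \<Longrightarrow> J_conditions (v t) a"
    using Y R Q J_terms_eq[of t] by (auto simp: J_conditions_def)
qed

end

section \<open>The initial function and the induction\<close>

text \<open>\<open>1 - tanh x = 2 / (exp (2 * x) + 1)\<close>, which is at most 2 and at most
  \<open>2 * exp (- 2 * x)\<close>.\<close>

lemma tanh_minus_1_bound: "\<bar>tanh x - 1\<bar> \<le> 2 * tail_weight x" for x :: real
proof -
  have e: "exp (2 * x) > 0" by simp
  have eq: "1 - tanh x = 2 / (exp (2 * x) + 1)"
  proof -
    have "tanh x = (1 - exp (- (2 * x))) / (1 + exp (- (2 * x)))" by (simp add: tanh_real_altdef)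
    also have "\<dots> = (exp (2 * x) - 1) / (exp (2 * x) + 1)"
      using e by (simp add: exp_minus divide_simps)
    finally have "tanh x = (exp (2 * x) - 1) / (exp (2 * x) + 1)" .
    moreover have "1 - (y - 1) / (y + 1) = 2 / (y + 1)" if "y > 0" for y :: real
      using that by (simp add: field_simps)
    ultimately show ?thesis using e by simp
  qed
  have "2 / (exp (2 * x) + 1) \<le> 2 / 1" "2 / (exp (2 * x) + 1) \<le> 2 / exp (2 * x)"
    using e by (intro divide_left_mono; simp add: add_pos_pos)+
  then have le: "2 / (exp (2 * x) + 1) \<le> 2 * 1" "2 / (exp (2 * x) + 1) \<le> 2 * exp (- 2 * x)"
    by (simp_all add: exp_minus divide_inverse)
  have "2 / (exp (2 * x) + 1) \<ge> 0" using e by simp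
  then have "\<bar>tanh x - 1\<bar> = 2 / (exp (2 * x) + 1)" using eq by linarith
  then show ?thesis using le by (simp only: tail_weight_def min_def split: if_split) simp
qed

text \<open>With \<open>y = tanh x - 1\<close> one has \<open>y' = - y * (y + 2)\<close>: one factor
  carries the weight and the other is bounded, so the induction closes.\<close>

lemma tanh_minus_1_deriv_bounded: "deriv_bounded P n tail_weight (\<lambda>_ x. tanh x - 1)"
proof (rule deriv_boundedI[where F = "\<lambda>_ _ x. tanh x - 1" and F' = "\<lambda>_ _ x. (- 1) * ((tanh x - 1) * ((tanh x - 1) + 2))" for k])
  fix n :: nat
  assume "\<And>k. deriv_bounded P n tail_weight (\<lambda>_ x. tanh x - 1)"
  then have h: "deriv_bounded P n tail_weight (\<lambda>_ x. tanh x - 1)" .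
  have "deriv_bounded P n (\<lambda>_. 1) (\<lambda>_ x. (tanh x - 1) + 2)"
    by (intro deriv_bounded_add deriv_bounded_const deriv_bounded_weight[OF h, of 1]) (auto simp: tail_weight_bounds)
  from deriv_bounded_mult[OF h this] show "deriv_bounded P n tail_weight (\<lambda>_ x. (- 1) * ((tanh x - 1) * ((tanh x - 1) + 2)))"
    by (intro deriv_bounded_cmult) (auto simp: tail_weight_bounds)
next
  show "\<exists>M. \<forall>p\<in>P. \<forall>x. \<bar>tanh x - 1\<bar> \<le> M * tail_weight x" using tanh_minus_1_bound by blast
  show "((\<lambda>x. tanh x - 1) has_real_derivative (- 1) * ((tanh x - 1) * ((tanh x - 1) + 2))) (at x)" for x :: real
    by (auto intro!: derivative_eq_intros simp: power2_eq_square algebra_simps)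
qed

lemma log_cosh_deriv: "((\<lambda>x. ln (cosh x)) has_real_derivative tanh x) (at x)" for x :: real
  by (auto intro!: derivative_eq_intros simp: tanh_def cosh_real_pos)

lemma log_cosh_higher_deriv:
  defines "u \<equiv> \<lambda>x :: real. ln (cosh x)"
  shows "deriv u = tanh" "deriv tanh = (\<lambda>x :: real. 1 - tanh x ^ 2)"
    "(deriv ^^ 2) u = (\<lambda>x. 1 - tanh x ^ 2)"
    "(deriv ^^ 3) u = (\<lambda>x. (1 - tanh x ^ 2) * (- 2 * tanh x))"
    "(deriv ^^ 4) u = (\<lambda>x. (1 - tanh x ^ 2) * (6 * tanh x ^ 2 - 2))"
    "(deriv ^^ 5) u = (\<lambda>x. (1 - tanh x ^ 2) * (16 * tanh x - 24 * tanh x ^ 3))"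
proof -
  have t: "(tanh has_real_derivative 1 - tanh x ^ 2) (at x)" for x :: real
    by (auto intro!: derivative_eq_intros)
  show d1: "deriv u = tanh"
    using DERIV_imp_deriv[OF log_cosh_deriv] unfolding u_def by blast
  show d2': "deriv tanh = (\<lambda>x :: real. 1 - tanh x ^ 2)" using DERIV_imp_deriv[OF t] by blast
  then show d2: "(deriv ^^ 2) u = (\<lambda>x. 1 - tanh x ^ 2)" using d1 by (simp add: numeral_2_eq_2)
  have Suc: "(deriv ^^ Suc k) u = h" if "(deriv ^^ k) u = g" "\<And>x. (g has_real_derivative h x) (at x)" for k g h
    using DERIV_imp_deriv[OF that(2)] that(1) by auto
  have s: "Suc 2 = 3" "Suc 3 = 4" "Suc 4 = 5" by simp_all
  have "(deriv ^^ Suc 2) u = (\<lambda>x. (1 - tanh x ^ 2) * (- 2 * tanh x))"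
    by (rule Suc[OF d2]) (rule DERIV_cong, (rule derivative_intros t)+, simp)
  then show d3: "(deriv ^^ 3) u = (\<lambda>x. (1 - tanh x ^ 2) * (- 2 * tanh x))" by (simp only: s)
  have "(deriv ^^ Suc 3) u = (\<lambda>x. (1 - tanh x ^ 2) * (6 * tanh x ^ 2 - 2))"
    by (rule Suc[OF d3]) (rule DERIV_cong, (rule derivative_intros t)+, simp, algebra)
  then show d4: "(deriv ^^ 4) u = (\<lambda>x. (1 - tanh x ^ 2) * (6 * tanh x ^ 2 - 2))" by (simp only: s)
  have "(deriv ^^ Suc 4) u = (\<lambda>x. (1 - tanh x ^ 2) * (16 * tanh x - 24 * tanh x ^ 3))"
    by (rule Suc[OF d4]) (rule DERIV_cong, (rule derivative_intros t)+, simp, algebra)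
  then show "(deriv ^^ 5) u = (\<lambda>x. (1 - tanh x ^ 2) * (16 * tanh x - 24 * tanh x ^ 3))" by (simp only: s)
qed

lemma cosh_bounds: "exp \<bar>x\<bar> / 2 \<le> cosh x" "cosh x \<le> exp \<bar>x\<bar>" for x :: real
proof -
  have "exp x \<le> exp \<bar>x\<bar>" "exp (- x) \<le> exp \<bar>x\<bar>" by auto
  then show "cosh x \<le> exp \<bar>x\<bar>" by (simp add: cosh_def del: exp_le_cancel_iff)
  have "exp x > 0" "exp (- x) > 0" by auto
  then show "exp \<bar>x\<bar> / 2 \<le> cosh x"
    by (cases "x \<ge> 0") (simp_all add: cosh_def less_imp_le)
qed

lemma tame_log_cosh: "tame (\<lambda>x. ln (cosh x))"
  unfolding tame_def
proof (intro conjI allI)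
  have "\<bar>ln (cosh x) - \<bar>x\<bar>\<bar> \<le> ln 2" for x :: real
  proof -
    have "ln (exp \<bar>x\<bar> / 2) \<le> ln (cosh x)" "ln (cosh x) \<le> ln (exp \<bar>x\<bar>)"
      using cosh_bounds[of x] by (intro ln_mono; simp add: cosh_real_pos)+
    then show ?thesis by (simp add: ln_div abs_le_iff)
  qed
  then show "\<exists>c. \<forall>x :: real. \<bar>ln (cosh x) - \<bar>x\<bar>\<bar> \<le> c" by blast
  show "deriv_bounded UNIV n tail_weight (\<lambda>_ x. deriv (\<lambda>x. ln (cosh x)) x - 1)" for n
    unfolding log_cosh_higher_deriv(1) by (rule tanh_minus_1_deriv_bounded)
  \<comment> \<open>The second derivative is \<open>1 / cosh x ^ 2\<close>, and
    \<open>cosh x \<le> exp \<bar>x\<bar>\<close>.\<close>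
  have "exp (- 2 * \<bar>x\<bar>) \<le> 1 - tanh x ^ 2" for x :: real
  proof -
    have "1 - tanh x ^ 2 = 1 / cosh x ^ 2"
    proof -
      have "1 - tanh x ^ 2 = (cosh x ^ 2 - sinh x ^ 2) / cosh x ^ 2"
        by (simp add: tanh_def power_divide diff_divide_distrib)
      then show ?thesis by (simp add: cosh_square_eq)
    qed
    moreover have "cosh x ^ 2 \<le> exp \<bar>x\<bar> ^ 2" using cosh_bounds[of x] by (intro power_mono) (auto simp: less_imp_le cosh_real_pos)
    then have "1 / exp \<bar>x\<bar> ^ 2 \<le> 1 / cosh x ^ 2" by (intro divide_left_mono) (auto simp: cosh_real_pos)
    moreover have "1 / exp \<bar>x\<bar> ^ 2 = exp (- 2 * \<bar>x\<bar>)" by (simp add: exp_minus divide_inverse exp_double)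
    ultimately show ?thesis by simp
  qed
  then show "\<exists>m>0. \<forall>x :: real. m * exp (- 2 * \<bar>x\<bar>) \<le> deriv (deriv (\<lambda>x. ln (cosh x))) x"
    unfolding log_cosh_higher_deriv(1,2) by (intro exI[of _ 1]) simp
  show "((\<lambda>x. ln (cosh x)) has_real_derivative deriv (\<lambda>x. ln (cosh x)) x) (at x)" for x :: real
    unfolding log_cosh_higher_deriv(1) by (rule log_cosh_deriv)
qed simp

text \<open>In the slope variable the curvature is \<open>1 - B^2\<close>, with second derivative
  -2, so \<open>J\<close> is identically 0 for \<open>a = 1\<close>.\<close>

lemma J_conditions_log_cosh: "J_conditions (\<lambda>x. ln (cosh x)) 1"
proof -
  let ?u = "\<lambda>x :: real. ln (cosh x)"
  have nz: "1 - tanh x ^ 2 \<noteq> 0" for x :: real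
    using tame_second_deriv_pos[OF tame_log_cosh, of x] unfolding log_cosh_higher_deriv by simp
  have r: "deriv_ratio 3 ?u x = - 2 * tanh x" "deriv_ratio 4 ?u x = 6 * tanh x ^ 2 - 2"
      "deriv_ratio 5 ?u x = 16 * tanh x - 24 * tanh x ^ 3" for x
    unfolding deriv_ratio_def log_cosh_higher_deriv using nz[of x] by simp_all
  have "J_term ?u 1 x = 0" "J_slope_term ?u x = 0" "J_decay_term ?u 1 x = 0" for x
    unfolding J_term_def J_slope_term_def J_decay_term_def r log_cosh_higher_deriv by algebra+
  then show ?thesis by (simp add: J_conditions_def)
qed

lemma J_conditions_lower:
  assumes u: "tame u" and J: "J_conditions u a" and b: "0 < b" "b < a"
  shows "J_conditions u b"
proof -
  have C: "(deriv ^^ 2) u x > 0" for x by (rule tame_second_deriv_pos[OF u])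
  have "J_term u b x \<ge> J_term u a x" for x
    using b C[of x] by (simp add: J_term_def)
  moreover have "J_decay_term u b x \<ge> J_decay_term u a x" if "x \<ge> 0" for x
  proof -
    have "deriv_ratio 3 u x \<le> 0"
      using J b that by (intro deriv_ratio_3_nonpos[OF u, of a]) (auto simp: J_conditions_def)
    then have "deriv_ratio 3 u x * (deriv ^^ 2) u x \<le> 0" using C[of x] by (simp add: mult_le_0_iff)
    then have "a * (deriv_ratio 3 u x * (deriv ^^ 2) u x) \<le> b * (deriv_ratio 3 u x * (deriv ^^ 2) u x)"
      using b by (intro mult_right_mono_neg) auto
    then show ?thesis by (simp add: J_decay_term_def mult.assoc)
  qed
  ultimately show ?thesis using J unfolding J_conditions_def by (meson order_trans)
qed

text \<open>The induction carries \<open>a \<le> 1\<close> and \<open>tame\<close> because the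
  preservation of the inequalities under a transform depends on them.\<close>

lemma obtainable_tame:
  "obtainable u a \<Longrightarrow> 0 < a \<and> a \<le> 1 \<and> tame u \<and> J_conditions u a"
proof (induction rule: obtainable.induct)
  case start
  then show ?case using tame_log_cosh J_conditions_log_cosh by simp
next
  case (transform u a r)
  \<comment> \<open>The duration of the transform serves as the horizon, so that \<open>v r\<close>
    is covered by the statements on \<open>{0..r}\<close>.\<close>
  then interpret heat_flow u a r by unfold_locales auto
  have "log_transform a r u = v r" by (simp add: v_def)
  then show ?case using tame_v[of r] J_conditions_preserved[of r] transform by simp
next
  case (lower u a b)
  then show ?case using J_conditions_lower[of u a b] by simp
qed

section \<open>The slope as coordinate\<close>

locale slope_coordinate =
  fixes u :: "real \<Rightarrow> real" and a :: real
  assumes tame: "tame u" and a: "0 < a" and J: "J_conditions u a"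
begin

abbreviation D :: "nat \<Rightarrow> real \<Rightarrow> real" where "D k \<equiv> (deriv ^^ k) u"
abbreviation \<rho> :: "nat \<Rightarrow> real \<Rightarrow> real" where "\<rho> k \<equiv> deriv_ratio k u"
abbreviation X :: "real \<Rightarrow> real" where "X \<equiv> slope_point u"

lemma D1: "(deriv u has_real_derivative D 2 x) (at x)"
  using tame_higher_deriv[OF tame, of 1] by (simp add: numeral_2_eq_2)

lemma D2_pos: "D 2 x > 0"
  by (rule tame_second_deriv_pos[OF tame])

lemma slope_strict_mono: "x < y \<Longrightarrow> deriv u x < deriv u y"
  by (rule DERIV_pos_imp_increasing) (use D1 D2_pos in auto)

lemma slope_isCont: "isCont (deriv u) x"
  by (rule DERIV_isCont[OF D1])

lemma slope_odd: "deriv u (- x) = - deriv u x"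
  using tame_higher_deriv_parity[OF tame, of 1 x] by simp

lemma slope_tendsto: "(deriv u \<longlongrightarrow> 1) at_top"
proof -
  have db: "deriv_bounded (UNIV :: unit set) 0 tail_weight (\<lambda>_ x. deriv u x - 1)" using tame unfolding tame_def by blast
  then obtain M where M: "M \<ge> 0" "\<And>x. \<bar>deriv u x - 1\<bar> \<le> M * tail_weight x"
    using deriv_bounded_bound[OF db tail_weight_bounds(1)] by auto
  have "\<bar>deriv u x - 1\<bar> \<le> M * exp (- 2 * x)" for x
    by (rule order_trans[OF M(2) mult_left_mono[OF _ M(1)]]) (simp add: tail_weight_def)
  then have ev: "eventually (\<lambda>x. norm (deriv u x - 1) \<le> M * exp (- 2 * x)) at_top"
    by (intro always_eventually allI) simp
  have "((\<lambda>x::real. exp (- 2 * x)) \<longlongrightarrow> 0) at_top" by real_asymp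
  from Lim_null_comparison[OF ev tendsto_mult_right_zero[OF this]]
  have "((\<lambda>x. deriv u x - 1) \<longlongrightarrow> 0) at_top" .
  from tendsto_add[OF this tendsto_const[of 1]] show ?thesis by simp
qed

lemma slope_less_1: "deriv u x < 1"
proof -
  have "eventually (\<lambda>y. deriv u (x + 1) \<le> deriv u y) at_top"
    using eventually_ge_at_top[of "x + 1"]
    by eventually_elim (metis less_eq_real_def slope_strict_mono)
  from tendsto_lowerbound[OF slope_tendsto this] have "deriv u (x + 1) \<le> 1" by simp
  then show ?thesis using slope_strict_mono[of x "x + 1"] by simp
qed

lemma slope_surj:
  assumes "B \<in> {-1<..<1}"
  shows "\<exists>x. deriv u x = B"
proof -
  have "\<bar>B\<bar> < 1" using assms by auto
  then have "eventually (\<lambda>x. \<bar>B\<bar> < deriv u x) at_top" using slope_tendsto by (intro order_tendstoD)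
  then have "eventually (\<lambda>x. 0 \<le> x \<and> \<bar>B\<bar> < deriv u x) at_top"
    by (intro eventually_conj eventually_ge_at_top)
  then obtain N where N: "0 \<le> N" "\<bar>B\<bar> < deriv u N"
    using eventually_happens[of "\<lambda>x. 0 \<le> x \<and> \<bar>B\<bar> < deriv u x" at_top] trivial_limit_at_top_linorder by blast
  have "\<exists>x. - N \<le> x \<and> x \<le> N \<and> deriv u x = B"
    using N slope_odd[of N] slope_isCont by (intro IVT) auto
  then show ?thesis by blast
qed

lemma X_slope: "X (deriv u x) = x"
proof -
  have "y = x" if "deriv u y = deriv u x" for y
    using that slope_strict_mono[of x y] slope_strict_mono[of y x] by (cases x y rule: linorder_cases) auto
  then show ?thesis unfolding slope_point_def by blast
qed

lemma slope_X: "B \<in> {-1<..<1} \<Longrightarrow> deriv u (X B) = B"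
  using slope_surj X_slope by metis

lemma X_0: "X 0 = 0"
  using X_slope[of 0] slope_odd[of 0] by simp

lemma X_nonneg: "B \<in> {0..<1} \<Longrightarrow> X B \<ge> 0"
proof (rule ccontr)
  assume B: "B \<in> {0..<1}" and "\<not> X B \<ge> 0"
  then have "deriv u (X B) < deriv u 0" by (intro slope_strict_mono) auto
  then show False using slope_X[of B] B slope_odd[of 0] by auto
qed

lemma X_deriv:
  assumes "B \<in> {-1<..<1}"
  shows "(X has_real_derivative inverse (D 2 (X B))) (at B)"
proof -
  have "isCont X (deriv u (X B))"
    by (rule isCont_inverse_function[of 1]) (auto simp: X_slope slope_isCont)
  then have "isCont X B" using slope_X[OF assms] by simp
  moreover have "D 2 (X B) \<noteq> 0" using D2_pos[of "X B"] by simp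
  ultimately show ?thesis
    using assms by (intro DERIV_inverse_function[OF D1, of X B "-1" 1]) (auto intro: slope_X)
qed

lemma slope_coordinate_deriv:
  assumes "B \<in> {-1<..<1}" "(f has_real_derivative d) (at (X B))"
  shows "((\<lambda>b. f (X b)) has_real_derivative d / D 2 (X B)) (at B)"
  using DERIV_chain2[OF assms(2) X_deriv[OF assms(1)]] by (simp add: divide_inverse)

text \<open>\<open>slope_point\<close> is meaningful only on the open interval, so identities are
  known only there; derivatives, being local, still agree.\<close>

lemma deriv_cong_slope:
  assumes "B \<in> {-1<..<1}" "\<And>b. b \<in> {-1<..<1} \<Longrightarrow> f b = g b" "(g has_real_derivative d) (at B)"
  shows "(f has_real_derivative d) (at B)"
  by (rule has_field_derivative_transform_within_open[OF assms(3) _ assms(1)]) (use assms(2) in auto)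

lemma D2_deriv: "(D 2 has_real_derivative D 2 x * \<rho> 3 x) (at x)"
  using tame_higher_deriv[OF tame, of 2 x] D2_pos[of x] by (simp add: deriv_ratio_def numeral_eq_Suc)

section \<open>Curvature and \<open>J\<close> as functions of the slope\<close>

lemma curv_eq: "curv u B = D 2 (X B)"
  by (simp add: curv_def numeral_2_eq_2)

lemma curv_deriv: "B \<in> {-1<..<1} \<Longrightarrow> (curv u has_real_derivative \<rho> 3 (X B)) (at B)"
  unfolding curv_eq[abs_def] by (rule DERIV_cong[OF slope_coordinate_deriv[OF _ D2_deriv]]) (use D2_pos[of "X B"] in auto)

lemma deriv_curv: "B \<in> {-1<..<1} \<Longrightarrow> deriv (curv u) B = \<rho> 3 (X B)"
  by (rule DERIV_imp_deriv[OF curv_deriv])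

lemma deriv_curv_deriv:
  assumes "B \<in> {-1<..<1}"
  shows "(deriv (curv u) has_real_derivative (\<rho> 4 (X B) - \<rho> 3 (X B) * \<rho> 3 (X B)) / D 2 (X B)) (at B)"
proof -
  have "(\<rho> 3 has_real_derivative \<rho> 4 x - \<rho> 3 x * \<rho> 3 x) (at x)" for x
    using deriv_ratio_deriv[OF tame, of 3 x] by simp
  from deriv_cong_slope[OF assms deriv_curv slope_coordinate_deriv[OF assms this]] show ?thesis .
qed

lemma J_of_eq:
  assumes "B \<in> {-1<..<1}"
  shows "J_of u a B = J_term u a (X B) / (2 * D 2 (X B))"
  unfolding J_of_def DERIV_imp_deriv[OF deriv_curv_deriv[OF assms]]
  using D2_pos[of "X B"] by (simp add: J_term_def field_simps power2_eq_square)

lemma J_of_deriv: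
  assumes "B \<in> {-1<..<1}"
  shows "(J_of u a has_real_derivative J_slope_term u (X B) / (2 * D 2 (X B) ^ 2)) (at B)"
proof -
  let ?x = "X B"
  have nz: "D 2 x \<noteq> 0" for x using D2_pos[of x] by simp
  have d: "(\<rho> 3 has_real_derivative \<rho> 4 x - \<rho> 3 x * \<rho> 3 x) (at x)" "(\<rho> 4 has_real_derivative \<rho> 5 x - \<rho> 4 x * \<rho> 3 x) (at x)" for x
    using deriv_ratio_deriv[OF tame, of 3 x] deriv_ratio_deriv[OF tame, of 4 x] by simp_all
  \<comment> \<open>The part \<open>- 2 * a * u''\<close> of \<open>J_term\<close>, divided by
    \<open>2 * u''\<close>, is the constant \<open>- a\<close>; it is split off and differentiates
    to 0.\<close>
  have "((\<lambda>x. ((\<rho> 3 x)\<^sup>2 - \<rho> 4 x) * inverse (D 2 x) / 2 - a) has_real_derivative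
      J_slope_term u ?x * inverse (D 2 ?x) / 2) (at ?x)"
  proof -
    have i: "((\<lambda>x. inverse (D 2 x)) has_real_derivative - (inverse (D 2 ?x) * \<rho> 3 ?x)) (at ?x)"
      by (rule DERIV_cong[OF DERIV_inverse'[OF D2_deriv nz]]) (use nz[of ?x] in simp)
    have n: "((\<lambda>x. (\<rho> 3 x)\<^sup>2 - \<rho> 4 x) has_real_derivative
        2 * (\<rho> 4 ?x - \<rho> 3 ?x * \<rho> 3 ?x) * \<rho> 3 ?x - (\<rho> 5 ?x - \<rho> 4 ?x * \<rho> 3 ?x)) (at ?x)"
      by (rule DERIV_cong[OF DERIV_diff[OF DERIV_power[OF d(1), of 2] d(2)]]) simp
    show ?thesis
      by (rule DERIV_cong[OF DERIV_diff[OF DERIV_cdivide[OF DERIV_mult[OF n i]] DERIV_const]])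
        (use nz[of ?x] in \<open>simp add: J_slope_term_def field_simps power2_eq_square power3_eq_cube\<close>)
  qed
  from slope_coordinate_deriv[OF assms this]
  have *: "((\<lambda>b. ((\<rho> 3 (X b))\<^sup>2 - \<rho> 4 (X b)) * inverse (D 2 (X b)) / 2 - a) has_real_derivative
      J_slope_term u ?x / (2 * D 2 ?x ^ 2)) (at B)"
    using nz[of ?x] by (simp add: field_simps power2_eq_square)
  show ?thesis
    by (rule deriv_cong_slope[OF assms _ *])
      (use nz in \<open>simp add: J_of_eq J_term_def field_simps\<close>)
qed

lemma J_of_nonneg: "B \<in> {-1<..<1} \<Longrightarrow> J_of u a B \<ge> 0"
  using J D2_pos[of "X B"] by (simp add: J_of_eq J_conditions_def)

lemma deriv_J_of: "B \<in> {-1<..<1} \<Longrightarrow> deriv (J_of u a) B = J_slope_term u (X B) / (2 * D 2 (X B) ^ 2)"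
  by (rule DERIV_imp_deriv[OF J_of_deriv])

lemma deriv_J_of_nonneg: "B \<in> {0..<1} \<Longrightarrow> deriv (J_of u a) B \<ge> 0"
  using J X_nonneg[of B] by (simp add: deriv_J_of J_conditions_def)

lemma odd_ratios_0: "\<rho> 3 0 = 0" "\<rho> 5 0 = 0"
  using tame_higher_deriv_parity[OF tame, of 3 0] tame_higher_deriv_parity[OF tame, of 5 0]
  by (simp_all add: deriv_ratio_def)

lemma J_of_deriv_0: "(J_of u a has_real_derivative 0) (at 0)"
  using J_of_deriv[of 0] by (simp add: J_slope_term_def X_0 odd_ratios_0)

lemma J_of_mono:
  assumes "0 \<le> b" "b \<le> B" "B < 1"
  shows "J_of u a b \<le> J_of u a B"
proof (rule DERIV_nonneg_imp_nondecreasing[OF assms(2)])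
  fix y assume "b \<le> y" "y \<le> B"
  then show "\<exists>d. (J_of u a has_real_derivative d) (at y) \<and> 0 \<le> d"
    using J_of_deriv[of y] deriv_J_of[of y] deriv_J_of_nonneg[of y] assms by auto
qed

text \<open>Up to the positive factor \<open>C^(1/2)\<close> the left side is
  \<open>(C^(3/2) J)_B\<close>, and since \<open>z = - C_B / 2\<close> it is also
  \<open>C J_B - 3 z J\<close>; the last two inequalities of the theorem are thus the sign of one
  quantity.\<close>

lemma curv_J_defect:
  assumes "B \<in> {-1<..<1}"
  shows "curv u B * deriv (J_of u a) B + 3 / 2 * deriv (curv u) B * J_of u a B
    = - J_decay_term u a (X B) / (4 * D 2 (X B))"
  unfolding curv_eq deriv_curv[OF assms] deriv_J_of[OF assms] J_of_eq[OF assms]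
    J_term_def J_slope_term_def J_decay_term_def
  using D2_pos[of "X B"] by (simp add: field_simps power2_eq_square power3_eq_cube)

lemma curv_J_defect_nonpos:
  "B \<in> {0..<1} \<Longrightarrow> curv u B * deriv (J_of u a) B + 3 / 2 * deriv (curv u) B * J_of u a B \<le> 0"
  using curv_J_defect[of B] J X_nonneg[of B] D2_pos[of "X B"] by (simp add: J_conditions_def)

lemma weighted_J_deriv:
  assumes "B \<in> {0..<1}"
  shows "deriv (\<lambda>b. curv u b powr (3 / 2) * J_of u a b) B \<le> 0"
proof -
  have B: "B \<in> {-1<..<1}" using assms by auto
  have C: "curv u B > 0" by (simp add: curv_eq D2_pos)
  have "((\<lambda>b. curv u b powr (3 / 2)) has_real_derivative 3 / 2 * curv u B powr (3 / 2 - 1) * deriv (curv u) B) (at B)"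
    using DERIV_chain2[OF has_real_derivative_powr[OF C, of "3 / 2"] curv_deriv[OF B]] by (simp add: deriv_curv[OF B])
  from DERIV_mult[OF this J_of_deriv[OF B]]
  have "((\<lambda>b. curv u b powr (3 / 2) * J_of u a b) has_real_derivative
      3 / 2 * curv u B powr (3 / 2 - 1) * deriv (curv u) B * J_of u a B
        + deriv (J_of u a) B * curv u B powr (3 / 2)) (at B)"
    by (simp add: deriv_J_of[OF B])
  from DERIV_imp_deriv[OF this]
  have "deriv (\<lambda>b. curv u b powr (3 / 2) * J_of u a b) B =
      3 / 2 * curv u B powr (3 / 2 - 1) * deriv (curv u) B * J_of u a B
        + deriv (J_of u a) B * curv u B powr (3 / 2)" .
  also have "curv u B powr (3 / 2) = curv u B powr (3 / 2 - 1) * curv u B"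
    using powr_add[of "curv u B" "3 / 2 - 1" 1] C by simp
  also have "3 / 2 * curv u B powr (3 / 2 - 1) * deriv (curv u) B * J_of u a B
        + deriv (J_of u a) B * (curv u B powr (3 / 2 - 1) * curv u B)
      = curv u B powr (3 / 2 - 1) * (curv u B * deriv (J_of u a) B + 3 / 2 * deriv (curv u) B * J_of u a B)"
    by (simp only: algebra_simps)
  also have "\<dots> \<le> 0" using curv_J_defect_nonpos[OF assms] by (intro mult_nonneg_nonpos) auto
  finally show ?thesis .
qed

section \<open>The functions \<open>z\<close> and \<open>K\<close> of the slope\<close>

definition \<zeta> :: "real \<Rightarrow> real" where "\<zeta> B = - 1 / 2 * deriv (curv u) B"

lemma zeta_deriv: "B \<in> {-1<..<1} \<Longrightarrow> (\<zeta> has_real_derivative a + J_of u a B) (at B)"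
  unfolding \<zeta>_def[abs_def] J_of_def
  by (rule DERIV_cong[OF DERIV_cmult[OF deriv_curv_deriv]])
    (simp_all add: DERIV_imp_deriv[OF deriv_curv_deriv])

lemma zeta_0: "\<zeta> 0 = 0"
  by (simp add: \<zeta>_def deriv_curv X_0 odd_ratios_0)

lemma K_of_nonzero: "B \<noteq> 0 \<Longrightarrow> K_of u a B = \<zeta> B / B - a"
  by (simp add: K_of_def A_of_def \<zeta>_def)

text \<open>\<open>\<zeta> b / b\<close> is a difference quotient of \<open>\<zeta>\<close> at 0, so
  its limit is the derivative \<open>a + J_of u a 0\<close>.\<close>

lemma K_of_0: "K_of u a 0 = J_of u a 0"
proof -
  have "((\<lambda>b. \<zeta> b / b) \<longlongrightarrow> a + J_of u a 0) (at 0)"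
    using zeta_deriv[of 0] by (simp add: has_field_derivative_iff zeta_0)
  then have "((\<lambda>b. - deriv (curv u) b / (2 * b)) \<longlongrightarrow> a + J_of u a 0) (at 0)"
    by (simp add: \<zeta>_def)
  from tendsto_Lim[OF _ this] show ?thesis by (simp add: K_of_def A_of_def)
qed

text \<open>\<open>b\<close> is kept on the nonnegative side when \<open>B\<close> is, because
  monotonicity of \<open>J\<close> is available there; negative \<open>B\<close> serves the
  two-sided derivative at 0.\<close>

lemma zeta_mean_value:
  assumes "B \<in> {-1<..<1}"
  shows "\<exists>b. \<bar>b\<bar> \<le> \<bar>B\<bar> \<and> (B \<ge> 0 \<longrightarrow> b \<ge> 0) \<and> \<zeta> B = (a + J_of u a b) * B"
proof -
  consider "B = 0" | "B > 0" | "B < 0" by linarith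
  then show ?thesis
  proof cases
    case 1 then show ?thesis using zeta_0 by auto
  next
    case 2
    have "\<exists>b. 0 < b \<and> b < B \<and> \<zeta> B - \<zeta> 0 = (B - 0) * (a + J_of u a b)"
      using assms 2 by (intro MVT2 zeta_deriv) auto
    then obtain b where "0 < b" "b < B" "\<zeta> B = (a + J_of u a b) * B" using zeta_0 by (auto simp: mult.commute)
    then show ?thesis by (intro exI[of _ b]) auto
  next
    case 3
    have "\<exists>b. B < b \<and> b < 0 \<and> \<zeta> 0 - \<zeta> B = (0 - B) * (a + J_of u a b)"
      using assms 3 by (intro MVT2 zeta_deriv) auto
    then obtain b where "B < b" "b < 0" "\<zeta> B = (a + J_of u a b) * B" using zeta_0 by (auto simp: mult.commute)
    then show ?thesis using 3 by (intro exI[of _ b]) auto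
  qed
qed

lemma K_of_mean_value:
  assumes "B \<in> {-1<..<1}"
  shows "\<exists>b. \<bar>b\<bar> \<le> \<bar>B\<bar> \<and> (B \<ge> 0 \<longrightarrow> b \<ge> 0) \<and> K_of u a B = J_of u a b"
proof (cases "B = 0")
  case True then show ?thesis using K_of_0 by auto
next
  case False
  obtain b where b: "\<bar>b\<bar> \<le> \<bar>B\<bar>" "B \<ge> 0 \<longrightarrow> b \<ge> 0" "\<zeta> B = (a + J_of u a b) * B"
    using zeta_mean_value[OF assms] by blast
  have "K_of u a B = J_of u a b" using K_of_nonzero[OF False] b(3) False by simp
  then show ?thesis using b by blast
qed

lemma K_of_nonneg:
  assumes "B \<in> {0..<1}"
  shows "K_of u a B \<ge> 0"
proof -
  obtain b where "\<bar>b\<bar> \<le> \<bar>B\<bar>" "K_of u a B = J_of u a b" using K_of_mean_value[of B] assms by auto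
  moreover from this(1) have "b \<in> {-1<..<1}" using assms by (auto simp: abs_le_iff)
  ultimately show ?thesis using J_of_nonneg[of b] by simp
qed

text \<open>By the mean value theorem \<open>K B = J b\<close> with \<open>\<bar>b\<bar> \<le> \<bar>B\<bar>\<close>, so \<open>K\<close> inherits the vanishing
  derivative of the even function \<open>J\<close>.\<close>

lemma K_of_deriv_0: "(K_of u a has_real_derivative 0) (at 0)"
  unfolding has_field_derivative_iff LIM_def
proof (intro allI impI)
  fix e :: real assume e: "e > 0"
  have "((\<lambda>y. (J_of u a y - J_of u a 0) / (y - 0)) \<longlongrightarrow> 0) (at 0)"
    using J_of_deriv_0 unfolding has_field_derivative_iff .
  \<comment> \<open>Half of \<open>e\<close> leaves room for the strict inequality at the
    end.\<close>
  then obtain s where s: "s > 0" "\<And>y. y \<noteq> 0 \<Longrightarrow> \<bar>y\<bar> < s \<Longrightarrow> \<bar>(J_of u a y - J_of u a 0) / y\<bar> < e / 2"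
    using LIM_D[of "\<lambda>y. (J_of u a y - J_of u a 0) / (y - 0)" 0 0 "e / 2"] e by auto
  have J: "\<bar>J_of u a y - J_of u a 0\<bar> \<le> e / 2 * \<bar>y\<bar>" if "\<bar>y\<bar> < s" for y
  proof (cases "y = 0")
    case False
    then show ?thesis using s(2)[OF False that] by (simp add: abs_divide pos_divide_less_eq)
  qed simp
  show "\<exists>s>0. \<forall>y. y \<noteq> 0 \<and> dist y 0 < s \<longrightarrow> dist ((K_of u a y - K_of u a 0) / (y - 0)) 0 < e"
  \<comment> \<open>The bound 1 keeps \<open>y\<close> inside the slope range, where the mean value
    statement applies.\<close>
  proof (intro exI[of _ "min s 1"] conjI allI impI)
    fix y :: real assume y: "y \<noteq> 0 \<and> dist y 0 < min s 1"
    then obtain b where b: "\<bar>b\<bar> \<le> \<bar>y\<bar>" "K_of u a y = J_of u a b" using K_of_mean_value[of y] by (auto simp: abs_less_iff)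
    have "\<bar>K_of u a y - K_of u a 0\<bar> \<le> e / 2 * \<bar>b\<bar>" using J[of b] b y K_of_0 by simp
    also have "\<dots> \<le> e / 2 * \<bar>y\<bar>" using b e by (intro mult_left_mono) auto
    also have "\<dots> < e * \<bar>y\<bar>" using e y by simp
    finally show "dist ((K_of u a y - K_of u a 0) / (y - 0)) 0 < e"
      using y by (simp add: abs_divide pos_divide_less_eq)
  qed (use s in auto)
qed

text \<open>\<open>K\<close> is the mean of \<open>J\<close> over \<open>{0..B}\<close>, and the
  mean of a nondecreasing function does not exceed its last value; at the mean value point this
  gives the sign of \<open>B\<^sup>2 * K_B = (a + J) * B - \<zeta>\<close>.\<close>

lemma deriv_K_of_nonneg:
  assumes "B \<in> {0..<1}"
  shows "deriv (K_of u a) B \<ge> 0"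
proof (cases "B = 0")
  case True then show ?thesis using DERIV_imp_deriv[OF K_of_deriv_0] by simp
next
  case False
  then have B: "B > 0" "B \<in> {-1<..<1}" using assms by auto
  have "((\<lambda>b. \<zeta> b / b - a) has_real_derivative ((a + J_of u a B) * B - \<zeta> B) / (B * B)) (at B)"
    using DERIV_diff[OF DERIV_divide[OF zeta_deriv[OF B(2)] DERIV_ident False] DERIV_const[of a]] by simp
  then have "(K_of u a has_real_derivative ((a + J_of u a B) * B - \<zeta> B) / (B * B)) (at B)"
    by (rule has_field_derivative_transform_within_open[of _ _ _ "{0<..}"]) (use B in \<open>auto simp: K_of_nonzero\<close>)
  then have "deriv (K_of u a) B = ((a + J_of u a B) * B - \<zeta> B) / (B * B)" by (rule DERIV_imp_deriv)
  moreover obtain b where b: "\<bar>b\<bar> \<le> \<bar>B\<bar>" "B \<ge> 0 \<longrightarrow> b \<ge> 0" "\<zeta> B = (a + J_of u a b) * B"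
    using zeta_mean_value[OF B(2)] by blast
  have "J_of u a b \<le> J_of u a B" using b(1,2) B by (intro J_of_mono) auto
  then have "\<zeta> B \<le> (a + J_of u a B) * B" unfolding b(3) using B by (intro mult_right_mono) auto
  ultimately show ?thesis using B by simp
qed

end

theorem proposition3p6:
  fixes u :: "real \<Rightarrow> real" and a B :: real
  assumes "obtainable u a" and "0 \<le> B" and "B < 1"
  defines "C \<equiv> curv u" and "K \<equiv> K_of u a" and "J \<equiv> J_of u a"
  defines "z \<equiv> - 1 / 2 * deriv C B"
  shows "K B \<ge> 0 \<and> deriv K B \<ge> 0 \<and> J B \<ge> 0 \<and> deriv J B \<ge> 0
    \<and> deriv (\<lambda>b. C b powr (3 / 2) * J b) B \<le> 0
    \<and> z = (a + K B) * B
    \<and> C B * deriv J B \<le> 3 * z * J B"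
proof -
  interpret slope_coordinate u a
    using obtainable_tame[OF assms(1)] by unfold_locales auto
  have B: "B \<in> {0..<1}" "B \<in> {-1<..<1}" using assms(2,3) by auto
  have z: "z = \<zeta> B" by (simp add: z_def C_def \<zeta>_def)
  \<comment> \<open>At \<open>B = 0\<close> both sides vanish, since \<open>\<zeta>\<close> is
    odd.\<close>
  have "z = (a + K B) * B"
    using zeta_0 K_of_nonzero[of B] by (cases "B = 0") (simp_all add: z K_def)
  moreover have "C B * deriv J B \<le> 3 * z * J B"
    using curv_J_defect_nonpos[OF B(1)] by (simp add: z_def C_def J_def)
  ultimately show ?thesis
    using K_of_nonneg[OF B(1)] deriv_K_of_nonneg[OF B(1)] J_of_nonneg[OF B(2)]
      deriv_J_of_nonneg[OF B(1)] weighted_J_deriv[OF B(1)]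
    by (simp add: C_def K_def J_def)
qed

end
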